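(* Let $N\ge n\ge1$ and let $F=(f_1,\dots,f_N):\mathbb{B}^n\to\mathbb{B}^N$ be a minimum proper holomorphic map in which each component is a monomial $f_i=c_iz^{\alpha_i}$ with $\alpha_i$ a multi-index and $c_i\in\mathbb{R}$. Fix $\theta\in(0,\pi/4)$ and define $M^{N+1}_F=\big(f_1,\dots,f_N,1-\sqrt{1-\sum_{i=1}^Nf_i^2}\big)$, and for $2\le k\le N+1$, $M^{N+k}_F=\big(\cos\theta f_1,\sqrt{-1}\sin\theta f_1,\dots,\cos\theta f_{k-1},\sqrt{-1}\sin\theta f_{k-1},f_k,\dots,f_N,1-\sqrt{1-\cos(2\theta)\sum_{j=1}^{k-1}f_j^2-\sum_{j=k}^Nf_j^2}\big)$ (with the block $f_k,\dots,f_N$ empty when $k=N+1$). Then for each $1\le k\le N+1$, $M^{N+k}_F$ is a minimum proper holomorphic map from $\mathbb{B}^n$ to $D^{IV}_{N+k}$.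
   Context: $\mathbb{B}^n=\{z\in\mathbb{C}^n:|z|^2<1\}$; $D^{IV}_m=\{Z\in\mathbb{C}^m: Z\overline{Z}^t<2,\ 1-Z\overline{Z}^t+\tfrac14|ZZ^t|^2>0\}$ (row vectors). $\sqrt{\cdot}$ is the branch with $\sqrt1=1$ (radicands are $1-w$ with $|w|<1$). Proper means preimages of compact sets are compact. A proper holomorphic map $F:\mathbb{B}^n\to\mathbb{B}^N$ is minimum if it is not of the form $\phi\circ(G,0)\circ\psi$ with $\psi\in\mathrm{Aut}(\mathbb{B}^n)$, $\phi\in\mathrm{Aut}(\mathbb{B}^N)$ and $G:\mathbb{B}^n\to\mathbb{B}^{N-1}$ holomorphic. Maps $F_1,F_2:\mathbb{B}^n\to D^{IV}_m$ are equivalent if $F_1=\phi\circ F_2\circ\psi$ with $\psi\in\mathrm{Aut}(\mathbb{B}^n)$, $\phi\in\mathrm{Aut}(D^{IV}_m)$; a holomorphic map $F:\mathbb{B}^n\to D^{IV}_m$ is minimum if there is no holomorphic $G:\mathbb{B}^n\to D^{IV}_{m-1}$ with $F$ equivalent to $(G,0)$. *)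

theory Defs
  imports "HOL-Analysis.Analysis"
begin

text \<open>Points of C^a are represented as functions nat => complex vanishing at
indices >= a (coordinate i of the paper is index i-1 here). The type
nat => complex carries the product topology (HOL-Analysis Function_Topology),
which on the subspace cvec a is the Euclidean topology of C^a.\<close>

definition cvec :: "nat \<Rightarrow> (nat \<Rightarrow> complex) set" where
  "cvec a = {z. \<forall>i\<ge>a. z i = 0}"

definition cnorm :: "nat \<Rightarrow> (nat \<Rightarrow> complex) \<Rightarrow> real" where
  "cnorm a z = sqrt (\<Sum>i<a. (cmod (z i))\<^sup>2)"

definition holo_comp :: "nat \<Rightarrow> (nat \<Rightarrow> complex) set \<Rightarrow> ((nat \<Rightarrow> complex) \<Rightarrow> complex) \<Rightarrow> bool" where
  "holo_comp a D g \<longleftrightarrow> (\<forall>z\<in>D. \<exists>d::nat \<Rightarrow> complex.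
     ((\<lambda>h. (g (\<lambda>i. z i + h i) - g z - (\<Sum>i<a. d i * h i)) / complex_of_real (cnorm a h))
        \<longlongrightarrow> 0) (at (\<lambda>i. 0) within cvec a))"

definition holo_map :: "nat \<Rightarrow> nat \<Rightarrow> (nat \<Rightarrow> complex) set \<Rightarrow> ((nat \<Rightarrow> complex) \<Rightarrow> (nat \<Rightarrow> complex)) \<Rightarrow> bool" where
  "holo_map a b D G \<longleftrightarrow> (\<forall>z\<in>D. G z \<in> cvec b) \<and> (\<forall>j<b. holo_comp a D (\<lambda>z. G z j))"

definition maps_into :: "('a \<Rightarrow> 'b) \<Rightarrow> 'a set \<Rightarrow> 'b set \<Rightarrow> bool" where
  "maps_into G D E \<longleftrightarrow> (\<forall>z\<in>D. G z \<in> E)"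

definition proper_on :: "((nat \<Rightarrow> complex) \<Rightarrow> (nat \<Rightarrow> complex)) \<Rightarrow> (nat \<Rightarrow> complex) set \<Rightarrow> (nat \<Rightarrow> complex) set \<Rightarrow> bool" where
  "proper_on G D E \<longleftrightarrow> (\<forall>K. K \<subseteq> E \<and> compact K \<longrightarrow> compact {z\<in>D. G z \<in> K})"

definition proper_holo :: "nat \<Rightarrow> nat \<Rightarrow> (nat \<Rightarrow> complex) set \<Rightarrow> (nat \<Rightarrow> complex) set \<Rightarrow> ((nat \<Rightarrow> complex) \<Rightarrow> (nat \<Rightarrow> complex)) \<Rightarrow> bool" where
  "proper_holo a b D E G \<longleftrightarrow> holo_map a b D G \<and> maps_into G D E \<and> proper_on G D E"

definition Aut :: "nat \<Rightarrow> (nat \<Rightarrow> complex) set \<Rightarrow> ((nat \<Rightarrow> complex) \<Rightarrow> (nat \<Rightarrow> complex)) set" where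
  "Aut a D = {\<phi>. holo_map a a D \<phi> \<and> bij_betw \<phi> D D \<and> holo_map a a D (inv_into D \<phi>)}"

definition cball_unit :: "nat \<Rightarrow> (nat \<Rightarrow> complex) set" where
  "cball_unit a = {z \<in> cvec a. (\<Sum>i<a. (cmod (z i))\<^sup>2) < 1}"

definition DIV :: "nat \<Rightarrow> (nat \<Rightarrow> complex) set" where
  "DIV m = {Z \<in> cvec m. (\<Sum>i<m. (cmod (Z i))\<^sup>2) < 2 \<and>
      1 - (\<Sum>i<m. (cmod (Z i))\<^sup>2) + (cmod (\<Sum>i<m. (Z i)\<^sup>2))\<^sup>2 / 4 > 0}"

text \<open>Minimum proper holomorphic map B^n -> B^N. Since G maps into B^(N-1), the
point G w of C^(N-1) (coordinates >= N-1 vanish) is exactly (G w, 0) in C^N.\<close>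
definition minimum_ball_map :: "nat \<Rightarrow> nat \<Rightarrow> ((nat \<Rightarrow> complex) \<Rightarrow> (nat \<Rightarrow> complex)) \<Rightarrow> bool" where
  "minimum_ball_map n N F \<longleftrightarrow> proper_holo n N (cball_unit n) (cball_unit N) F \<and>
     \<not> (\<exists>\<psi>\<in>Aut n (cball_unit n). \<exists>\<phi>\<in>Aut N (cball_unit N). \<exists>G.
          holo_map n (N - 1) (cball_unit n) G \<and> maps_into G (cball_unit n) (cball_unit (N - 1)) \<and>
          (\<forall>z\<in>cball_unit n. F z = \<phi> (G (\<psi> z))))"

definition minimum_DIV_map :: "nat \<Rightarrow> nat \<Rightarrow> ((nat \<Rightarrow> complex) \<Rightarrow> (nat \<Rightarrow> complex)) \<Rightarrow> bool" where
  "minimum_DIV_map n m F \<longleftrightarrow> holo_map n m (cball_unit n) F \<and> maps_into F (cball_unit n) (DIV m) \<and>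
     \<not> (\<exists>\<psi>\<in>Aut n (cball_unit n). \<exists>\<phi>\<in>Aut m (DIV m). \<exists>G.
          holo_map n (m - 1) (cball_unit n) G \<and> maps_into G (cball_unit n) (DIV (m - 1)) \<and>
          (\<forall>z\<in>cball_unit n. F z = \<phi> (G (\<psi> z))))"

definition monomial_map :: "nat \<Rightarrow> nat \<Rightarrow> (nat \<Rightarrow> real) \<Rightarrow> (nat \<Rightarrow> nat \<Rightarrow> nat) \<Rightarrow> (nat \<Rightarrow> complex) \<Rightarrow> (nat \<Rightarrow> complex)" where
  "monomial_map n N c \<alpha> z = (\<lambda>i. if i < N then complex_of_real (c i) * (\<Prod>j<n. (z j) ^ (\<alpha> i j)) else 0)"

text \<open>M^(N+k)_F for 1 <= k <= N+1 (0-based coordinates; k = 1 gives M^(N+1)_F since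
cos(2 theta) multiplies an empty sum):
positions 2j, 2j+1 (j < k-1): cos theta f_j, i sin theta f_j;
positions 2(k-1)+t (t < N-k+1): f_(k-1+t);
position N+k-1: 1 - sqrt(1 - cos(2 theta) sum_(j<k-1) f_j^2 - sum_(k-1<=j<N) f_j^2).\<close>
definition Mmap :: "nat \<Rightarrow> ((nat \<Rightarrow> complex) \<Rightarrow> (nat \<Rightarrow> complex)) \<Rightarrow> real \<Rightarrow> nat \<Rightarrow> (nat \<Rightarrow> complex) \<Rightarrow> (nat \<Rightarrow> complex)" where
  "Mmap N F \<theta> k z = (\<lambda>p.
     if p < 2 * (k - 1) then
       (if even p then complex_of_real (cos \<theta>) * F z (p div 2)
        else \<i> * complex_of_real (sin \<theta>) * F z (p div 2))
     else if p < N + k - 1 then F z (p - (k - 1))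
     else if p = N + k - 1 then
       1 - csqrt (1 - complex_of_real (cos (2 * \<theta>)) * (\<Sum>j<k - 1. (F z j)\<^sup>2)
                 - (\<Sum>j\<in>{k - 1..<N}. (F z j)\<^sup>2))
     else 0)"

end

theory Submission
  imports Defs "HOL-Complex_Analysis.Complex_Analysis"
begin

text \<open>Write \<open>h\<close> for the last component of the map \<open>M\<close> built from \<open>F\<close>. The radicand is chosen so that \<open>M M\<^sup>t = 2 h\<close>; hence
  \<open>1 - |M|\<^sup>2 + |M M\<^sup>t|\<^sup>2/4 = 1 - |F|\<^sup>2\<close>, and \<open>M\<close> inherits properness from \<open>F\<close>.

  Suppose that \<open>M = \<phi> \<circ> (G,0) \<circ> \<psi>\<close>, let \<open>\<sigma>\<close> change the sign of the last coordinate and put \<open>\<tau> = \<phi> \<sigma> \<phi>\<^sup>-\<^sup>1\<close>, an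
  involution different from the identity that fixes every point of the image of \<open>M\<close>.
  Minimality of \<open>F\<close> makes its components pairwise non-proportional nonconstant monomials, so \<open>M(0) = 0\<close> and
  \<open>\<tau>\<close> is linear by Cartan's theorem. The functions \<open>f\<^sub>1, \<dots>, f\<^sub>N, h\<close> are linearly independent, so \<open>\<tau>\<close> fixes the
  last unit vector \<open>e\<close> and all coefficient vectors of the \<open>f\<^sub>j\<close>. A linear automorphism fixing \<open>e\<close> preserves
  the tangent cone at the boundary point \<open>\<surd>2 e\<close>, which forces its matrix to be real. A real matrix that
  fixes \<open>cos \<theta> e\<^sub>p + \<i> sin \<theta> e\<^sub>q\<close> fixes \<open>e\<^sub>p\<close> and \<open>e\<^sub>q\<close>, so \<open>\<tau>\<close> is the identity, a contradiction.\<close>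

section \<open>Complex differentiability in finitely many variables\<close>

text \<open>The automorphism group of the Lie ball is never described. A single map
  \<open>\<tau>\<close> yields the contradiction, and its linearity and reality come from general
  principles: boundedness of the domain and the shape of the boundary at one point. On the tangent
  cone there, the last coordinate has a negative real part that dominates the imaginary parts of the
  others. So the cone tells real from imaginary directions; \<open>e\<close> must be known to be
  fixed before this can be exploited. Independence of \<open>h\<close> from the components of
  \<open>F\<close> is tested on a curve along which all monomials are real: a relation would make
  \<open>sqrt (1 - S)\<close> a real polynomial in the parameter, with \<open>S\<close> a sum of
  squares with weights 1 and \<open>cos (2 * \<theta>)\<close>, positive because
  \<open>\<theta> < pi / 4\<close>. Minimality of \<open>F\<close> is exploited through explicit
  automorphisms of the ball: a Moebius map would remove a constant component, and a reflection would
  remove one of two proportional components.\<close>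

lemma tendsto_componentwise:
  fixes f :: "'a \<Rightarrow> 'i \<Rightarrow> 'b::topological_space"
  shows "(f \<longlongrightarrow> l) F \<longleftrightarrow> (\<forall>i. ((\<lambda>x. f x i) \<longlongrightarrow> l i) F)"
  using limitin_componentwise[of "\<lambda>_. euclidean" UNIV f l F]
  by (simp add: euclidean_product_topology)

lemma cnorm_nonneg: "0 \<le> cnorm a h"
  by (simp add: cnorm_def sum_nonneg)

lemma cmod_le_cnorm: "i < a \<Longrightarrow> cmod (h i) \<le> cnorm a h"
  unfolding cnorm_def by (intro real_le_rsqrt member_le_sum) auto

lemma cnorm_le_sum: "cnorm a h \<le> (\<Sum>i<a. cmod (h i))"
  using L2_set_le_sum[of "{..<a}" "\<lambda>i. cmod (h i)"] by (simp add: cnorm_def L2_set_def)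

lemma cnorm_eq_0: "h \<in> cvec a \<Longrightarrow> cnorm a h = 0 \<Longrightarrow> h = (\<lambda>i. 0)"
proof (rule ext)
  fix i assume "h \<in> cvec a" "cnorm a h = 0"
  then show "h i = 0" using cmod_le_cnorm[of i a h] by (cases "i < a") (auto simp: cvec_def)
qed

lemma cvec_add: "u \<in> cvec a \<Longrightarrow> v \<in> cvec a \<Longrightarrow> (\<lambda>i. u i + v i) \<in> cvec a"
  and cvec_diff: "u \<in> cvec a \<Longrightarrow> v \<in> cvec a \<Longrightarrow> (\<lambda>i. u i - v i) \<in> cvec a"
  and cvec_smult: "u \<in> cvec a \<Longrightarrow> (\<lambda>i. c * u i) \<in> cvec a"
  by (auto simp: cvec_def)

text \<open>The limit in \<open>holo_comp\<close> with the quotient multiplied out: the estimate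
  composes without division by \<open>cnorm a h\<close>, and at \<open>h = 0\<close> it holds
  trivially.\<close>

definition has_cgrad ::
  "nat \<Rightarrow> (nat \<Rightarrow> complex) \<Rightarrow> ((nat \<Rightarrow> complex) \<Rightarrow> complex) \<Rightarrow> (nat \<Rightarrow> complex) \<Rightarrow> bool" where
  "has_cgrad a z g d \<longleftrightarrow> (\<forall>\<epsilon>>0. \<forall>\<^sub>F h in at (\<lambda>i. 0) within cvec a.
     cmod (g (\<lambda>i. z i + h i) - g z - (\<Sum>i<a. d i * h i)) \<le> \<epsilon> * cnorm a h)"

lemma holo_comp_iff: "holo_comp a D g \<longleftrightarrow> (\<forall>z\<in>D. \<exists>d. has_cgrad a z g d)"
proof -
  have "((\<lambda>h. (g (\<lambda>i. z i + h i) - g z - (\<Sum>i<a. d i * h i)) / complex_of_real (cnorm a h))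
        \<longlongrightarrow> 0) (at (\<lambda>i. 0) within cvec a) \<longleftrightarrow> has_cgrad a z g d" (is "?L \<longleftrightarrow> ?R") for z d
  proof -
    define r where "r h = g (\<lambda>i. z i + h i) - g z - (\<Sum>i<a. d i * h i)" for h
    have pos: "\<forall>\<^sub>F h in at (\<lambda>i. 0) within cvec a. 0 < cnorm a h"
      unfolding eventually_at_filter
    proof (intro always_eventually allI impI)
      fix h assume "h \<noteq> (\<lambda>i. 0)" "h \<in> cvec a"
      then have "cnorm a h \<noteq> 0" using cnorm_eq_0 by blast
      then show "0 < cnorm a h" using cnorm_nonneg[of a h] by linarith
    qed
    have "?L \<longleftrightarrow> (\<forall>\<epsilon>>0. \<forall>\<^sub>F h in at (\<lambda>i. 0) within cvec a. cmod (r h) / cnorm a h < \<epsilon>)"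
      unfolding tendsto_iff r_def
      by (simp add: dist_norm norm_divide cnorm_nonneg)
    also have "\<dots> \<longleftrightarrow> (\<forall>\<epsilon>>0. \<forall>\<^sub>F h in at (\<lambda>i. 0) within cvec a. cmod (r h) \<le> \<epsilon> * cnorm a h)"
    proof (intro iffI allI impI)
      fix \<epsilon> :: real assume "0 < \<epsilon>"
        and *: "\<forall>\<epsilon>>0. \<forall>\<^sub>F h in at (\<lambda>i. 0) within cvec a. cmod (r h) / cnorm a h < \<epsilon>"
      from *[rule_format, OF \<open>0 < \<epsilon>\<close>] pos
      show "\<forall>\<^sub>F h in at (\<lambda>i. 0) within cvec a. cmod (r h) \<le> \<epsilon> * cnorm a h"
        by eventually_elim (simp add: field_simps)
    next
      fix \<epsilon> :: real assume "0 < \<epsilon>"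
        and *: "\<forall>\<epsilon>>0. \<forall>\<^sub>F h in at (\<lambda>i. 0) within cvec a. cmod (r h) \<le> \<epsilon> * cnorm a h"
      have "0 < \<epsilon>/2" using \<open>0 < \<epsilon>\<close> by simp
      from *[rule_format, OF this] pos
      show "\<forall>\<^sub>F h in at (\<lambda>i. 0) within cvec a. cmod (r h) / cnorm a h < \<epsilon>"
      proof eventually_elim
        case (elim h)
        then have "cmod (r h) / cnorm a h \<le> \<epsilon>/2" by (simp add: field_simps)
        with \<open>0 < \<epsilon>\<close> show ?case by linarith
      qed
    qed
    finally show ?thesis by (simp add: has_cgrad_def r_def)
  qed
  then show ?thesis unfolding holo_comp_def by blast
qed

lemma cmod_linear_le:
  "cmod (\<Sum>i<a. d i * h i) \<le> (\<Sum>i<a. cmod (d i)) * cnorm a h"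
proof -
  have "cmod (\<Sum>i<a. d i * h i) \<le> (\<Sum>i<a. cmod (d i) * cmod (h i))"
    by (rule order_trans[OF norm_sum]) (simp add: norm_mult)
  also have "\<dots> \<le> (\<Sum>i<a. cmod (d i) * cnorm a h)"
    by (intro sum_mono mult_left_mono cmod_le_cnorm) auto
  finally show ?thesis by (simp add: sum_distrib_right)
qed

lemma has_cgrad_increment_bound:
  assumes "has_cgrad a z g d"
  obtains K where "0 < K"
    "\<forall>\<^sub>F h in at (\<lambda>i. 0) within cvec a. cmod (g (\<lambda>i. z i + h i) - g z) \<le> K * cnorm a h"
proof
  define K where "K = 1 + (\<Sum>i<a. cmod (d i))"
  show "0 < K" unfolding K_def by (intro add_pos_nonneg sum_nonneg) auto
  have "\<forall>\<^sub>F h in at (\<lambda>i. 0) within cvec a.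
      cmod (g (\<lambda>i. z i + h i) - g z - (\<Sum>i<a. d i * h i)) \<le> 1 * cnorm a h"
    using assms unfolding has_cgrad_def by (meson zero_less_one)
  then show "\<forall>\<^sub>F h in at (\<lambda>i. 0) within cvec a. cmod (g (\<lambda>i. z i + h i) - g z) \<le> K * cnorm a h"
  proof eventually_elim
    case (elim h)
    have "cmod (g (\<lambda>i. z i + h i) - g z) \<le>
      cmod (g (\<lambda>i. z i + h i) - g z - (\<Sum>i<a. d i * h i)) + cmod (\<Sum>i<a. d i * h i)"
      using norm_triangle_sub[of "g (\<lambda>i. z i + h i) - g z" "\<Sum>i<a. d i * h i"] by linarith
    with elim cmod_linear_le[where a=a and d=d and h=h] show ?case
      by (simp add: K_def algebra_simps)
  qed
qed

lemma tendsto_cnorm_0: "((\<lambda>h. cnorm a h) \<longlongrightarrow> 0) (at (\<lambda>i. 0) within cvec a)"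
proof -
  have "((\<lambda>h::nat \<Rightarrow> complex. h i) \<longlongrightarrow> 0) (at (\<lambda>i. 0) within cvec a)" for i
    using tendsto_componentwise[of "\<lambda>h. h" "\<lambda>i. 0" "at (\<lambda>i. 0) within cvec a"]
    by simp
  then have "((\<lambda>h. \<Sum>i<a. cmod (h i)) \<longlongrightarrow> (\<Sum>i<a. cmod 0)) (at (\<lambda>i. 0) within cvec a)"
    by (intro tendsto_intros) auto
  then show ?thesis
    by (intro tendsto_sandwich[of "\<lambda>_. 0" "\<lambda>h. cnorm a h" _ "\<lambda>h. \<Sum>i<a. cmod (h i)"])
       (auto simp: cnorm_nonneg cnorm_le_sum)
qed

text \<open>One chain rule with an outer function of two complex variables covers sums, products
  and, with \<open>B = 0\<close>, composition with a function of one variable.\<close>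

lemma has_cgrad_compose2:
  assumes g1: "has_cgrad a z g1 d1" and g2: "has_cgrad a z g2 d2"
    and \<Phi>: "(\<Phi> has_derivative (\<lambda>p. A * fst p + B * snd p)) (at (g1 z, g2 z))"
  shows "has_cgrad a z (\<lambda>w. \<Phi> (g1 w, g2 w)) (\<lambda>i. A * d1 i + B * d2 i)"
  unfolding has_cgrad_def
proof (intro allI impI)
  fix \<epsilon> :: real assume \<epsilon>: "0 < \<epsilon>"
  obtain K1 where K1: "0 < K1" "\<forall>\<^sub>F h in at (\<lambda>i. 0) within cvec a. cmod (g1 (\<lambda>i. z i + h i) - g1 z) \<le> K1 * cnorm a h"
    using has_cgrad_increment_bound[OF g1] .
  obtain K2 where K2: "0 < K2" "\<forall>\<^sub>F h in at (\<lambda>i. 0) within cvec a. cmod (g2 (\<lambda>i. z i + h i) - g2 z) \<le> K2 * cnorm a h"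
    using has_cgrad_increment_bound[OF g2] .
  \<comment> \<open>The remainder of \<open>\<Phi>\<close> will contribute
    \<open>\<eta> * (K1 + K2)\<close>, those of \<open>g1\<close> and \<open>g2\<close> will
    contribute \<open>\<eta> * cmod A\<close> and \<open>\<eta> * cmod B\<close>; this choice keeps
    the total below \<open>\<epsilon>\<close>.\<close>
  define \<eta> where "\<eta> = \<epsilon> / (K1 + K2 + cmod A + cmod B + 1)"
  have den: "0 < K1 + K2 + cmod A + cmod B + 1" using K1 K2 by (auto intro!: add_pos_nonneg)
  have \<eta>: "0 < \<eta>" using \<epsilon> den by (simp add: \<eta>_def)
  obtain \<delta> where \<delta>: "0 < \<delta>" "\<And>p. norm (p - (g1 z, g2 z)) < \<delta> \<Longrightarrow>
     norm (\<Phi> p - \<Phi> (g1 z, g2 z) - (A * fst (p - (g1 z, g2 z)) + B * snd (p - (g1 z, g2 z))))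
       \<le> \<eta> * norm (p - (g1 z, g2 z))"
    using \<Phi> \<eta> unfolding has_derivative_at_alt by blast
  have sm: "\<forall>\<^sub>F h in at (\<lambda>i. 0) within cvec a. cnorm a h < \<delta> / (K1 + K2)"
    using order_tendstoD(2)[OF tendsto_cnorm_0, of "\<delta> / (K1 + K2)" a] \<delta>(1) K1(1) K2(1) by simp
  have e1: "\<forall>\<^sub>F h in at (\<lambda>i. 0) within cvec a.
     cmod (g1 (\<lambda>i. z i + h i) - g1 z - (\<Sum>i<a. d1 i * h i)) \<le> \<eta> * cnorm a h"
    using g1 \<eta> unfolding has_cgrad_def by blast
  have e2: "\<forall>\<^sub>F h in at (\<lambda>i. 0) within cvec a.
     cmod (g2 (\<lambda>i. z i + h i) - g2 z - (\<Sum>i<a. d2 i * h i)) \<le> \<eta> * cnorm a h"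
    using g2 \<eta> unfolding has_cgrad_def by blast
  show "\<forall>\<^sub>F h in at (\<lambda>i. 0) within cvec a.
      cmod (\<Phi> (g1 (\<lambda>i. z i + h i), g2 (\<lambda>i. z i + h i)) - \<Phi> (g1 z, g2 z)
         - (\<Sum>i<a. (A * d1 i + B * d2 i) * h i)) \<le> \<epsilon> * cnorm a h"
    using K1(2) K2(2) sm e1 e2
  proof eventually_elim
    case (elim h)
    define u where "u = g1 (\<lambda>i. z i + h i) - g1 z"
    define v where "v = g2 (\<lambda>i. z i + h i) - g2 z"
    define s1 where "s1 = (\<Sum>i<a. d1 i * h i)"
    define s2 where "s2 = (\<Sum>i<a. d2 i * h i)"
    define P where "P = \<Phi> (g1 (\<lambda>i. z i + h i), g2 (\<lambda>i. z i + h i)) - \<Phi> (g1 z, g2 z)"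
    have uv: "norm (u, v) \<le> (K1 + K2) * cnorm a h"
      using norm_Pair_le[of u v] elim(1,2) by (simp add: u_def v_def algebra_simps)
    also have "\<dots> < \<delta>" using elim(3) K1(1) K2(1) by (simp add: field_simps)
    finally have "norm (u, v) < \<delta>" .
    then have "cmod (P - (A * u + B * v)) \<le> \<eta> * norm (u, v)"
      using \<delta>(2)[of "(g1 (\<lambda>i. z i + h i), g2 (\<lambda>i. z i + h i))"] by (simp add: u_def v_def P_def)
    also have "\<dots> \<le> \<eta> * ((K1 + K2) * cnorm a h)"
      using uv \<eta> by (simp add: mult_left_mono)
    finally have 1: "cmod (P - (A * u + B * v)) \<le> \<eta> * ((K1 + K2) * cnorm a h)" .
    have 2: "cmod (A * (u - s1)) \<le> cmod A * (\<eta> * cnorm a h)"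
      using elim(4) by (simp add: norm_mult u_def s1_def mult_left_mono)
    have 3: "cmod (B * (v - s2)) \<le> cmod B * (\<eta> * cnorm a h)"
      using elim(5) by (simp add: norm_mult v_def s2_def mult_left_mono)
    have "(\<Sum>i<a. (A * d1 i + B * d2 i) * h i) = A * s1 + B * s2"
      by (simp add: s1_def s2_def sum_distrib_left sum.distrib algebra_simps)
    then have "P - (\<Sum>i<a. (A * d1 i + B * d2 i) * h i)
       = (P - (A * u + B * v)) + A * (u - s1) + B * (v - s2)"
      by (simp add: algebra_simps)
    moreover have "cmod (P - (A * u + B * v) + A * (u - s1) + B * (v - s2))
        \<le> cmod (P - (A * u + B * v)) + cmod (A * (u - s1)) + cmod (B * (v - s2))"
      using norm_triangle_ineq[of "P - (A * u + B * v) + A * (u - s1)" "B * (v - s2)"]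
        norm_triangle_ineq[of "P - (A * u + B * v)" "A * (u - s1)"] by linarith
    ultimately have "cmod (P - (\<Sum>i<a. (A * d1 i + B * d2 i) * h i))
        \<le> cmod (P - (A * u + B * v)) + cmod (A * (u - s1)) + cmod (B * (v - s2))"
      by (simp only:)
    also have "\<dots> \<le> \<eta> * (K1 + K2 + cmod A + cmod B) * cnorm a h"
      using 1 2 3 by (simp add: algebra_simps)
    also have "\<dots> \<le> \<epsilon> * cnorm a h"
    proof (rule mult_right_mono[OF _ cnorm_nonneg])
      have "\<eta> * (K1 + K2 + cmod A + cmod B) \<le> \<eta> * (K1 + K2 + cmod A + cmod B + 1)"
        using \<eta> by simp
      also have "\<dots> = \<epsilon>" using den by (simp add: \<eta>_def)
      finally show "\<eta> * (K1 + K2 + cmod A + cmod B) \<le> \<epsilon>" .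
    qed
    finally show ?case by (simp add: P_def)
  qed
qed

section \<open>Closure properties of holomorphic functions\<close>

lemma holo_comp_const: "holo_comp a D (\<lambda>z. c)"
proof -
  have "has_cgrad a z (\<lambda>z. c) (\<lambda>i. 0)" for z
    by (simp add: has_cgrad_def cnorm_nonneg)
  then show ?thesis unfolding holo_comp_iff by blast
qed

lemma holo_comp_coord:
  assumes "i < a" shows "holo_comp a D (\<lambda>z. z i)"
proof -
  have "(\<Sum>j<a. (if j = i then 1 else 0) * h j) = h i" for h :: "nat \<Rightarrow> complex"
    using assms by (simp add: if_distrib[of "\<lambda>x. x * _"] cong: if_cong)
  then have "has_cgrad a z (\<lambda>z. z i) (\<lambda>j. if j = i then 1 else 0)" for z
    by (simp add: has_cgrad_def cnorm_nonneg)
  then show ?thesis unfolding holo_comp_iff by blast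
qed

lemma holo_comp_compose:
  assumes "holo_comp a D g" and "\<And>z. z \<in> D \<Longrightarrow> \<phi> field_differentiable at (g z)"
  shows "holo_comp a D (\<lambda>z. \<phi> (g z))"
  unfolding holo_comp_iff
proof
  fix z assume z: "z \<in> D"
  then obtain d where d: "has_cgrad a z g d" using assms(1) holo_comp_iff by blast
  obtain A where A: "(\<phi> has_field_derivative A) (at (g z))"
    using assms(2)[OF z] field_differentiable_def by blast
  have "((\<lambda>p. \<phi> (fst p)) has_derivative (\<lambda>p. A * fst p)) (at (g z, g z))"
    using has_derivative_compose[of fst fst "(g z, g z)" UNIV \<phi> "(*) A"] A
    by (simp add: has_field_derivative_def has_derivative_fst)
  then have "((\<lambda>p. \<phi> (fst p)) has_derivative (\<lambda>p. A * fst p + 0 * snd p)) (at (g z, g z))"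
    by simp
  from has_cgrad_compose2[OF d d this]
  show "\<exists>d. has_cgrad a z (\<lambda>z. \<phi> (g z)) d" by auto
qed

lemma holo_comp_add:
  assumes "holo_comp a D f" "holo_comp a D g"
  shows "holo_comp a D (\<lambda>z. f z + g z)"
  unfolding holo_comp_iff
proof
  fix z assume z: "z \<in> D"
  obtain d where d: "has_cgrad a z f d" using bspec[OF assms(1)[unfolded holo_comp_iff] z] ..
  obtain e where e: "has_cgrad a z g e" using bspec[OF assms(2)[unfolded holo_comp_iff] z] ..
  have "((\<lambda>p. fst p + snd p) has_derivative (\<lambda>p. 1 * fst p + 1 * snd p)) (at (f z, g z))"
    by (auto intro!: derivative_eq_intros)
  from has_cgrad_compose2[OF d e this]
  show "\<exists>d. has_cgrad a z (\<lambda>z. f z + g z) d" by auto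
qed

lemma holo_comp_mult:
  assumes "holo_comp a D f" "holo_comp a D g"
  shows "holo_comp a D (\<lambda>z. f z * g z)"
  unfolding holo_comp_iff
proof
  fix z assume z: "z \<in> D"
  obtain d where d: "has_cgrad a z f d" using bspec[OF assms(1)[unfolded holo_comp_iff] z] ..
  obtain e where e: "has_cgrad a z g e" using bspec[OF assms(2)[unfolded holo_comp_iff] z] ..
  have "((\<lambda>p. fst p * snd p) has_derivative (\<lambda>p. g z * fst p + f z * snd p)) (at (f z, g z))"
    using has_derivative_mult[OF has_derivative_fst[OF has_derivative_ident] has_derivative_snd[OF has_derivative_ident],
        of "(f z, g z)" UNIV]
    by (simp add: algebra_simps)
  from has_cgrad_compose2[OF d e this]
  show "\<exists>d. has_cgrad a z (\<lambda>z. f z * g z) d" by auto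
qed

lemma holo_comp_diff:
  assumes "holo_comp a D f" "holo_comp a D g"
  shows "holo_comp a D (\<lambda>z. f z - g z)"
  using holo_comp_add[OF assms(1) holo_comp_mult[OF holo_comp_const[of a D "-1"] assms(2)]] by simp

lemma holo_comp_sum:
  "(\<And>i. i \<in> I \<Longrightarrow> holo_comp a D (f i)) \<Longrightarrow> holo_comp a D (\<lambda>z. \<Sum>i\<in>I. f i z)"
  by (induction I rule: infinite_finite_induct) (simp_all add: holo_comp_const holo_comp_add)

lemma holo_comp_power: "holo_comp a D f \<Longrightarrow> holo_comp a D (\<lambda>z. f z ^ n)"
  by (induction n) (simp_all add: holo_comp_const holo_comp_mult)

lemma holo_comp_divide:
  assumes "holo_comp a D f" "holo_comp a D g" "\<And>z. z \<in> D \<Longrightarrow> g z \<noteq> 0"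
  shows "holo_comp a D (\<lambda>z. f z / g z)"
proof -
  have "holo_comp a D (\<lambda>z. inverse (g z))"
    by (rule holo_comp_compose[OF assms(2)])
       (simp add: assms(3) field_differentiable_inverse)
  then show ?thesis
    using holo_comp_mult[OF assms(1)] by (simp add: divide_inverse)
qed

lemmas holo_comp_intros =
  holo_comp_const holo_comp_coord holo_comp_add holo_comp_diff holo_comp_mult
  holo_comp_sum holo_comp_power holo_comp_divide

lemma holo_comp_continuous_on:
  assumes g: "holo_comp a D g" and D: "D \<subseteq> cvec a"
  shows "continuous_on D g"
  unfolding continuous_on_def
proof
  fix z assume z: "z \<in> D"
  obtain d where d: "has_cgrad a z g d" using bspec[OF g[unfolded holo_comp_iff] z] ..
  obtain C where C: "0 < C" "\<forall>\<^sub>F h in at (\<lambda>i. 0) within cvec a. cmod (g (\<lambda>i. z i + h i) - g z) \<le> C * cnorm a h"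
    using has_cgrad_increment_bound[OF d] .
  have "((\<lambda>h. C * cnorm a h) \<longlongrightarrow> C * 0) (at (\<lambda>i. 0) within cvec a)"
    by (intro tendsto_mult_left tendsto_cnorm_0)
  then have "((\<lambda>h. C * cnorm a h) \<longlongrightarrow> 0) (at (\<lambda>i. 0) within cvec a)" by simp
  with C(2) have "((\<lambda>h. g (\<lambda>i. z i + h i) - g z) \<longlongrightarrow> 0) (at (\<lambda>i. 0) within cvec a)"
    by (rule Lim_null_comparison)
  then have lim: "((\<lambda>h. g (\<lambda>i. z i + h i)) \<longlongrightarrow> g z) (at (\<lambda>i. 0) within cvec a)"
    by (simp add: LIM_zero_iff)
  have "((\<lambda>x i. x i - z i) \<longlongrightarrow> (\<lambda>i. 0)) (at z within D)"
    unfolding tendsto_componentwise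
  proof
    fix i
    have "((\<lambda>x. x i) \<longlongrightarrow> z i) (at z within D)"
      using tendsto_componentwise[of "\<lambda>x. x" z "at z within D"] by simp
    then show "((\<lambda>x. x i - z i) \<longlongrightarrow> 0) (at z within D)" by (simp add: LIM_zero)
  qed
  moreover have "\<forall>\<^sub>F x in at z within D. (\<lambda>i. x i - z i) \<in> cvec a \<and> (\<lambda>i. x i - z i) \<noteq> (\<lambda>i. 0)"
    unfolding eventually_at_filter
    by (intro always_eventually allI impI conjI cvec_diff) (use z D in \<open>auto simp: fun_eq_iff\<close>)
  ultimately have "filterlim (\<lambda>x i. x i - z i) (at (\<lambda>i. 0) within cvec a) (at z within D)"
    by (simp add: filterlim_at)
  from filterlim_compose[OF lim this] show "(g \<longlongrightarrow> g z) (at z within D)" by simp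
qed

section \<open>Holomorphy tested along curves\<close>

definition curve_deriv :: "(complex \<Rightarrow> nat \<Rightarrow> complex) \<Rightarrow> complex \<Rightarrow> (nat \<Rightarrow> complex) \<Rightarrow> bool" where
  "curve_deriv \<gamma> \<zeta> v \<longleftrightarrow> (\<forall>i. ((\<lambda>t. \<gamma> t i) has_field_derivative v i) (at \<zeta>))"

text \<open>Differentiating only along curves makes the chain rule immediate, and one-variable
  function theory on discs is all that the rigidity argument below needs.\<close>

definition curve_holo :: "nat \<Rightarrow> (nat \<Rightarrow> complex) set \<Rightarrow> ((nat \<Rightarrow> complex) \<Rightarrow> nat \<Rightarrow> complex) \<Rightarrow> bool" where
  "curve_holo a D f \<longleftrightarrow> (\<forall>z\<in>D. \<exists>d. \<forall>\<gamma> \<zeta> v. \<gamma> \<zeta> = z \<longrightarrow> (\<forall>\<^sub>F t in nhds \<zeta>. \<gamma> t \<in> D) \<longrightarrow>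
     curve_deriv \<gamma> \<zeta> v \<longrightarrow> curve_deriv (\<lambda>t. f (\<gamma> t)) \<zeta> (\<lambda>i. \<Sum>j<a. d i j * v j))"

text \<open>The difference quotients of \<open>\<gamma>\<close> converge, so
  \<open>cnorm a (k t)\<close> is at most a constant times \<open>cmod (t - \<zeta>)\<close>; the
  remainder of \<open>g\<close>, small against \<open>cnorm a (k t)\<close>, is then small against
  \<open>t - \<zeta>\<close>.\<close>

lemma has_cgrad_along_curve:
  assumes g: "has_cgrad a z g d" and z: "\<gamma> \<zeta> = z"
    and ev: "\<forall>\<^sub>F t in nhds \<zeta>. \<gamma> t \<in> cvec a" and v: "curve_deriv \<gamma> \<zeta> v"
  shows "((\<lambda>t. g (\<gamma> t)) has_field_derivative (\<Sum>j<a. d j * v j)) (at \<zeta>)"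
proof -
  have zc: "z \<in> cvec a" using eventually_nhds_x_imp_x[OF ev] z by simp
  define k where "k t = (\<lambda>i. \<gamma> t i - z i)" for t
  have klim: "(k \<longlongrightarrow> (\<lambda>i. 0)) (at \<zeta>)"
    unfolding tendsto_componentwise k_def
  proof
    fix i
    have "((\<lambda>t. \<gamma> t i) has_field_derivative v i) (at \<zeta>)" using v by (simp add: curve_deriv_def)
    then have "isCont (\<lambda>t. \<gamma> t i) \<zeta>" by (rule DERIV_isCont)
    then have "((\<lambda>t. \<gamma> t i) \<longlongrightarrow> z i) (at \<zeta>)" using z by (simp add: isCont_def)
    then show "((\<lambda>t. \<gamma> t i - z i) \<longlongrightarrow> 0) (at \<zeta>)" by (simp add: LIM_zero)
  qed
  have ratio: "((\<lambda>t. (\<gamma> t i - z i) / (t - \<zeta>)) \<longlongrightarrow> v i) (at \<zeta>)" for i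
    using v z unfolding curve_deriv_def has_field_derivative_iff by auto
  define K where "K = (\<Sum>i<a. cmod (v i)) + 1"
  have K: "0 < K" unfolding K_def by (intro add_nonneg_pos sum_nonneg) auto
  have "((\<lambda>t. \<Sum>i<a. cmod ((\<gamma> t i - z i) / (t - \<zeta>))) \<longlongrightarrow> (\<Sum>i<a. cmod (v i))) (at \<zeta>)"
    by (intro tendsto_intros ratio)
  then have "\<forall>\<^sub>F t in at \<zeta>. (\<Sum>i<a. cmod ((\<gamma> t i - z i) / (t - \<zeta>))) < K"
    by (rule order_tendstoD) (simp add: K_def)
  then have kb: "\<forall>\<^sub>F t in at \<zeta>. cnorm a (k t) \<le> K * cmod (t - \<zeta>)"
    using eventually_neq_at_within[of \<zeta>]
  proof eventually_elim
    case (elim t)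
    have "cnorm a (k t) \<le> (\<Sum>i<a. cmod (\<gamma> t i - z i))"
      using cnorm_le_sum[of a "k t"] by (simp add: k_def)
    also have "\<dots> = (\<Sum>i<a. cmod ((\<gamma> t i - z i) / (t - \<zeta>))) * cmod (t - \<zeta>)"
      using elim(2) by (simp add: sum_distrib_right norm_divide)
    also have "\<dots> \<le> K * cmod (t - \<zeta>)"
      using elim(1) by (intro mult_right_mono) auto
    finally show ?case .
  qed
  have "((\<lambda>t. ((g (\<gamma> t) - g z) - (\<Sum>j<a. d j * (\<gamma> t j - z j))) / (t - \<zeta>)) \<longlongrightarrow> 0) (at \<zeta>)"
  proof (rule tendstoI)
    fix \<epsilon> :: real assume \<epsilon>: "0 < \<epsilon>"
    define P where "P h \<longleftrightarrow> cmod (g (\<lambda>i. z i + h i) - g z - (\<Sum>i<a. d i * h i)) \<le> \<epsilon> / (2*K) * cnorm a h" for h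
    have "\<forall>\<^sub>F h in at (\<lambda>i. 0) within cvec a. P h"
      using g \<epsilon> K unfolding has_cgrad_def P_def by (auto dest!: spec[of _ "\<epsilon> / (2*K)"])
    then obtain S where S: "open S" "(\<lambda>i. 0) \<in> S" "\<And>h. h \<in> S \<Longrightarrow> h \<noteq> (\<lambda>i. 0) \<Longrightarrow> h \<in> cvec a \<Longrightarrow> P h"
      unfolding eventually_at_topological by blast
    \<comment> \<open>The curve may return to \<open>z\<close> at parameters other than
      \<open>\<zeta>\<close>. There \<open>k t\<close> is zero, which the punctured filter excludes,
      so the estimate is supplied separately.\<close>
    have P0: "P (\<lambda>i. 0)" by (simp add: P_def cnorm_nonneg cnorm_def)
    have "\<forall>\<^sub>F t in at \<zeta>. k t \<in> S" using topological_tendstoD[OF klim S(1,2)] .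
    moreover have "\<forall>\<^sub>F t in at \<zeta>. \<gamma> t \<in> cvec a" using ev by (simp add: eventually_nhds_conv_at)
    ultimately show "\<forall>\<^sub>F t in at \<zeta>. dist (((g (\<gamma> t) - g z) - (\<Sum>j<a. d j * (\<gamma> t j - z j))) / (t - \<zeta>)) 0 < \<epsilon>"
      using kb eventually_neq_at_within[of \<zeta>]
    proof eventually_elim
      case (elim t)
      have "k t \<in> cvec a" using cvec_diff[OF elim(2) zc] by (simp add: k_def)
      then have "P (k t)" using S(3) elim(1) P0 by metis
      then have "cmod (g (\<gamma> t) - g z - (\<Sum>j<a. d j * (\<gamma> t j - z j))) \<le> \<epsilon> / (2*K) * cnorm a (k t)"
        by (simp add: P_def k_def)
      also have "\<dots> \<le> \<epsilon> / (2*K) * (K * cmod (t - \<zeta>))"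
        using elim(3) \<epsilon> K by (intro mult_left_mono) auto
      also have "\<dots> = \<epsilon> / 2 * cmod (t - \<zeta>)" using K by simp
      also have "\<dots> < \<epsilon> * cmod (t - \<zeta>)" using \<epsilon> elim(4) by simp
      finally show ?case using elim(4) by (simp add: norm_divide divide_less_eq)
    qed
  qed
  moreover have "((\<lambda>t. \<Sum>j<a. d j * ((\<gamma> t j - z j) / (t - \<zeta>))) \<longlongrightarrow> (\<Sum>j<a. d j * v j)) (at \<zeta>)"
    by (intro tendsto_intros ratio)
  ultimately have "((\<lambda>t. ((g (\<gamma> t) - g z) - (\<Sum>j<a. d j * (\<gamma> t j - z j))) / (t - \<zeta>)
       + (\<Sum>j<a. d j * ((\<gamma> t j - z j) / (t - \<zeta>)))) \<longlongrightarrow> 0 + (\<Sum>j<a. d j * v j)) (at \<zeta>)"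
    by (rule tendsto_add)
  then have "((\<lambda>t. (g (\<gamma> t) - g z) / (t - \<zeta>)) \<longlongrightarrow> (\<Sum>j<a. d j * v j)) (at \<zeta>)"
    by (simp add: diff_divide_distrib[of "g _ - g _"] sum_divide_distrib)
  then show ?thesis using z by (simp add: has_field_derivative_iff)
qed

lemma holo_map_imp_curve_holo:
  assumes f: "holo_map a b D f" and D: "D \<subseteq> cvec a"
  shows "curve_holo a D f"
  unfolding curve_holo_def
proof
  fix z assume z: "z \<in> D"
  have "\<exists>d. has_cgrad a z (\<lambda>z. f z i) d" if "i < b" for i
    using f z that by (auto simp: holo_map_def holo_comp_iff)
  then obtain d where d: "\<And>i. i < b \<Longrightarrow> has_cgrad a z (\<lambda>z. f z i) (d i)" by metis
  define e where "e i = (if i < b then d i else (\<lambda>j. 0))" for i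
  show "\<exists>d. \<forall>\<gamma> \<zeta> v. \<gamma> \<zeta> = z \<longrightarrow> (\<forall>\<^sub>F t in nhds \<zeta>. \<gamma> t \<in> D) \<longrightarrow>
     curve_deriv \<gamma> \<zeta> v \<longrightarrow> curve_deriv (\<lambda>t. f (\<gamma> t)) \<zeta> (\<lambda>i. \<Sum>j<a. d i j * v j)"
  proof (intro exI allI impI)
    fix \<gamma> \<zeta> v
    assume \<gamma>: "\<gamma> \<zeta> = z" "\<forall>\<^sub>F t in nhds \<zeta>. \<gamma> t \<in> D" "curve_deriv \<gamma> \<zeta> v"
    have cv: "\<forall>\<^sub>F t in nhds \<zeta>. \<gamma> t \<in> cvec a" using \<gamma>(2) by eventually_elim (use D in auto)
    have "((\<lambda>t. f (\<gamma> t) i) has_field_derivative (\<Sum>j<a. e i j * v j)) (at \<zeta>)" for i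
    proof (cases "i < b")
      case True
      then show ?thesis using has_cgrad_along_curve[OF d[OF True] \<gamma>(1) cv \<gamma>(3)] by (simp add: e_def)
    next
      case False
      have "\<forall>\<^sub>F t in nhds \<zeta>. f (\<gamma> t) i = 0"
        using \<gamma>(2) by eventually_elim (use f False in \<open>auto simp: holo_map_def cvec_def\<close>)
      then have "((\<lambda>t. f (\<gamma> t) i) has_field_derivative 0) (at \<zeta>) \<longleftrightarrow> ((\<lambda>t. 0) has_field_derivative 0) (at \<zeta>)"
        by (intro DERIV_cong_ev) auto
      then show ?thesis using False by (simp add: e_def)
    qed
    then show "curve_deriv (\<lambda>t. f (\<gamma> t)) \<zeta> (\<lambda>i. \<Sum>j<a. e i j * v j)"
      by (simp add: curve_deriv_def)
  qed
qed

lemma curve_holo_comp: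
  assumes f: "curve_holo a D f" and g: "curve_holo a D g" and fD: "f ` D \<subseteq> D"
  shows "curve_holo a D (\<lambda>z. g (f z))"
  unfolding curve_holo_def
proof
  fix z assume z: "z \<in> D"
  obtain d where d: "\<And>\<gamma> \<zeta> v. \<lbrakk>\<gamma> \<zeta> = z; \<forall>\<^sub>F t in nhds \<zeta>. \<gamma> t \<in> D; curve_deriv \<gamma> \<zeta> v\<rbrakk>
      \<Longrightarrow> curve_deriv (\<lambda>t. f (\<gamma> t)) \<zeta> (\<lambda>i. \<Sum>j<a. d i j * v j)"
    using bspec[OF f[unfolded curve_holo_def] z] by auto
  have fz: "f z \<in> D" using fD z by auto
  obtain e where e: "\<And>\<gamma> \<zeta> v. \<lbrakk>\<gamma> \<zeta> = f z; \<forall>\<^sub>F t in nhds \<zeta>. \<gamma> t \<in> D; curve_deriv \<gamma> \<zeta> v\<rbrakk>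
      \<Longrightarrow> curve_deriv (\<lambda>t. g (\<gamma> t)) \<zeta> (\<lambda>i. \<Sum>j<a. e i j * v j)"
    using bspec[OF g[unfolded curve_holo_def] fz] by auto
  have eq: "(\<Sum>j<a. e i j * (\<Sum>l<a. d j l * v l)) = (\<Sum>l<a. (\<Sum>j<a. e i j * d j l) * v l)" for i v
    by (simp add: sum_distrib_left sum_distrib_right mult.assoc) (rule sum.swap)
  show "\<exists>d. \<forall>\<gamma> \<zeta> v. \<gamma> \<zeta> = z \<longrightarrow> (\<forall>\<^sub>F t in nhds \<zeta>. \<gamma> t \<in> D) \<longrightarrow>
     curve_deriv \<gamma> \<zeta> v \<longrightarrow> curve_deriv (\<lambda>t. g (f (\<gamma> t))) \<zeta> (\<lambda>i. \<Sum>j<a. d i j * v j)"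
  proof (intro exI allI impI)
    fix \<gamma> \<zeta> v
    assume \<gamma>: "\<gamma> \<zeta> = z" "\<forall>\<^sub>F t in nhds \<zeta>. \<gamma> t \<in> D" "curve_deriv \<gamma> \<zeta> v"
    have "\<forall>\<^sub>F t in nhds \<zeta>. f (\<gamma> t) \<in> D" using \<gamma>(2) by eventually_elim (use fD in auto)
    from e[OF _ this d[OF \<gamma>]] \<gamma>(1)
    show "curve_deriv (\<lambda>t. g (f (\<gamma> t))) \<zeta> (\<lambda>i. \<Sum>l<a. (\<Sum>j<a. e i j * d j l) * v l)"
      by (simp add: eq)
  qed
qed

text \<open>The passage to one variable: the later estimates are made on complex discs mapped into
  \<open>D\<close>.\<close>

lemma curve_holo_holomorphic_on:
  assumes f: "curve_holo a D f" and S: "open S" and \<gamma>: "\<And>t. t \<in> S \<Longrightarrow> \<gamma> t \<in> D"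
    and hol: "\<And>i. (\<lambda>t. \<gamma> t i) holomorphic_on S"
  shows "(\<lambda>t. f (\<gamma> t) i) holomorphic_on S"
  unfolding holomorphic_on_open[OF S]
proof
  fix t assume t: "t \<in> S"
  have "\<exists>v. ((\<lambda>t. \<gamma> t j) has_field_derivative v) (at t)" for j
    using hol[of j] t by (simp add: holomorphic_on_open[OF S])
  then obtain v where "curve_deriv \<gamma> t v" unfolding curve_deriv_def by metis
  moreover have "\<forall>\<^sub>F t in nhds t. \<gamma> t \<in> D"
    using eventually_nhds_in_open[OF S t] by eventually_elim (use \<gamma> in auto)
  ultimately have "\<exists>w. curve_deriv (\<lambda>t. f (\<gamma> t)) t w"
    using bspec[OF f[unfolded curve_holo_def] \<gamma>[OF t]] by auto
  then show "\<exists>f'. ((\<lambda>t. f (\<gamma> t) i) has_field_derivative f') (at t)"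
    unfolding curve_deriv_def by blast
qed

section \<open>Cartan's uniqueness theorem\<close>

text \<open>Dividing by \<open>b + e\<close> with \<open>e > 0\<close> gives the strict bound that
  the Schwarz lemma wants, also when \<open>b = 0\<close>; then \<open>e\<close> tends to 0.\<close>

lemma Schwarz_bound:
  assumes hol: "u holomorphic_on ball 0 1" and u0: "u 0 = 0"
    and bd: "\<And>\<zeta>. \<lbrakk>cmod \<zeta> < 1; \<zeta> \<noteq> 0\<rbrakk> \<Longrightarrow> cmod (u \<zeta>) \<le> b" and \<zeta>: "cmod \<zeta> < 1"
  shows "cmod (u \<zeta>) \<le> b * cmod \<zeta>"
proof -
  have b0: "0 \<le> b" using order_trans[OF norm_ge_zero bd[of "1/2"]] by simp
  have "cmod (u \<zeta>) \<le> b * cmod \<zeta> + e" if e: "0 < e" for e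
  proof -
    have "cmod (u \<zeta> / (b + e)) \<le> cmod \<zeta>"
    proof (rule Schwarz_Lemma(1)[OF _ _ _ \<zeta>, of "\<lambda>\<zeta>. u \<zeta> / complex_of_real (b + e)"])
      show "(\<lambda>\<zeta>. u \<zeta> / complex_of_real (b + e)) holomorphic_on ball 0 1"
        using b0 e of_real_eq_0_iff[of "b + e", where ?'a=complex]
        by (intro holomorphic_intros hol) auto
      show "u 0 / complex_of_real (b + e) = 0" by (simp add: u0)
      fix z :: complex assume z: "cmod z < 1"
      have "cmod (u z) < b + e"
        using bd[OF z] u0 b0 e by (cases "z = 0") auto
      moreover have "cmod (complex_of_real (b + e)) = b + e"
        using b0 e norm_of_real[of "b + e", where ?'a=complex] by (simp del: of_real_add)
      ultimately show "cmod (u z / complex_of_real (b + e)) < 1"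
        using b0 e by (simp add: norm_divide divide_less_eq del: of_real_add)
    qed
    moreover have "cmod (complex_of_real (b + e)) = b + e"
      using b0 e norm_of_real[of "b + e", where ?'a=complex] by (simp del: of_real_add)
    ultimately have "cmod (u \<zeta>) \<le> (b + e) * cmod \<zeta>"
      using b0 e by (simp add: norm_divide divide_le_eq mult.commute flip: of_real_add)
    also have "\<dots> \<le> b * cmod \<zeta> + e" using \<zeta> e by (simp add: algebra_simps)
    finally show ?thesis .
  qed
  then show ?thesis by (rule field_le_epsilon)
qed

text \<open>Divide out one factor \<open>\<zeta>\<close> at a time. By Schwarz the quotient is again
  bounded by \<open>b\<close>, though directly only off the origin, which is why the bound is
  assumed there alone. The point is that \<open>b\<close> does not deteriorate with
  \<open>s\<close>.\<close>

lemma Schwarz_bound_order: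
  assumes "u holomorphic_on ball 0 1"
    and "\<And>\<zeta>. \<lbrakk>cmod \<zeta> < 1; \<zeta> \<noteq> 0\<rbrakk> \<Longrightarrow> cmod (u \<zeta>) \<le> b"
    and "((\<lambda>\<zeta>. u \<zeta> / \<zeta> ^ s) \<longlongrightarrow> 0) (at 0)" and "cmod \<zeta> < 1"
  shows "cmod (u \<zeta>) \<le> b * cmod \<zeta> ^ Suc s"
  using assms
proof (induction s arbitrary: u \<zeta>)
  case 0
  have "isCont u 0"
    using 0(1) holomorphic_on_imp_continuous_on[of u] continuous_on_eq_continuous_at[of "ball 0 1" u] by simp
  then have "(u \<longlongrightarrow> u 0) (at 0)" by (simp add: isCont_def)
  moreover have "(u \<longlongrightarrow> 0) (at 0)" using 0(3) by simp
  ultimately have "u 0 = 0" using LIM_unique by blast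
  then show ?case using Schwarz_bound[OF 0(1) _ 0(2) 0(4)] by simp
next
  case (Suc s)
  have "isCont u 0"
    using Suc.prems(1) holomorphic_on_imp_continuous_on[of u] continuous_on_eq_continuous_at[of "ball 0 1" u] by simp
  then have "(u \<longlongrightarrow> u 0) (at 0)" by (simp add: isCont_def)
  moreover have "((\<lambda>\<zeta>. u \<zeta> / \<zeta> ^ Suc s * \<zeta> ^ Suc s) \<longlongrightarrow> 0 * 0 ^ Suc s) (at 0)"
    by (intro tendsto_intros Suc.prems(3))
  then have "((\<lambda>\<zeta>. u \<zeta> / \<zeta> ^ Suc s * \<zeta> ^ Suc s) \<longlongrightarrow> 0) (at 0)" by simp
  then have "(u \<longlongrightarrow> 0) (at 0)"
    by (rule Lim_transform_eventually) (auto simp: eventually_at_filter)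
  ultimately have u0: "u 0 = 0" using LIM_unique by blast
  obtain w where w: "w holomorphic_on ball 0 1" "\<And>z. cmod z < 1 \<Longrightarrow> u z = z * w z"
    using Schwarz3[OF Suc.prems(1) u0] by auto
  have "cmod (w z) \<le> b" if z: "cmod z < 1" "z \<noteq> 0" for z
    using Schwarz_bound[OF Suc.prems(1) u0 Suc.prems(2) z(1)] w(2)[OF z(1)] z(2)
    by (simp add: norm_mult mult.commute)
  moreover have "((\<lambda>\<zeta>. w \<zeta> / \<zeta> ^ s) \<longlongrightarrow> 0) (at 0)"
  proof (rule Lim_transform_eventually[OF Suc.prems(3)])
    have "\<forall>\<^sub>F z in at 0. z \<in> ball (0::complex) 1 - {0}"
      by (rule eventually_at_in_open) auto
    then show "\<forall>\<^sub>F z in at 0. u z / z ^ Suc s = w z / z ^ s"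
      by eventually_elim (simp add: w(2))
  qed
  ultimately have "cmod (w \<zeta>) \<le> b * cmod \<zeta> ^ Suc s"
    using Suc.IH[OF w(1) _ _ Suc.prems(4)] by blast
  then have "cmod \<zeta> * cmod (w \<zeta>) \<le> cmod \<zeta> * (b * cmod \<zeta> ^ Suc s)"
    by (rule mult_left_mono) simp
  then show ?case using w(2)[OF Suc.prems(4)] by (simp add: norm_mult algebra_simps)
qed

definition l1norm :: "nat \<Rightarrow> (nat \<Rightarrow> complex) \<Rightarrow> real" where
  "l1norm a w = (\<Sum>i<a. cmod (w i))"

lemma l1norm_nonneg: "0 \<le> l1norm a w"
  by (simp add: l1norm_def sum_nonneg)

lemma l1norm_add: "l1norm a (\<lambda>i. u i + v i) \<le> l1norm a u + l1norm a v"
  by (simp add: l1norm_def flip: sum.distrib) (intro sum_mono norm_triangle_ineq)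

lemma l1norm_smult: "l1norm a (\<lambda>i. c * u i) = cmod c * l1norm a u"
  by (simp add: l1norm_def norm_mult sum_distrib_left)

lemma l1norm_eq_0: "w \<in> cvec a \<Longrightarrow> l1norm a w = 0 \<Longrightarrow> w = (\<lambda>i. 0)"
proof (rule ext)
  fix i assume w: "w \<in> cvec a" "l1norm a w = 0"
  then have "\<forall>i<a. w i = 0" by (simp add: l1norm_def sum_nonneg_eq_0_iff)
  then show "w i = 0" using w(1) by (cases "i < a") (auto simp: cvec_def)
qed

text \<open>Cartan's uniqueness theorem: if \<open>f = id + E\<close> with \<open>E\<close> of order \<open>s \<ge> 2\<close> at the origin, then the
  iterates satisfy \<open>f\<^sup>k = id + k E + O(s+1)\<close>, and boundedness of all iterates kills the
  part of order \<open>s\<close>.\<close>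

lemma Cartan_uniqueness:
  assumes Dc: "D \<subseteq> cvec a"
    and ball: "\<And>w. w \<in> cvec a \<Longrightarrow> l1norm a w < 1 \<Longrightarrow> w \<in> D"
    and bd: "\<And>w i. w \<in> D \<Longrightarrow> cmod (w i) \<le> R"
    and f: "curve_holo a D f" and fD: "f ` D \<subseteq> D" and f0: "f (\<lambda>i. 0) = (\<lambda>i. 0)"
    and f1: "\<And>v. v \<in> cvec a \<Longrightarrow> curve_deriv (\<lambda>t. f (\<lambda>i. t * v i)) 0 v"
    and w: "w \<in> cvec a" "l1norm a w < 1"
  shows "f w = w"
proof -
  define E where "E j w = f w j - w j" for j w
  have z0: "(\<lambda>i. 0) \<in> D" by (rule ball) (auto simp: cvec_def l1norm_def)
  have R0: "0 \<le> R" using bd[OF z0] by simp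
  have Ebd: "cmod (E j w) \<le> 2 * R" if "w \<in> D" for j w
    using norm_triangle_ineq4[of "f w j" "w j"] bd[OF that, where i=j] bd[of "f w", where i=j] fD that
    by (auto simp: E_def)
  have E0: "E j (\<lambda>i. 0) = 0" for j by (simp add: E_def f0)
  have line: "(\<lambda>t. E j (\<lambda>i. p i + t * q i)) holomorphic_on ball 0 1"
    if "\<And>t. cmod t < 1 \<Longrightarrow> (\<lambda>i. p i + t * q i) \<in> D" for p q j
  proof -
    have "(\<lambda>t. f (\<lambda>i. p i + t * q i) j) holomorphic_on ball 0 1"
      by (rule curve_holo_holomorphic_on[OF f]) (auto intro!: holomorphic_intros that)
    then show ?thesis unfolding E_def by (intro holomorphic_intros)
  qed
  have disc: "(\<lambda>i. t * Z i) \<in> D" if "Z \<in> cvec a" "l1norm a Z = 1" "cmod t < 1" for Z t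
    using that by (intro ball cvec_smult) (simp_all add: l1norm_smult)
  \<comment> \<open>Order of vanishing \<open>s\<close> with the constant \<open>2 * R\<close>, the
    sup bound of \<open>E\<close>. As the constant is the same for every \<open>s\<close>, letting
    \<open>s\<close> grow gives \<open>E j w = 0\<close> in the end.\<close>
  define P where "P s \<longleftrightarrow> (\<forall>w j. w \<in> cvec a \<longrightarrow> l1norm a w < 1 \<longrightarrow> cmod (E j w) \<le> 2 * R * l1norm a w ^ s)" for s
  \<comment> \<open>Limits along complex lines through the origin suffice: on each line the Schwarz
    estimate restores the constant \<open>2 * R\<close>.\<close>
  have slices: "P (Suc s)"
    if lim: "\<And>Z j. Z \<in> cvec a \<Longrightarrow> l1norm a Z = 1 \<Longrightarrow> ((\<lambda>t. E j (\<lambda>i. t * Z i) / t ^ s) \<longlongrightarrow> 0) (at 0)" for s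
    unfolding P_def
  proof (intro allI impI)
    fix w j assume w: "w \<in> cvec a" "l1norm a w < 1"
    show "cmod (E j w) \<le> 2 * R * l1norm a w ^ Suc s"
    proof (cases "l1norm a w = 0")
      case True
      then show ?thesis using l1norm_eq_0[OF w(1)] by (simp add: E0)
    next
      case False
      define r where "r = l1norm a w"
      have r: "0 < r" "r < 1" using False w(2) l1norm_nonneg[of a w] by (auto simp: r_def)
      define Z where "Z = (\<lambda>i. complex_of_real (1/r) * w i)"
      have Z: "Z \<in> cvec a" "l1norm a Z = 1"
        unfolding Z_def using r w(1) by (auto simp: cvec_smult l1norm_smult r_def[symmetric] norm_divide simp del: of_real_divide)
      have "cmod (E j (\<lambda>i. complex_of_real r * Z i)) \<le> 2 * R * cmod (complex_of_real r) ^ Suc s"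
      proof (rule Schwarz_bound_order[of "\<lambda>t. E j (\<lambda>i. t * Z i)"])
        show "(\<lambda>t. E j (\<lambda>i. t * Z i)) holomorphic_on ball 0 1"
          using line[of "\<lambda>i. 0" Z j] disc[OF Z] by simp
        show "\<And>t. cmod t < 1 \<Longrightarrow> cmod (E j (\<lambda>i. t * Z i)) \<le> 2 * R"
          by (intro Ebd disc Z)
        show "((\<lambda>t. E j (\<lambda>i. t * Z i) / t ^ s) \<longlongrightarrow> 0) (at 0)" by (rule lim[OF Z])
        show "cmod (complex_of_real r) < 1" using r by simp
      qed
      moreover have "(\<lambda>i. complex_of_real r * Z i) = w" using r by (auto simp: Z_def)
      ultimately show ?thesis using r by (simp add: r_def)
    qed
  qed
  have P2: "P (Suc 1)"
  proof (rule slices)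
    fix Z j assume Z: "Z \<in> cvec a" "l1norm a Z = 1"
    have "((\<lambda>t. f (\<lambda>i. t * Z i) j) has_field_derivative Z j) (at 0)"
      using f1[OF Z(1)] by (simp add: curve_deriv_def)
    then have "((\<lambda>t. f (\<lambda>i. t * Z i) j / t) \<longlongrightarrow> Z j) (at 0)"
      by (simp add: has_field_derivative_iff f0)
    then have "((\<lambda>t. f (\<lambda>i. t * Z i) j / t - Z j) \<longlongrightarrow> 0) (at 0)" by (simp add: LIM_zero)
    then show "((\<lambda>t. E j (\<lambda>i. t * Z i) / t ^ 1) \<longlongrightarrow> 0) (at 0)"
      by (rule Lim_transform_eventually) (auto simp: eventually_at_filter E_def field_simps)
  qed
  \<comment> \<open>A Lipschitz estimate in place of a Cauchy estimate for the derivative of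
    \<open>E\<close>. Points at least \<open>r\<close> apart are covered by the sup bound on the
    ball of radius \<open>2 * r\<close>; for closer ones the segment from \<open>Y\<close> through
    \<open>X\<close> is stretched to length \<open>r\<close>, and Schwarz is applied on the disc it
    spans.\<close>
  have lip: "cmod (E j X - E j Y) * r \<le> 4 * R * (2 * r) ^ s * l1norm a (\<lambda>i. X i - Y i)"
    if Ps: "P s" and X: "X \<in> cvec a" "l1norm a X \<le> r" and Y: "Y \<in> cvec a" "l1norm a Y \<le> r"
      and r: "0 < r" "2 * r < 1" for s r X Y j
  proof -
    define \<delta> where "\<delta> = l1norm a (\<lambda>i. X i - Y i)"
    have XY: "(\<lambda>i. X i - Y i) \<in> cvec a" using X Y by (simp add: cvec_diff)
    have bnd: "cmod (E j V) \<le> 2 * R * (2 * r) ^ s" if V: "V \<in> cvec a" "l1norm a V \<le> 2 * r" for V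
    proof -
      have "cmod (E j V) \<le> 2 * R * l1norm a V ^ s" using Ps V r by (simp add: P_def)
      also have "\<dots> \<le> 2 * R * (2 * r) ^ s"
        using V R0 l1norm_nonneg by (intro mult_left_mono power_mono) auto
      finally show ?thesis .
    qed
    have dbnd: "cmod (E j V - E j Y) \<le> 4 * R * (2 * r) ^ s" if "V \<in> cvec a" "l1norm a V \<le> 2 * r" for V
      using norm_triangle_ineq4[of "E j V" "E j Y"] bnd[OF that] bnd[OF Y(1)] Y(2) r by simp
    consider "\<delta> = 0" | "r \<le> \<delta>" | "0 < \<delta>" "\<delta> < r"
      using l1norm_nonneg[of a "\<lambda>i. X i - Y i"] by (fold \<delta>_def) linarith
    then show ?thesis
    proof cases
      case 1
      then have "(\<lambda>i. X i - Y i) = (\<lambda>i. 0)" using l1norm_eq_0[OF XY] by (simp add: \<delta>_def)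
      then have "X = Y" by (metis eq_iff_diff_eq_0 ext)
      then show ?thesis by (simp add: l1norm_def)
    next
      case 2
      then have "cmod (E j X - E j Y) * r \<le> 4 * R * (2 * r) ^ s * \<delta>"
        using dbnd[OF X(1)] X(2) r R0 by (intro mult_mono) auto
      then show ?thesis by (simp add: \<delta>_def)
    next
      case 3
      define q where "q = (\<lambda>i. complex_of_real (r / \<delta>) * (X i - Y i))"
      have q: "q \<in> cvec a" "l1norm a q = r"
        using 3 r XY unfolding q_def l1norm_smult by (auto simp: cvec_smult \<delta>_def[symmetric] simp del: of_real_divide)
      have pt: "(\<lambda>i. Y i + t * q i) \<in> cvec a" "l1norm a (\<lambda>i. Y i + t * q i) \<le> 2 * r" if "cmod t < 1" for t
      proof -
        show "(\<lambda>i. Y i + t * q i) \<in> cvec a" using Y q by (intro cvec_add cvec_smult)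
        have "l1norm a (\<lambda>i. t * q i) \<le> 1 * r"
          unfolding l1norm_smult using that q r by (intro mult_mono) auto
        then show "l1norm a (\<lambda>i. Y i + t * q i) \<le> 2 * r"
          using l1norm_add[of a Y "\<lambda>i. t * q i"] Y(2) by linarith
      qed
      have "cmod (E j (\<lambda>i. Y i + complex_of_real (\<delta> / r) * q i) - E j Y)
          \<le> 4 * R * (2 * r) ^ s * cmod (complex_of_real (\<delta> / r))"
      proof (rule Schwarz_bound[of "\<lambda>t. E j (\<lambda>i. Y i + t * q i) - E j Y"])
        show "(\<lambda>t. E j (\<lambda>i. Y i + t * q i) - E j Y) holomorphic_on ball 0 1"
        proof (intro holomorphic_intros line ball)
          fix t :: complex assume t: "cmod t < 1"
          show "(\<lambda>i. Y i + t * q i) \<in> cvec a" using pt(1)[OF t] .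
          show "l1norm a (\<lambda>i. Y i + t * q i) < 1" using pt(2)[OF t] r by linarith
        qed
        show "cmod (E j (\<lambda>i. Y i + t * q i) - E j Y) \<le> 4 * R * (2 * r) ^ s" if "cmod t < 1" for t
          using dbnd pt that by blast
        show "cmod (complex_of_real (\<delta> / r)) < 1" using 3 r unfolding norm_of_real by simp
      qed simp
      moreover have "(\<lambda>i. Y i + complex_of_real (\<delta> / r) * q i) = X"
        using 3 r by (auto simp: q_def)
      moreover have "cmod (complex_of_real (\<delta> / r)) = \<delta> / r" using 3 r unfolding norm_of_real by simp
      ultimately have "cmod (E j X - E j Y) \<le> 4 * R * (2 * r) ^ s * (\<delta> / r)" by simp
      then show ?thesis using r by (simp add: \<delta>_def field_simps)
    qed
  qed
  have step: "P (Suc s)" if Ps: "P s" and s: "2 \<le> s" for s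
  proof (rule slices)
    fix Z j assume Z: "Z \<in> cvec a" "l1norm a Z = 1"
    define Y where "Y t = (\<lambda>i. t * Z i)" for t :: complex
    have Yc: "Y t \<in> cvec a" and Yl: "l1norm a (Y t) = cmod t" for t
      using Z by (simp_all add: Y_def cvec_smult l1norm_smult)
    have YD: "Y t \<in> D" if "cmod t < 1" for t using disc[OF Z that] by (simp add: Y_def)
    have EY: "cmod (E j (Y t)) \<le> 2 * R * cmod t ^ s" if "cmod t < 1" for t j
      using Ps[unfolded P_def, rule_format, of "Y t" j] that Yc Yl by simp
    define X where "X k t = (f ^^ k) (Y t)" for k t
    have XD: "X k t \<in> D" if "cmod t < 1" for k t
      unfolding X_def using YD[OF that] fD by (induction k) auto
    have Xhol: "(\<lambda>t. X k t i) holomorphic_on ball 0 1" for k i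
    proof (induction k arbitrary: i)
      case 0
      then show ?case by (auto simp: X_def Y_def intro!: holomorphic_intros)
    next
      case (Suc k)
      have "(\<lambda>t. f (X k t) i) holomorphic_on ball 0 1"
        by (rule curve_holo_holomorphic_on[OF f]) (auto simp: XD Suc)
      then show ?case by (simp add: X_def)
    qed
    have expand: "\<exists>C\<ge>0. \<forall>\<^sub>F t in at 0. \<forall>j. cmod (X k t j - Y t j - of_nat k * E j (Y t)) \<le> C * cmod t ^ Suc s" for k
    proof (induction k)
      case 0
      show ?case by (rule exI[of _ 0]) (simp add: X_def)
    next
      case (Suc k)
      then obtain C where C: "0 \<le> C"
        "\<forall>\<^sub>F t in at 0. \<forall>j. cmod (X k t j - Y t j - of_nat k * E j (Y t)) \<le> C * cmod t ^ Suc s"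
        by auto
      \<comment> \<open>\<open>K * cmod t ^ s\<close> will bound the distance of
        \<open>X k t\<close> from \<open>Y t\<close>. The factor \<open>4 ^ s\<close> in
        \<open>C'\<close> comes from \<open>lip\<close> with \<open>r = 2 * cmod t\<close>.\<close>
      define K where "K = real a * (real k * (2 * R) + C)"
      have K0: "0 \<le> K" using R0 C by (simp add: K_def)
      define C' where "C' = C + 4 * R * 4 ^ s * K"
      \<comment> \<open>The bound \<open>1/4\<close> keeps the radius \<open>4 * cmod t\<close> in
        \<open>lip\<close> below 1; \<open>1 / (K + 1)\<close> gives
        \<open>K * cmod t \<le> 1\<close>, so that \<open>X k t\<close> stays within twice the norm
        of \<open>Y t\<close>.\<close>
      have "\<forall>\<^sub>F t in at (0::complex). dist t 0 < min (1/4) (1 / (K + 1))"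
        unfolding eventually_at using K0
        by (intro exI[of _ "min (1/4) (1 / (K + 1))"]) auto
      then have "\<forall>\<^sub>F t in at 0. \<forall>j. cmod (X (Suc k) t j - Y t j - of_nat (Suc k) * E j (Y t)) \<le> C' * cmod t ^ Suc s"
        using C(2) eventually_neq_at_within[of 0]
      proof eventually_elim
        case (elim t)
        have t: "cmod t < 1/4" "cmod t < 1 / (K + 1)" using elim(1) by auto
        have Kt: "K * cmod t \<le> 1"
        proof -
          have "(K + 1) * cmod t < 1" using t(2) K0 by (simp add: field_simps)
          then show ?thesis using norm_ge_zero[of t] unfolding distrib_right by linarith
        qed
        have t1: "cmod t < 1" using t by simp
        have pw: "cmod t ^ Suc s \<le> cmod t ^ s" using t1 by (intro power_decreasing) auto
        have diff: "cmod (X k t j - Y t j) \<le> (real k * (2 * R) + C) * cmod t ^ s" for j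
        proof -
          have "cmod (X k t j - Y t j) \<le> cmod (X k t j - Y t j - of_nat k * E j (Y t)) + cmod (of_nat k * E j (Y t))"
            using norm_triangle_sub[of "X k t j - Y t j" "of_nat k * E j (Y t)"] by linarith
          also have "\<dots> \<le> C * cmod t ^ s + real k * (2 * R * cmod t ^ s)"
          proof (rule add_mono)
            have "cmod (X k t j - Y t j - of_nat k * E j (Y t)) \<le> C * cmod t ^ Suc s" using elim(2) by blast
            also have "\<dots> \<le> C * cmod t ^ s" using pw C(1) by (rule mult_left_mono)
            finally show "cmod (X k t j - Y t j - of_nat k * E j (Y t)) \<le> C * cmod t ^ s" .
            show "cmod (of_nat k * E j (Y t)) \<le> real k * (2 * R * cmod t ^ s)"
              using EY[OF t1, of j] by (simp add: norm_mult mult_left_mono)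
          qed
          finally show ?thesis by (simp add: algebra_simps)
        qed
        have XYl: "l1norm a (\<lambda>i. X k t i - Y t i) \<le> K * cmod t ^ s"
          using sum_bounded_above[of "{..<a}", OF diff] by (simp add: l1norm_def K_def mult.assoc)
        have "cmod t ^ s = cmod t * cmod t ^ (s - 1)" using s by (simp add: power_eq_if[of _ s])
        also have "\<dots> \<le> cmod t * cmod t ^ 1" using s t1 by (intro mult_left_mono power_decreasing) auto
        finally have "K * cmod t ^ s \<le> K * cmod t * cmod t" using K0 by (simp add: mult_left_mono mult.assoc)
        also have "\<dots> \<le> 1 * cmod t" using Kt by (intro mult_right_mono) auto
        finally have small: "K * cmod t ^ s \<le> cmod t" by simp
        have "l1norm a (X k t) \<le> l1norm a (Y t) + l1norm a (\<lambda>i. X k t i - Y t i)"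
          using l1norm_add[of a "Y t" "\<lambda>i. X k t i - Y t i"] by simp
        then have Xl: "l1norm a (X k t) \<le> 2 * cmod t" using XYl small Yl[of t] by linarith
        have Xc: "X k t \<in> cvec a" using XD[OF t1] Dc by auto
        show ?case
        proof
          fix j
          have "cmod (E j (X k t) - E j (Y t)) * (2 * cmod t)
             \<le> 4 * R * (2 * (2 * cmod t)) ^ s * l1norm a (\<lambda>i. X k t i - Y t i)"
            using Xl Xc Yc[of t] Yl[of t] t elim(3) by (intro lip Ps) auto
          also have "\<dots> \<le> 4 * R * (2 * (2 * cmod t)) ^ s * (K * cmod t ^ s)"
            using XYl R0 by (intro mult_left_mono) auto
          also have "\<dots> = 4 * R * 4 ^ s * K * (cmod t ^ s * cmod t ^ s)"
            by (simp add: power_mult_distrib)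
          \<comment> \<open>Here \<open>2 \<le> s\<close> decides: the product of two terms of order
            \<open>s\<close> has order at least \<open>s + 2\<close>, and cancelling
            \<open>cmod t\<close> leaves \<open>s + 1\<close>.\<close>
          also have "\<dots> \<le> 4 * R * 4 ^ s * K * (cmod t ^ s * cmod t ^ 2)"
            using R0 K0 s t1 by (intro mult_left_mono power_decreasing) auto
          also have "\<dots> = 4 * R * 4 ^ s * K * cmod t ^ Suc s * cmod t" by (simp add: power2_eq_square)
          also have "\<dots> \<le> 4 * R * 4 ^ s * K * cmod t ^ Suc s * (2 * cmod t)"
            using R0 K0 by (intro mult_left_mono) auto
          finally have "cmod (E j (X k t) - E j (Y t)) \<le> 4 * R * 4 ^ s * K * cmod t ^ Suc s"
            by (rule mult_right_le_imp_le) (use elim(3) in simp)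
          moreover have "cmod (X k t j - Y t j - of_nat k * E j (Y t)) \<le> C * cmod t ^ Suc s"
            using elim(2) by blast
          moreover have "X (Suc k) t j - Y t j - of_nat (Suc k) * E j (Y t)
            = (X k t j - Y t j - of_nat k * E j (Y t)) + (E j (X k t) - E j (Y t))"
            by (simp add: X_def E_def[of j "(f ^^ k) (Y t)"] algebra_simps)
          ultimately show "cmod (X (Suc k) t j - Y t j - of_nat (Suc k) * E j (Y t)) \<le> C' * cmod t ^ Suc s"
            using norm_triangle_ineq[of "X k t j - Y t j - of_nat k * E j (Y t)" "E j (X k t) - E j (Y t)"]
            unfolding C'_def distrib_right by (simp only:)
        qed
      qed
      moreover have "0 \<le> C'" using C R0 K0 by (simp add: C'_def)
      ultimately show ?case by (intro exI[of _ C'] conjI)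
    qed
    \<comment> \<open>The constants in \<open>expand\<close> depend on \<open>k\<close>. Here they
      only serve to show that \<open>X k t - Y t\<close> is negligible against
      \<open>t ^ (s - 1)\<close>; Schwarz then replaces them by \<open>2 * R\<close>, uniformly in
      \<open>k\<close>.\<close>
    have Xbd: "cmod (X k t j - Y t j) \<le> 2 * R * cmod t ^ s" if t: "cmod t < 1" for k t
    proof -
      obtain C where C: "0 \<le> C"
        "\<forall>\<^sub>F t in at 0. \<forall>j. cmod (X k t j - Y t j - of_nat k * E j (Y t)) \<le> C * cmod t ^ Suc s"
        using expand[of k] by auto
      have "\<forall>\<^sub>F t in at (0::complex). t \<in> ball 0 1 - {0}" by (rule eventually_at_in_open) auto
      then have "\<forall>\<^sub>F t in at 0. cmod ((X k t j - Y t j) / t ^ (s - 1)) \<le> (C + real k * (2 * R)) * cmod t"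
        using C(2)
      proof eventually_elim
        case (elim t)
        have t: "cmod t < 1" "t \<noteq> 0" using elim(1) by auto
        have "cmod (X k t j - Y t j) \<le> cmod (X k t j - Y t j - of_nat k * E j (Y t)) + cmod (of_nat k * E j (Y t))"
          using norm_triangle_sub[of "X k t j - Y t j" "of_nat k * E j (Y t)"] by linarith
        also have "\<dots> \<le> C * cmod t ^ s + real k * (2 * R * cmod t ^ s)"
        proof (rule add_mono)
          have "cmod (X k t j - Y t j - of_nat k * E j (Y t)) \<le> C * cmod t ^ Suc s" using elim(2) by blast
          also have "\<dots> \<le> C * cmod t ^ s" using C(1) t by (intro mult_left_mono power_decreasing) auto
          finally show "cmod (X k t j - Y t j - of_nat k * E j (Y t)) \<le> C * cmod t ^ s" .
          show "cmod (of_nat k * E j (Y t)) \<le> real k * (2 * R * cmod t ^ s)"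
            using EY[OF t(1), of j] by (simp add: norm_mult mult_left_mono)
        qed
        also have "\<dots> = (C + real k * (2 * R)) * cmod t * cmod t ^ (s - 1)"
        proof -
          have "cmod t ^ s = cmod t * cmod t ^ (s - 1)" using s by (simp add: power_eq_if[of _ s])
          then show ?thesis by (simp add: algebra_simps)
        qed
        finally show ?case using t by (simp add: norm_divide norm_power divide_le_eq)
      qed
      moreover have "((\<lambda>t. (C + real k * (2 * R)) * cmod t) \<longlongrightarrow> (C + real k * (2 * R)) * cmod 0) (at 0)"
        by (intro tendsto_intros)
      then have "((\<lambda>t. (C + real k * (2 * R)) * cmod t) \<longlongrightarrow> 0) (at 0)" by simp
      ultimately have lim: "((\<lambda>t. (X k t j - Y t j) / t ^ (s - 1)) \<longlongrightarrow> 0) (at 0)"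
        by (rule Lim_null_comparison)
      have hol: "(\<lambda>t. X k t j - Y t j) holomorphic_on ball 0 1"
        unfolding Y_def by (intro holomorphic_intros Xhol)
      have bnd: "cmod (X k t j - Y t j) \<le> 2 * R" if "cmod t < 1" for t
        using norm_triangle_ineq4[of "X k t j" "Y t j"] bd[OF XD[OF that, of k], where i=j] bd[OF YD[OF that], where i=j] by linarith
      have "cmod (X k t j - Y t j) \<le> 2 * R * cmod t ^ Suc (s - 1)"
        by (rule Schwarz_bound_order[OF hol bnd lim t])
      then show ?thesis using s by simp
    qed
    show "((\<lambda>t. E j (\<lambda>i. t * Z i) / t ^ s) \<longlongrightarrow> 0) (at 0)"
    proof (rule tendstoI)
      fix \<epsilon> :: real assume \<epsilon>: "0 < \<epsilon>"
      \<comment> \<open>\<open>k\<close> is chosen before \<open>t\<close>, as \<open>C\<close>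
        depends on it. Of the two terms that bound \<open>k\<close> times \<open>E\<close>, the one
        with \<open>2 * R\<close> is then less than half of
        \<open>\<epsilon> * k * cmod t ^ s\<close>, and a small \<open>t\<close> puts the one with
        \<open>C\<close> below the other half.\<close>
      obtain k where k: "4 * R / \<epsilon> < real k" using reals_Archimedean2 by blast
      have k0: "0 < real k" using k divide_nonneg_pos[of "4 * R" \<epsilon>] R0 \<epsilon> by linarith
      obtain C where C: "0 \<le> C"
        "\<forall>\<^sub>F t in at 0. \<forall>j. cmod (X k t j - Y t j - of_nat k * E j (Y t)) \<le> C * cmod t ^ Suc s"
        using expand[of k] by auto
      have "0 < \<epsilon> * real k / (2 * (C + 1))" using \<epsilon> k0 C by simp
      then have "\<forall>\<^sub>F t in at (0::complex). t \<in> ball 0 (min 1 (\<epsilon> * real k / (2 * (C + 1)))) - {0}"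
        by (intro eventually_at_in_open) auto
      then show "\<forall>\<^sub>F t in at 0. dist (E j (\<lambda>i. t * Z i) / t ^ s) 0 < \<epsilon>"
        using C(2)
      proof eventually_elim
        case (elim t)
        have t: "cmod t < 1" "t \<noteq> 0" "cmod t < \<epsilon> * real k / (2 * (C + 1))" using elim(1) by auto
        have ts: "0 < cmod t ^ s" using t by simp
        have "real k * cmod (E j (Y t)) = cmod (of_nat k * E j (Y t))" by (simp add: norm_mult)
        also have "\<dots> \<le> cmod (X k t j - Y t j) + cmod (X k t j - Y t j - of_nat k * E j (Y t))"
          using norm_triangle_ineq4[of "X k t j - Y t j" "X k t j - Y t j - of_nat k * E j (Y t)"] by simp
        also have "\<dots> \<le> 2 * R * cmod t ^ s + C * cmod t ^ Suc s"
          using Xbd[OF t(1), of k] elim(2) by (intro add_mono) auto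
        also have "\<dots> = (2 * R + C * cmod t) * cmod t ^ s" by (simp add: algebra_simps)
        also have "\<dots> < \<epsilon> * real k * cmod t ^ s"
        proof (rule mult_strict_right_mono[OF _ ts])
          have "2 * R < \<epsilon> * real k / 2" using k \<epsilon> by (simp add: field_simps)
          moreover have "(C + 1) * cmod t < \<epsilon> * real k / 2" using t(3) C(1) by (simp add: field_simps)
          moreover have "C * cmod t \<le> (C + 1) * cmod t" by (simp add: algebra_simps)
          ultimately show "2 * R + C * cmod t < \<epsilon> * real k" by linarith
        qed
        finally have "real k * cmod (E j (Y t)) < real k * (\<epsilon> * cmod t ^ s)" by (simp add: algebra_simps)
        then have "cmod (E j (Y t)) < \<epsilon> * cmod t ^ s" using k0 by simp
        then show ?case using ts by (simp add: norm_divide norm_power Y_def divide_less_eq)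
      qed
    qed
  qed
  have PP: "P (s + 2)" for s
  proof (induction s)
    case 0
    then show ?case using P2 by (simp add: numeral_2_eq_2)
  next
    case (Suc s)
    then show ?case using step[of "s + 2"] by simp
  qed
  have "f w j = w j" for j
  proof -
    have "cmod (E j w) \<le> 2 * R * l1norm a w ^ (s + 2)" for s
      using PP[of s] w by (simp only: P_def)
    moreover have "(\<lambda>s. 2 * R * l1norm a w ^ (s + 2)) \<longlonglongrightarrow> 2 * R * 0"
      using w(2) l1norm_nonneg[of a w]
      by (intro tendsto_mult_left LIMSEQ_ignore_initial_segment LIMSEQ_realpow_zero)
    ultimately have "cmod (E j w) \<le> 2 * R * 0"
      by (intro LIMSEQ_le_const) auto
    then show ?thesis by (simp add: E_def)
  qed
  then show ?thesis by (rule ext)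
qed

section \<open>Linearity of involutions\<close>

definition matvec :: "nat \<Rightarrow> (nat \<Rightarrow> nat \<Rightarrow> complex) \<Rightarrow> (nat \<Rightarrow> complex) \<Rightarrow> nat \<Rightarrow> complex" where
  "matvec a d v = (\<lambda>i. \<Sum>j<a. d i j * v j)"

lemma matvec_add: "matvec a d (\<lambda>i. u i + v i) = (\<lambda>i. matvec a d u i + matvec a d v i)"
  by (simp add: matvec_def algebra_simps sum.distrib)

lemma matvec_smult: "matvec a d (\<lambda>i. c * v i) = (\<lambda>i. c * matvec a d v i)"
  by (simp add: matvec_def sum_distrib_left algebra_simps)

lemma curve_deriv_cong:
  assumes "\<forall>\<^sub>F t in nhds \<zeta>. \<gamma> t = \<eta> t"
  shows "curve_deriv \<gamma> \<zeta> v \<longleftrightarrow> curve_deriv \<eta> \<zeta> v"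
proof -
  have "((\<lambda>t. \<gamma> t i) has_field_derivative v i) (at \<zeta>) \<longleftrightarrow> ((\<lambda>t. \<eta> t i) has_field_derivative v i) (at \<zeta>)" for i
    by (rule DERIV_cong_ev) (use assms in \<open>auto elim: eventually_mono\<close>)
  then show ?thesis by (simp add: curve_deriv_def)
qed

lemma curve_deriv_unique: "curve_deriv \<gamma> \<zeta> u \<Longrightarrow> curve_deriv \<gamma> \<zeta> v \<Longrightarrow> u = v"
  unfolding curve_deriv_def using DERIV_unique by (intro ext) fast

lemma curve_deriv_line: "curve_deriv (\<lambda>t i. t * v i) 0 v"
  unfolding curve_deriv_def by (auto intro!: derivative_eq_intros)

lemma curve_deriv_smult: "curve_deriv \<gamma> \<zeta> v \<Longrightarrow> curve_deriv (\<lambda>t i. c * \<gamma> t i) \<zeta> (\<lambda>i. c * v i)"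
  unfolding curve_deriv_def by (auto intro!: DERIV_cmult)

lemma curve_holo_smult:
  assumes "D \<subseteq> cvec a" shows "curve_holo a D (\<lambda>w i. c * w i)"
proof (rule holo_map_imp_curve_holo[OF _ assms])
  show "holo_map a a D (\<lambda>w i. c * w i)"
    using assms by (auto simp: holo_map_def intro!: cvec_smult holo_comp_intros)
qed

lemma eventually_smult_small:
  assumes "0 < r" shows "\<forall>\<^sub>F t in nhds 0. l1norm a (\<lambda>i. t * v i) < r"
proof -
  have "((\<lambda>t. cmod t * l1norm a v) \<longlongrightarrow> cmod 0 * l1norm a v) (nhds 0)"
    by (intro tendsto_intros) (simp add: filterlim_ident)
  then have "\<forall>\<^sub>F t in nhds 0. cmod t * l1norm a v < r"
    by (rule order_tendstoD) (use assms in simp)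
  then show ?thesis by (simp add: l1norm_smult)
qed

text \<open>Cartan's linearity theorem, for an involution \<open>\<tau>\<close>: the maps \<open>c\<^sup>-\<^sup>1 \<tau> c \<tau>\<close> with \<open>|c| = 1\<close> have derivative
  the identity at the origin, so \<open>\<tau>\<close> commutes with rotations.\<close>

lemma Cartan_linear_involution:
  assumes Dc: "D \<subseteq> cvec a"
    and ball: "\<And>w. w \<in> cvec a \<Longrightarrow> l1norm a w < 1 \<Longrightarrow> w \<in> D"
    and bd: "\<And>w i. w \<in> D \<Longrightarrow> cmod (w i) \<le> R"
    and bal: "\<And>w c. w \<in> D \<Longrightarrow> cmod c \<le> 1 \<Longrightarrow> (\<lambda>i. c * w i) \<in> D"
    and opn: "\<And>w. w \<in> D \<Longrightarrow> open {t. (\<lambda>i. t * w i) \<in> D}"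
    and \<tau>: "curve_holo a D \<tau>" and \<tau>D: "\<tau> ` D \<subseteq> D" and inv: "\<And>w. w \<in> D \<Longrightarrow> \<tau> (\<tau> w) = w"
    and \<tau>0: "\<tau> (\<lambda>i. 0) = (\<lambda>i. 0)"
  obtains d where "\<And>w. w \<in> D \<Longrightarrow> \<tau> w = matvec a d w"
    "\<And>v. v \<in> cvec a \<Longrightarrow> matvec a d v \<in> cvec a"
    "\<And>v. v \<in> cvec a \<Longrightarrow> matvec a d (matvec a d v) = v"
proof -
  have z0: "(\<lambda>i. 0) \<in> D" by (rule ball) (auto simp: cvec_def l1norm_def)
  have \<tau>in: "\<tau> w \<in> D" if "w \<in> D" for w using \<tau>D that by auto
  obtain d where d0: "\<And>\<gamma> \<zeta> v. \<lbrakk>\<gamma> \<zeta> = (\<lambda>i. 0); \<forall>\<^sub>F t in nhds \<zeta>. \<gamma> t \<in> D; curve_deriv \<gamma> \<zeta> v\<rbrakk>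
      \<Longrightarrow> curve_deriv (\<lambda>t. \<tau> (\<gamma> t)) \<zeta> (\<lambda>i. \<Sum>j<a. d i j * v j)"
    using bspec[OF \<tau>[unfolded curve_holo_def] z0] by auto
  have d: "curve_deriv (\<lambda>t. \<tau> (\<gamma> t)) 0 (matvec a d v)"
    if "\<gamma> 0 = (\<lambda>i. 0)" "\<forall>\<^sub>F t in nhds 0. \<gamma> t \<in> D" "curve_deriv \<gamma> 0 v" for \<gamma> v
    using d0[OF that] by (simp add: matvec_def)
  have line: "\<forall>\<^sub>F t in nhds 0. (\<lambda>i. t * v i) \<in> D" if "v \<in> cvec a" for v
    using eventually_smult_small[OF zero_less_one, of a v]
    by eventually_elim (use that in \<open>auto intro: ball cvec_smult\<close>)
  have d1: "curve_deriv (\<lambda>t. \<tau> (\<lambda>i. t * v i)) 0 (matvec a d v)" if "v \<in> cvec a" for v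
    using d[OF _ line[OF that] curve_deriv_line] by simp
  have ev\<tau>: "\<forall>\<^sub>F t in nhds 0. \<tau> (\<lambda>i. t * v i) \<in> D" if "v \<in> cvec a" for v
    using line[OF that] by eventually_elim (rule \<tau>in)
  have Lc: "matvec a d v \<in> cvec a" if v: "v \<in> cvec a" for v
    unfolding cvec_def
  proof (intro CollectI allI impI)
    fix i assume i: "a \<le> i"
    have "((\<lambda>t. \<tau> (\<lambda>i. t * v i) i) has_field_derivative matvec a d v i) (at 0)"
      using d1[OF v] by (simp add: curve_deriv_def)
    moreover have "((\<lambda>t. \<tau> (\<lambda>i. t * v i) i) has_field_derivative 0) (at 0) \<longleftrightarrow> ((\<lambda>t. 0::complex) has_field_derivative 0) (at 0)"
    proof (rule DERIV_cong_ev)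
      show "\<forall>\<^sub>F t in nhds 0. \<tau> (\<lambda>i. t * v i) i = 0"
        using ev\<tau>[OF v] by eventually_elim (use Dc i in \<open>auto simp: cvec_def\<close>)
    qed auto
    ultimately show "matvec a d v i = 0" using DERIV_unique[of _ _ 0] by auto
  qed
  have LL: "matvec a d (matvec a d v) = v" if v: "v \<in> cvec a" for v
  proof -
    have "curve_deriv (\<lambda>t. \<tau> (\<tau> (\<lambda>i. t * v i))) 0 (matvec a d (matvec a d v))"
      by (rule d[OF _ ev\<tau>[OF v] d1[OF v]]) (simp add: \<tau>0)
    moreover have ev: "\<forall>\<^sub>F t in nhds 0. \<tau> (\<tau> (\<lambda>i. t * v i)) = (\<lambda>i. t * v i)"
      using line[OF v] by eventually_elim (rule inv)
    ultimately have "curve_deriv (\<lambda>t i. t * v i) 0 (matvec a d (matvec a d v))"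
      using curve_deriv_cong[OF ev] by simp
    then show ?thesis by (rule curve_deriv_unique[OF _ curve_deriv_line])
  qed
  have rot: "\<tau> (\<lambda>i. c * w i) = (\<lambda>i. c * \<tau> w i)"
    if w: "w \<in> cvec a" "l1norm a w < 1" and c: "cmod c = 1" for w c
  proof -
    define f where "f = (\<lambda>w i. cnj c * \<tau> (\<lambda>i. c * \<tau> w i) i)"
    have cc: "cnj c * c = 1" "c * cnj c = 1" using c by (auto simp: complex_norm_square[symmetric] mult.commute)
    have c': "cmod (cnj c) = 1" using c by simp
    have wD: "w \<in> D" using ball w .
    have "f w = w"
    proof (rule Cartan_uniqueness[where D=D and a=a and R=R and f=f])
      have 1: "curve_holo a D (\<lambda>w i. c * \<tau> w i)"
        using curve_holo_comp[OF \<tau> curve_holo_smult[OF Dc] \<tau>D] .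
      have 2: "curve_holo a D (\<lambda>w. \<tau> (\<lambda>i. c * \<tau> w i))"
        by (rule curve_holo_comp[OF 1 \<tau>]) (auto simp: c intro!: bal \<tau>in)
      have "curve_holo a D (\<lambda>w i. cnj c * \<tau> (\<lambda>i. c * \<tau> w i) i)"
        by (rule curve_holo_comp[OF 2 curve_holo_smult[OF Dc]]) (auto simp: c intro!: bal \<tau>in)
      then show "curve_holo a D f" by (simp add: f_def)
      show "f ` D \<subseteq> D" unfolding f_def by (auto simp: c intro!: bal \<tau>in)
      show "f (\<lambda>i. 0) = (\<lambda>i. 0)" by (simp add: f_def \<tau>0)
      fix v assume v: "v \<in> cvec a"
      have cd: "curve_deriv (\<lambda>t i. c * \<tau> (\<lambda>i. t * v i) i) 0 (\<lambda>i. c * matvec a d v i)"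
        by (rule curve_deriv_smult[OF d1[OF v]])
      have "\<forall>\<^sub>F t in nhds 0. (\<lambda>i. c * \<tau> (\<lambda>i. t * v i) i) \<in> D"
        using ev\<tau>[OF v] by eventually_elim (simp add: bal c)
      from d[OF _ this cd]
      have "curve_deriv (\<lambda>t. \<tau> (\<lambda>i. c * \<tau> (\<lambda>i. t * v i) i)) 0 (\<lambda>i. c * v i)"
        by (simp add: \<tau>0 matvec_smult LL[OF v])
      from curve_deriv_smult[OF this, of "cnj c"]
      show "curve_deriv (\<lambda>t. f (\<lambda>i. t * v i)) 0 v"
        by (simp add: f_def cc flip: mult.assoc)
    qed (use w in \<open>auto intro: subsetD[OF Dc] ball bd\<close>)
    then have fw: "cnj c * \<tau> (\<lambda>i. c * \<tau> w i) i = w i" for i by (simp add: f_def fun_eq_iff)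
    have "\<tau> (\<lambda>i. c * \<tau> w i) = (\<lambda>i. c * w i)"
    proof
      fix i
      have "c * w i = c * (cnj c * \<tau> (\<lambda>i. c * \<tau> w i) i)" by (simp only: fw)
      also have "\<dots> = (c * cnj c) * \<tau> (\<lambda>i. c * \<tau> w i) i" by (simp only: mult.assoc)
      finally show "\<tau> (\<lambda>i. c * \<tau> w i) i = c * w i" by (simp only: cc mult_1)
    qed
    moreover have "\<tau> (\<tau> (\<lambda>i. c * \<tau> w i)) = (\<lambda>i. c * \<tau> w i)" by (intro inv bal \<tau>in wD) (simp add: c)
    ultimately show ?thesis by simp
  qed
  \<comment> \<open>The radius 1/2 leaves room for all \<open>t\<close> with
    \<open>cmod t < 2\<close>, so the closed unit disc lies in the domain of holomorphy. By
    \<open>rot\<close> the difference in \<open>zero\<close> vanishes on the unit circle, hence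
    inside.\<close>
  have small: "\<tau> w = matvec a d w" if w: "w \<in> cvec a" "l1norm a w < 1/2" for w
  proof -
    have w1: "w \<in> cvec a" "l1norm a w < 1" using w by auto
    have tD: "(\<lambda>i. t * w i) \<in> D" if "cmod t < 2" for t
    proof (intro ball cvec_smult w)
      have "cmod t * l1norm a w \<le> 2 * l1norm a w" using that l1norm_nonneg by (intro mult_right_mono) auto
      then show "l1norm a (\<lambda>i. t * w i) < 1" using w by (simp add: l1norm_smult)
    qed
    have zero: "\<tau> (\<lambda>i. t * w i) i - t * \<tau> w i = 0" if t: "cmod t < 1" for t i
    proof -
      have hol: "(\<lambda>t. \<tau> (\<lambda>i. t * w i) i - t * \<tau> w i) holomorphic_on ball 0 2"
        by (intro holomorphic_intros curve_holo_holomorphic_on[OF \<tau>]) (auto intro!: holomorphic_intros tD)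
      have "cmod (\<tau> (\<lambda>i. t * w i) i - t * \<tau> w i) \<le> 0"
      proof (rule maximum_modulus_frontier[where S="ball 0 1" and f="\<lambda>t. \<tau> (\<lambda>i. t * w i) i - t * \<tau> w i"])
        show "(\<lambda>t. \<tau> (\<lambda>i. t * w i) i - t * \<tau> w i) holomorphic_on interior (ball 0 1)"
          by (rule holomorphic_on_subset[OF hol]) auto
        show "continuous_on (closure (ball 0 1)) (\<lambda>t. \<tau> (\<lambda>i. t * w i) i - t * \<tau> w i)"
          by (rule holomorphic_on_imp_continuous_on[OF holomorphic_on_subset[OF hol]]) auto
        fix z :: complex assume "z \<in> frontier (ball 0 1)"
        then have "cmod z = 1" by simp
        then show "cmod (\<tau> (\<lambda>i. z * w i) i - z * \<tau> w i) \<le> 0" by (simp add: rot[OF w1])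
      qed (use t in auto)
      then show ?thesis by simp
    qed
    have "\<forall>\<^sub>F t in nhds (0::complex). t \<in> ball 0 1" by (rule eventually_nhds_in_open) auto
    then have ev: "\<forall>\<^sub>F t in nhds 0. \<tau> (\<lambda>i. t * w i) = (\<lambda>i. t * \<tau> w i)"
      by eventually_elim (use zero in auto)
    have "curve_deriv (\<lambda>t i. t * \<tau> w i) 0 (matvec a d w)"
      using d1[OF w(1)] curve_deriv_cong[OF ev] by simp
    then show ?thesis using curve_deriv_unique[OF _ curve_deriv_line] by metis
  qed
  have "\<tau> w = matvec a d w" if w: "w \<in> D" for w
  proof
    fix i
    \<comment> \<open>Balancedness makes the slice \<open>S\<close> starlike, hence connected, with
      1 in it. The identity theorem carries linearity from the disc of radius \<open>r\<close>,
      where \<open>t * w\<close> is small, to \<open>t = 1\<close>.\<close>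
    define S where "S = {t. (\<lambda>i. t * w i) \<in> D}"
    define r where "r = min 1 (1 / (2 * (l1norm a w + 1)))"
    have wc: "w \<in> cvec a" using w Dc by auto
    have l0: "0 \<le> l1norm a w" by (rule l1norm_nonneg)
    have r0: "0 < r" using l0 by (simp add: r_def)
    have S1: "t \<in> S" if "cmod t \<le> 1" for t using bal[OF w that] by (simp add: S_def)
    have "starlike S"
      unfolding starlike_def
    proof (intro bexI[of _ 0] ballI subsetI)
      fix x t assume x: "x \<in> S" and "t \<in> closed_segment 0 x"
      then obtain u where u: "0 \<le> u" "u \<le> 1" "t = complex_of_real u * x"
        by (auto simp: closed_segment_def scaleR_conv_of_real)
      have "(\<lambda>i. complex_of_real u * (x * w i)) \<in> D"
        using u x bal[of "\<lambda>i. x * w i" "complex_of_real u"] by (simp add: S_def)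
      then show "t \<in> S" using u by (simp add: S_def mult.assoc)
    qed (rule S1, simp)
    then have conn: "connected S" by (rule starlike_imp_connected)
    have op: "open S" unfolding S_def by (rule opn[OF w])
    have "\<tau> (\<lambda>i. 1 * w i) i = 1 * matvec a d w i"
    proof (rule analytic_continuation_open[where s="ball 0 r" and s'=S and f="\<lambda>t. \<tau> (\<lambda>i. t * w i) i" and g="\<lambda>t. t * matvec a d w i"])
      show "ball 0 r \<subseteq> S" using S1 by (auto simp: r_def)
      show "(\<lambda>t. \<tau> (\<lambda>i. t * w i) i) holomorphic_on S"
        by (rule curve_holo_holomorphic_on[OF \<tau> op]) (auto simp: S_def intro!: holomorphic_intros)
      fix t :: complex assume t: "t \<in> ball 0 r"
      have "cmod t * l1norm a w \<le> r * l1norm a w" using t l0 by (intro mult_right_mono) auto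
      also have "\<dots> \<le> 1 / (2 * (l1norm a w + 1)) * l1norm a w" using l0 by (intro mult_right_mono) (auto simp: r_def)
      also have "\<dots> < 1/2" using l0 by (simp add: field_simps)
      finally have "\<tau> (\<lambda>i. t * w i) = matvec a d (\<lambda>i. t * w i)"
        by (intro small cvec_smult wc) (simp add: l1norm_smult)
      then show "\<tau> (\<lambda>i. t * w i) i = t * matvec a d w i" by (simp add: matvec_smult)
    qed (use op conn r0 S1 in \<open>auto intro!: holomorphic_intros\<close>)
    then show "\<tau> w i = matvec a d w i" by simp
  qed
  from that[OF this Lc LL] show thesis .
qed

section \<open>The Lie ball as a bounded balanced domain\<close>

lemma DIV_subset_cvec: "DIV m \<subseteq> cvec m"
  by (auto simp: DIV_def)

lemma cmod_sum_squares_le: "cmod (\<Sum>i<m. (w i)\<^sup>2) \<le> (\<Sum>i<m. (cmod (w i))\<^sup>2)"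
  using norm_sum[of "\<lambda>i. (w i)\<^sup>2" "{..<m}"] by (simp add: norm_power)

lemma small_in_DIV: "w \<in> cvec m \<Longrightarrow> l1norm m w < 1 \<Longrightarrow> w \<in> DIV m"
proof -
  assume w: "w \<in> cvec m" "l1norm m w < 1"
  have "(cnorm m w)\<^sup>2 \<le> (l1norm m w)\<^sup>2"
    using cnorm_le_sum[of m w] cnorm_nonneg[of m w] by (intro power_mono) (auto simp: l1norm_def)
  also have "\<dots> < 1" using w(2) l1norm_nonneg[of m w] by (simp add: power_less_one_iff)
  finally have "(\<Sum>i<m. (cmod (w i))\<^sup>2) < 1" by (simp add: cnorm_def sum_nonneg)
  moreover have "0 \<le> (cmod (\<Sum>i<m. (w i)\<^sup>2))\<^sup>2 / 4" by simp
  ultimately have "(\<Sum>i<m. (cmod (w i))\<^sup>2) < 2 \<and> 0 < 1 - (\<Sum>i<m. (cmod (w i))\<^sup>2) + (cmod (\<Sum>i<m. (w i)\<^sup>2))\<^sup>2 / 4"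
    by linarith
  then show ?thesis using w(1) by (simp add: DIV_def)
qed

lemma DIV_bounded: "w \<in> DIV m \<Longrightarrow> cmod (w i) \<le> 2"
proof (cases "i < m")
  case True
  assume w: "w \<in> DIV m"
  have "(cmod (w i))\<^sup>2 \<le> (\<Sum>i<m. (cmod (w i))\<^sup>2)"
    using True by (intro member_le_sum) auto
  also have "\<dots> < 2\<^sup>2" using w by (simp add: DIV_def)
  finally show ?thesis using power2_less_imp_less[of "cmod (w i)" 2] by simp
qed (auto simp: DIV_def cvec_def)

text \<open>With \<open>t = (cmod c)\<^sup>2\<close>, scaling by \<open>c\<close> raises the
  defining function by \<open>(1 - t) * (p - (1 + t) * q\<^sup>2 / 4)\<close>. This is nonnegative
  because \<open>q \<le> p < 2\<close> gives \<open>q\<^sup>2 \<le> 2 * p\<close>.\<close>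

lemma DIV_balanced:
  assumes w: "w \<in> DIV m" and c: "cmod c \<le> 1"
  shows "(\<lambda>i. c * w i) \<in> DIV m"
proof -
  define p where "p = (\<Sum>i<m. (cmod (w i))\<^sup>2)"
  define q where "q = cmod (\<Sum>i<m. (w i)\<^sup>2)"
  define t where "t = (cmod c)\<^sup>2"
  have p: "0 \<le> p" "p < 2" "0 < 1 - p + q\<^sup>2 / 4" "0 \<le> q" "q \<le> p"
    using w cmod_sum_squares_le[where m=m and w=w] by (auto simp: DIV_def p_def q_def sum_nonneg)
  have t: "0 \<le> t" "t \<le> 1" using c by (auto simp: t_def power_le_one)
  have s1: "(\<Sum>i<m. (cmod (c * w i))\<^sup>2) = t * p"
    by (simp add: norm_mult power_mult_distrib p_def t_def sum_distrib_left)
  have "(\<Sum>i<m. (c * w i)\<^sup>2) = c\<^sup>2 * (\<Sum>i<m. (w i)\<^sup>2)"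
    by (simp add: power_mult_distrib sum_distrib_left)
  then have s2: "cmod (\<Sum>i<m. (c * w i)\<^sup>2) = t * q" by (simp add: norm_mult norm_power q_def t_def)
  have "q\<^sup>2 \<le> p\<^sup>2" using p by (intro power_mono) auto
  also have "\<dots> \<le> 2 * p" using p by (simp add: power2_eq_square mult_right_mono)
  finally have qp: "q\<^sup>2 \<le> 2 * p" .
  have "(1 + t) * q\<^sup>2 \<le> 2 * q\<^sup>2" using t by (intro mult_right_mono) auto
  then have "0 \<le> (1 - t) * (p - (1 + t) * q\<^sup>2 / 4)" using t qp by (intro mult_nonneg_nonneg) auto
  also have "\<dots> = (1 - t * p + (t * q)\<^sup>2 / 4) - (1 - p + q\<^sup>2 / 4)"
    by (simp add: power2_eq_square field_simps)
  finally have "0 < 1 - t * p + (t * q)\<^sup>2 / 4" using p by linarith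
  moreover have "t * p \<le> 1 * p" using t p by (intro mult_right_mono) auto
  then have "t * p < 2" using p by linarith
  ultimately show ?thesis
    using w by (simp add: DIV_def s1 s2 cvec_smult)
qed

lemma DIV_open_slice:
  assumes "w \<in> DIV m" shows "open {t. (\<lambda>i. t * w i) \<in> DIV m}"
proof -
  have "{t. (\<lambda>i. t * w i) \<in> DIV m} =
    {t. (\<Sum>i<m. (cmod (t * w i))\<^sup>2) < 2 \<and>
        0 < 1 - (\<Sum>i<m. (cmod (t * w i))\<^sup>2) + (cmod (\<Sum>i<m. (t * w i)\<^sup>2))\<^sup>2 / 4}"
    using assms by (auto simp: DIV_def cvec_smult)
  also have "open \<dots>"
    by (intro open_Collect_conj open_Collect_less continuous_intros) simp
  finally show ?thesis .
qed

section \<open>Linear automorphisms of the Lie ball fixing a vertex\<close>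

definition unit_vec :: "nat \<Rightarrow> nat \<Rightarrow> complex" where
  "unit_vec l = (\<lambda>i. if i = l then 1 else 0)"

text \<open>The point \<open>\<surd>2 e\<close>, with \<open>e\<close> the last unit vector, lies on the Shilov boundary; this
  describes the tangent cone of the domain there.\<close>

lemma vertex_in_DIV_iff:
  fixes \<epsilon> :: real
  assumes w: "w \<in> cvec (Suc l)" and \<epsilon>: "0 < \<epsilon>"
  defines "q \<equiv> (\<Sum>i<Suc l. (w i)\<^sup>2)"
  shows "(\<lambda>i. complex_of_real (sqrt 2) * (unit_vec l i + complex_of_real \<epsilon> * w i)) \<in> DIV (Suc l) \<longleftrightarrow>
     2 * Re (w l) + \<epsilon> * (\<Sum>i<Suc l. (cmod (w i))\<^sup>2) < 0 \<and>
     0 < 4 * ((Re (w l))\<^sup>2 - (\<Sum>i<l. (Im (w i))\<^sup>2))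
        + \<epsilon> * (4 * Re (w l) * Re q + 4 * Im (w l) * Im q) + \<epsilon>\<^sup>2 * (cmod q)\<^sup>2"
    (is "?Z \<in> _ \<longleftrightarrow> _")
proof -
  define n where "n = (\<Sum>i<Suc l. (cmod (w i))\<^sup>2)"
  define \<nu> where "\<nu> = (\<Sum>i<l. (Im (w i))\<^sup>2)"
  define u where "u = Re (w l)"
  define v where "v = Im (w l)"
  have Zc: "?Z \<in> cvec (Suc l)" using w by (simp add: cvec_def unit_vec_def)
  have low: "i < l \<Longrightarrow> unit_vec l i = 0" for i by (simp add: unit_vec_def)
  have top: "unit_vec l l = 1" by (simp add: unit_vec_def)
  have s1: "(\<Sum>i<Suc l. (cmod (?Z i))\<^sup>2) = 2 * (1 + 2 * \<epsilon> * u + \<epsilon>\<^sup>2 * n)"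
  proof -
    have "(\<Sum>i<Suc l. (cmod (?Z i))\<^sup>2) = 2 * (\<Sum>i<l. \<epsilon>\<^sup>2 * (cmod (w i))\<^sup>2) + 2 * (cmod (1 + complex_of_real \<epsilon> * w l))\<^sup>2"
      using \<epsilon> by (simp add: low norm_mult power_mult_distrib top sum_distrib_left)
    also have "(cmod (1 + complex_of_real \<epsilon> * w l))\<^sup>2 = 1 + 2 * \<epsilon> * u + \<epsilon>\<^sup>2 * (cmod (w l))\<^sup>2"
      unfolding cmod_power2 by (simp add: u_def power2_eq_square algebra_simps)
    finally show ?thesis by (simp add: n_def sum_distrib_left algebra_simps)
  qed
  have s2: "(\<Sum>i<Suc l. (?Z i)\<^sup>2) = 2 * (1 + 2 * complex_of_real \<epsilon> * w l + (complex_of_real \<epsilon>)\<^sup>2 * q)"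
  proof -
    have r2: "(complex_of_real (sqrt 2))\<^sup>2 = 2" by (simp flip: of_real_power)
    have "(\<Sum>i<Suc l. (?Z i)\<^sup>2) = 2 * (\<Sum>i<l. (complex_of_real \<epsilon>)\<^sup>2 * (w i)\<^sup>2) + 2 * (1 + complex_of_real \<epsilon> * w l)\<^sup>2"
      by (simp add: low power_mult_distrib top sum_distrib_left r2)
    then show ?thesis by (simp add: q_def sum_distrib_left algebra_simps power2_eq_square)
  qed
  \<comment> \<open>Turns \<open>4 * (u\<^sup>2 + v\<^sup>2) - 2 * (n - Re q)\<close> into
    \<open>4 * (u\<^sup>2 - \<nu>)\<close>. The imaginary part of the last coordinate drops out of
    the leading term, which leaves the cone \<open>u < 0\<close>,
    \<open>\<nu> < u\<^sup>2\<close>.\<close>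
  have nq: "n - Re q = 2 * (\<nu> + v\<^sup>2)"
  proof -
    have "n - Re q = (\<Sum>i<Suc l. (cmod (w i))\<^sup>2 - Re ((w i)\<^sup>2))"
      by (simp add: n_def q_def sum_subtractf)
    also have "\<dots> = (\<Sum>i<Suc l. 2 * (Im (w i))\<^sup>2)"
      unfolding cmod_power2 by (intro sum.cong refl) (simp add: power2_eq_square)
    finally show ?thesis by (simp add: \<nu>_def v_def sum_distrib_left)
  qed
  have "cmod (\<Sum>i<Suc l. (?Z i)\<^sup>2) = 2 * cmod (1 + 2 * complex_of_real \<epsilon> * w l + (complex_of_real \<epsilon>)\<^sup>2 * q)"
    unfolding s2 by (simp only: norm_mult) simp
  then have "(cmod (\<Sum>i<Suc l. (?Z i)\<^sup>2))\<^sup>2 / 4 = (cmod (1 + 2 * complex_of_real \<epsilon> * w l + (complex_of_real \<epsilon>)\<^sup>2 * q))\<^sup>2"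
    by (simp add: power_mult_distrib)
  also have "\<dots> = (1 + 2 * \<epsilon> * u + \<epsilon>\<^sup>2 * Re q)\<^sup>2 + (2 * \<epsilon> * v + \<epsilon>\<^sup>2 * Im q)\<^sup>2"
    unfolding cmod_power2 by (simp add: u_def v_def flip: of_real_power)
  finally have s3: "(cmod (\<Sum>i<Suc l. (?Z i)\<^sup>2))\<^sup>2 / 4 = \<dots>" .
  have "1 - 2 * (1 + 2 * \<epsilon> * u + \<epsilon>\<^sup>2 * n) + ((1 + 2 * \<epsilon> * u + \<epsilon>\<^sup>2 * Re q)\<^sup>2 + (2 * \<epsilon> * v + \<epsilon>\<^sup>2 * Im q)\<^sup>2)
     = \<epsilon>\<^sup>2 * (4 * (u\<^sup>2 + v\<^sup>2) - 2 * (n - Re q) + \<epsilon> * (4 * u * Re q + 4 * v * Im q) + \<epsilon>\<^sup>2 * ((Re q)\<^sup>2 + (Im q)\<^sup>2))"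
    by (simp add: power2_eq_square algebra_simps)
  also have "\<dots> = \<epsilon>\<^sup>2 * (4 * (u\<^sup>2 - \<nu>) + \<epsilon> * (4 * u * Re q + 4 * v * Im q) + \<epsilon>\<^sup>2 * (cmod q)\<^sup>2)"
    unfolding nq cmod_power2 by (simp add: algebra_simps)
  finally have Q: "1 - (\<Sum>i<Suc l. (cmod (?Z i))\<^sup>2) + (cmod (\<Sum>i<Suc l. (?Z i)\<^sup>2))\<^sup>2 / 4
     = \<epsilon>\<^sup>2 * (4 * (u\<^sup>2 - \<nu>) + \<epsilon> * (4 * u * Re q + 4 * v * Im q) + \<epsilon>\<^sup>2 * (cmod q)\<^sup>2)"
    unfolding s1 s3 .
  have "(\<Sum>i<Suc l. (cmod (?Z i))\<^sup>2) < 2 \<longleftrightarrow> \<epsilon> * (2 * u + \<epsilon> * n) < 0"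
  proof -
    have "2 * (1 + 2 * \<epsilon> * u + \<epsilon>\<^sup>2 * n) = 2 + 2 * (\<epsilon> * (2 * u + \<epsilon> * n))"
      by (simp add: power2_eq_square algebra_simps)
    then show ?thesis unfolding s1 by linarith
  qed
  also have "\<dots> \<longleftrightarrow> 2 * u + \<epsilon> * n < 0" using \<epsilon> by (simp add: mult_less_0_iff)
  finally have A: "(\<Sum>i<Suc l. (cmod (?Z i))\<^sup>2) < 2 \<longleftrightarrow> 2 * u + \<epsilon> * n < 0" .
  have B: "0 < 1 - (\<Sum>i<Suc l. (cmod (?Z i))\<^sup>2) + (cmod (\<Sum>i<Suc l. (?Z i)\<^sup>2))\<^sup>2 / 4 \<longleftrightarrow>
      0 < 4 * (u\<^sup>2 - \<nu>) + \<epsilon> * (4 * u * Re q + 4 * v * Im q) + \<epsilon>\<^sup>2 * (cmod q)\<^sup>2"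
    unfolding Q using \<epsilon> by (simp add: zero_less_mult_iff)
  have "?Z \<in> DIV (Suc l) \<longleftrightarrow> (\<Sum>i<Suc l. (cmod (?Z i))\<^sup>2) < 2 \<and>
     0 < 1 - (\<Sum>i<Suc l. (cmod (?Z i))\<^sup>2) + (cmod (\<Sum>i<Suc l. (?Z i)\<^sup>2))\<^sup>2 / 4"
    using Zc unfolding DIV_def by blast
  also have "\<dots> \<longleftrightarrow> 2 * u + \<epsilon> * n < 0 \<and> 0 < 4 * (u\<^sup>2 - \<nu>) + \<epsilon> * (4 * u * Re q + 4 * v * Im q) + \<epsilon>\<^sup>2 * (cmod q)\<^sup>2"
    unfolding A B ..
  finally show ?thesis by (simp add: u_def v_def n_def \<nu>_def)
qed

text \<open>The tangent cone at the vertex is \<open>g w < 0\<close> for the \<open>g\<close> below.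
  Preserving it and fixing the last unit vector, \<open>L\<close> cannot increase \<open>g\<close>;
  being an involution, it preserves \<open>g\<close>. Comparing \<open>w\<close> with
  \<open>-w\<close> separates the two summands of \<open>g\<close>, so \<open>L\<close> preserves
  both \<open>Re (w l)\<close> and \<open>\<nu> w\<close>. A real vector has
  \<open>\<nu> w = 0\<close>, and so has its image.\<close>

lemma DIV_linear_involution_real:
  assumes LD: "\<And>w. w \<in> DIV (Suc l) \<Longrightarrow> matvec (Suc l) d w \<in> DIV (Suc l)"
    and Lc: "\<And>v. v \<in> cvec (Suc l) \<Longrightarrow> matvec (Suc l) d v \<in> cvec (Suc l)"
    and LL: "\<And>v. v \<in> cvec (Suc l) \<Longrightarrow> matvec (Suc l) d (matvec (Suc l) d v) = v"
    and fix_last: "matvec (Suc l) d (unit_vec l) = unit_vec l"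
    and ij: "i < Suc l" "j < Suc l"
  shows "Im (d i j) = 0"
proof -
  define L where "L = matvec (Suc l) d"
  define \<nu> where "\<nu> w = (\<Sum>i<l. (Im (w i))\<^sup>2)" for w :: "nat \<Rightarrow> complex"
  define g where "g w = Re (w l) + sqrt (\<nu> w)" for w
  have \<nu>0: "0 \<le> \<nu> w" for w by (simp add: \<nu>_def sum_nonneg)
  have ec: "unit_vec p \<in> cvec (Suc l)" if "p < Suc l" for p using that by (auto simp: cvec_def unit_vec_def)
  \<comment> \<open>On the image side only the closed cone is reached, since strict inequalities
    weaken in the limit of small \<open>\<epsilon>\<close>.\<close>
  have cone: "Re (L w l) \<le> 0 \<and> \<nu> (L w) \<le> (Re (L w l))\<^sup>2"
    if w: "w \<in> cvec (Suc l)" and w1: "Re (w l) < 0" and w2: "\<nu> w < (Re (w l))\<^sup>2" for w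
  proof -
    define Z where "Z w \<epsilon> = (\<lambda>i. complex_of_real (sqrt 2) * (unit_vec l i + complex_of_real \<epsilon> * w i))" for w \<epsilon>
    define n where "n w = (\<Sum>i<Suc l. (cmod (w i))\<^sup>2)" for w :: "nat \<Rightarrow> complex"
    define q where "q w = (\<Sum>i<Suc l. (w i)\<^sup>2)" for w :: "nat \<Rightarrow> complex"
    define h where "h w \<epsilon> = 4 * ((Re (w l))\<^sup>2 - \<nu> w)
        + \<epsilon> * (4 * Re (w l) * Re (q w) + 4 * Im (w l) * Im (q w)) + \<epsilon>\<^sup>2 * (cmod (q w))\<^sup>2" for w \<epsilon>
    have iff: "Z w \<epsilon> \<in> DIV (Suc l) \<longleftrightarrow> 2 * Re (w l) + \<epsilon> * n w < 0 \<and> 0 < h w \<epsilon>"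
      if "w \<in> cvec (Suc l)" "0 < \<epsilon>" for w \<epsilon>
      using vertex_in_DIV_iff[OF that] by (simp only: Z_def n_def q_def h_def \<nu>_def)
    have LZ: "L (Z w \<epsilon>) = Z (L w) \<epsilon>" for \<epsilon>
      using fix_last by (simp add: Z_def L_def matvec_smult matvec_add)
    have lim1: "((\<lambda>\<epsilon>. 2 * Re (w l) + \<epsilon> * n w) \<longlongrightarrow> 2 * Re (w l) + 0 * n w) (at_right 0)" for w
      by (intro tendsto_intros)
    have lim2: "(h w \<longlongrightarrow> 4 * ((Re (w l))\<^sup>2 - \<nu> w)
        + 0 * (4 * Re (w l) * Re (q w) + 4 * Im (w l) * Im (q w)) + 0\<^sup>2 * (cmod (q w))\<^sup>2) (at_right 0)" for w
      unfolding h_def by (intro tendsto_intros)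
    have "\<forall>\<^sub>F \<epsilon> in at_right 0. 2 * Re (w l) + \<epsilon> * n w < 0"
      by (rule order_tendstoD(2)[OF lim1]) (use w1 in simp)
    moreover have "\<forall>\<^sub>F \<epsilon> in at_right 0. 0 < h w \<epsilon>"
      by (rule order_tendstoD(1)[OF lim2]) (use w2 in simp)
    moreover have "\<forall>\<^sub>F \<epsilon> in at_right 0. 0 < (\<epsilon>::real)"
      by (rule eventually_at_right_less)
    ultimately have ev: "\<forall>\<^sub>F \<epsilon> in at_right 0. 2 * Re (L w l) + \<epsilon> * n (L w) < 0 \<and> 0 < h (L w) \<epsilon>"
    proof eventually_elim
      case (elim \<epsilon>)
      then have "Z w \<epsilon> \<in> DIV (Suc l)" using iff[OF w] by simp
      then have "Z (L w) \<epsilon> \<in> DIV (Suc l)" using LD[of "Z w \<epsilon>"] LZ by (simp add: L_def)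
      then show ?case using iff[of "L w" \<epsilon>] Lc[OF w] elim by (simp add: L_def)
    qed
    have "2 * Re (L w l) + 0 * n (L w) \<le> 0"
      by (rule tendsto_upperbound[OF lim1]) (use ev in \<open>auto elim: eventually_mono\<close>)
    moreover have "0 \<le> 4 * ((Re (L w l))\<^sup>2 - \<nu> (L w))
        + 0 * (4 * Re (L w l) * Re (q (L w)) + 4 * Im (L w l) * Im (q (L w))) + 0\<^sup>2 * (cmod (q (L w)))\<^sup>2"
      by (rule tendsto_lowerbound[OF lim2]) (use ev in \<open>auto elim: eventually_mono\<close>)
    ultimately show ?thesis by simp
  qed
  have g_le: "g (L w) \<le> g w" if w: "w \<in> cvec (Suc l)" for w
  proof (rule dense_ge)
    fix s assume s: "g w < s"
    \<comment> \<open>\<open>g w\<close> is the infimum of the \<open>s\<close> for which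
      \<open>w - s * unit_vec l\<close> lies in the cone, and \<open>L\<close> commutes with this
      shift.\<close>
    define w' where "w' = (\<lambda>i. w i + complex_of_real (-s) * unit_vec l i)"
    have w'c: "w' \<in> cvec (Suc l)" unfolding w'_def using w ec[of l] by (intro cvec_add cvec_smult) auto
    have \<nu>': "\<nu> w' = \<nu> w" unfolding \<nu>_def w'_def by (intro sum.cong refl) (simp add: unit_vec_def)
    have re: "Re (w' l) = Re (w l) - s" by (simp add: w'_def unit_vec_def)
    have lt: "sqrt (\<nu> w) < s - Re (w l)" using s by (simp add: g_def)
    have sq: "0 \<le> sqrt (\<nu> w)" using \<nu>0 by simp
    have "(sqrt (\<nu> w))\<^sup>2 < (s - Re (w l))\<^sup>2" using lt sq by (intro power_strict_mono) auto
    then have "\<nu> w' < (Re (w' l))\<^sup>2" using \<nu>0[of w] by (simp add: \<nu>' re power2_commute)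
    moreover have "Re (w' l) < 0" using lt sq re by linarith
    ultimately have c: "Re (L w' l) \<le> 0" "\<nu> (L w') \<le> (Re (L w' l))\<^sup>2" using cone[OF w'c] by auto
    have Lw': "L w' = (\<lambda>i. L w i + complex_of_real (-s) * unit_vec l i)"
      unfolding w'_def L_def by (simp only: matvec_add matvec_smult fix_last)
    have \<nu>L: "\<nu> (L w') = \<nu> (L w)" unfolding \<nu>_def Lw' by (intro sum.cong refl) (simp add: unit_vec_def)
    have reL: "Re (L w' l) = Re (L w l) - s" by (simp add: Lw' unit_vec_def)
    have "sqrt (\<nu> (L w)) \<le> s - Re (L w l)"
      using c by (intro real_le_lsqrt) (auto simp: \<nu>L reL power2_commute)
    then show "g (L w) \<le> s" by (simp add: g_def)
  qed
  have g_eq: "g (L w) = g w" if w: "w \<in> cvec (Suc l)" for w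
    using g_le[OF w] g_le[OF Lc[OF w]] LL[OF w] by (simp add: L_def)
  have Lneg: "L (\<lambda>i. - w i) = (\<lambda>i. - L w i)" for w
    using matvec_smult[of "Suc l" d "-1" w] by (simp add: L_def)
  have neg: "g (\<lambda>i. - w i) = - Re (w l) + sqrt (\<nu> w)" for w by (simp add: g_def \<nu>_def)
  have pres: "Re (L w l) = Re (w l) \<and> \<nu> (L w) = \<nu> w" if w: "w \<in> cvec (Suc l)" for w
  proof -
    have "(\<lambda>i. - w i) \<in> cvec (Suc l)" using cvec_smult[OF w, of "-1"] by simp
    from g_eq[OF this] have 1: "- Re (L w l) + sqrt (\<nu> (L w)) = - Re (w l) + sqrt (\<nu> w)"
      by (simp add: Lneg neg)
    have 2: "Re (L w l) + sqrt (\<nu> (L w)) = Re (w l) + sqrt (\<nu> w)" using g_eq[OF w] by (simp add: g_def)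
    from 1 2 have "sqrt (\<nu> (L w)) = sqrt (\<nu> w)" "Re (L w l) = Re (w l)" by linarith+
    then show ?thesis by simp
  qed
  have col: "L (unit_vec j) i = d i j" for i
    using ij by (simp add: L_def matvec_def unit_vec_def if_distrib cong: if_cong)
  show ?thesis
  proof (cases "i < l")
    case True
    have "\<nu> (L (unit_vec j)) = \<nu> (unit_vec j)" using pres[OF ec[OF ij(2)]] by simp
    also have "\<dots> = 0" by (simp add: \<nu>_def unit_vec_def if_distrib cong: if_cong)
    finally have "\<forall>i<l. Im (L (unit_vec j) i) = 0" by (simp add: \<nu>_def sum_nonneg_eq_0_iff)
    then show ?thesis using True col by simp
  next
    case False
    then have i: "i = l" using ij by simp
    \<comment> \<open>\<open>\<nu>\<close> omits the last coordinate. Its row is tested on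
      \<open>\<i> * unit_vec j\<close>, since
      \<open>Re (\<i> * d l j) = - Im (d l j)\<close>.\<close>
    have "Re (L (\<lambda>i. \<i> * unit_vec j i) l) = Re (\<i> * unit_vec j l)"
      using pres[OF cvec_smult[OF ec[OF ij(2)]]] by blast
    moreover have "L (\<lambda>i. \<i> * unit_vec j i) l = \<i> * d l j"
      by (simp only: L_def matvec_smult) (simp only: L_def[symmetric] col)
    ultimately show ?thesis by (simp add: i unit_vec_def split: if_splits)
  qed
qed

section \<open>Ball automorphisms and minimum monomial maps\<close>

lemma eventually_add_in_open:
  fixes z :: "nat \<Rightarrow> complex"
  assumes "open U" "z \<in> U"
  shows "\<forall>\<^sub>F h in at (\<lambda>i. 0) within S. (\<lambda>i. z i + h i) \<in> U"
proof -
  have "((\<lambda>h i. z i + h i) \<longlongrightarrow> z) (at (\<lambda>i. 0) within S)"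
    unfolding tendsto_componentwise
  proof
    fix i
    have "((\<lambda>h::nat \<Rightarrow> complex. h i) \<longlongrightarrow> 0) (at (\<lambda>i. 0) within S)"
      using tendsto_componentwise[of "\<lambda>h. h" "\<lambda>i. 0" "at (\<lambda>i. 0) within S"]
      by simp
    then have "((\<lambda>h::nat \<Rightarrow> complex. z i + h i) \<longlongrightarrow> z i + 0) (at (\<lambda>i. 0) within S)"
      by (intro tendsto_intros)
    then show "((\<lambda>h. z i + h i) \<longlongrightarrow> z i) (at (\<lambda>i. 0) within S)" by simp
  qed
  then show ?thesis using assms by (rule topological_tendstoD)
qed

text \<open>The difference quotients also see points outside the domain, so agreement on it is
  transferred through relative openness. The application is \<open>inv_into\<close>, which agrees
  with an explicit inverse on the ball.\<close>

lemma holo_comp_cong: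
  assumes g: "holo_comp a (U \<inter> cvec a) g" and U: "open U"
    and eq: "\<And>z. z \<in> U \<inter> cvec a \<Longrightarrow> f z = g z"
  shows "holo_comp a (U \<inter> cvec a) f"
  unfolding holo_comp_iff
proof
  fix z assume z: "z \<in> U \<inter> cvec a"
  then obtain d where d: "has_cgrad a z g d" using bspec[OF g[unfolded holo_comp_iff]] by auto
  have ev: "\<forall>\<^sub>F h in at (\<lambda>i. 0) within cvec a. f (\<lambda>i. z i + h i) = g (\<lambda>i. z i + h i)"
  proof -
    have "\<forall>\<^sub>F h in at (\<lambda>i. 0) within cvec a. h \<in> cvec a" by (simp add: eventually_at_filter)
    moreover have "\<forall>\<^sub>F h in at (\<lambda>i. 0) within cvec a. (\<lambda>i. z i + h i) \<in> U"
      using z by (intro eventually_add_in_open U) auto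
    ultimately show ?thesis
      by eventually_elim (use z in \<open>auto intro!: eq cvec_add\<close>)
  qed
  have "has_cgrad a z f d"
    unfolding has_cgrad_def
  proof (intro allI impI)
    fix \<epsilon> :: real assume "0 < \<epsilon>"
    with d have "\<forall>\<^sub>F h in at (\<lambda>i. 0) within cvec a.
      cmod (g (\<lambda>i. z i + h i) - g z - (\<Sum>i<a. d i * h i)) \<le> \<epsilon> * cnorm a h"
      by (simp add: has_cgrad_def)
    with ev show "\<forall>\<^sub>F h in at (\<lambda>i. 0) within cvec a.
      cmod (f (\<lambda>i. z i + h i) - f z - (\<Sum>i<a. d i * h i)) \<le> \<epsilon> * cnorm a h"
      by eventually_elim (simp add: eq[OF z])
  qed
  then show "\<exists>d. has_cgrad a z f d" by (rule exI[of _ d])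
qed

lemma cball_unit_open:
  obtains U where "open U" "cball_unit a = U \<inter> cvec a"
proof
  show "open {z::nat \<Rightarrow> complex. (\<Sum>i<a. (cmod (z i))\<^sup>2) < 1}"
    by (intro open_Collect_less continuous_intros continuous_on_product_coordinates)
qed (auto simp: cball_unit_def)

lemma cball_unit_subset_cvec: "cball_unit a \<subseteq> cvec a"
  by (auto simp: cball_unit_def)

lemma AutI:
  assumes \<phi>: "holo_map a a (cball_unit a) \<phi>" and \<rho>: "holo_map a a (cball_unit a) \<rho>"
    and "\<And>w. w \<in> cball_unit a \<Longrightarrow> \<phi> w \<in> cball_unit a" "\<And>w. w \<in> cball_unit a \<Longrightarrow> \<rho> w \<in> cball_unit a"
    and "\<And>w. w \<in> cball_unit a \<Longrightarrow> \<rho> (\<phi> w) = w" "\<And>w. w \<in> cball_unit a \<Longrightarrow> \<phi> (\<rho> w) = w"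
  shows "\<phi> \<in> Aut a (cball_unit a)"
proof -
  obtain U where U: "open U" "cball_unit a = U \<inter> cvec a" by (rule cball_unit_open)
  have bij: "bij_betw \<phi> (cball_unit a) (cball_unit a)"
    using assms(3-6) by (intro bij_betw_byWitness[where f'=\<rho>]) auto
  have inv: "inv_into (cball_unit a) \<phi> w = \<rho> w" if "w \<in> cball_unit a" for w
    using bij that assms(4,6) by (intro inv_into_f_eq) (auto simp: bij_betw_def)
  have "holo_comp a (cball_unit a) (\<lambda>z. inv_into (cball_unit a) \<phi> z j)" if "j < a" for j
  proof -
    have "holo_comp a (U \<inter> cvec a) (\<lambda>z. \<rho> z j)" using \<rho> that by (simp add: holo_map_def U(2))
    then have "holo_comp a (U \<inter> cvec a) (\<lambda>z. inv_into (cball_unit a) \<phi> z j)"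
      by (rule holo_comp_cong[OF _ U(1)]) (use inv U(2) in simp)
    then show ?thesis by (simp add: U(2))
  qed
  then have "holo_map a a (cball_unit a) (inv_into (cball_unit a) \<phi>)"
    using \<rho> inv by (simp add: holo_map_def)
  then show ?thesis using \<phi> bij by (simp add: Aut_def)
qed

lemma holo_map_id: "D \<subseteq> cvec a \<Longrightarrow> holo_map a a D (\<lambda>w. w)"
  by (auto simp: holo_map_def intro: holo_comp_coord)

text \<open>The form in which minimality is used: \<open>\<psi>\<close> is the identity and
  \<open>G\<close> is \<open>H\<close>, which already takes values in
  \<open>cvec (N - 1)\<close>.\<close>

lemma minimum_ball_map_no_zero_last:
  assumes min: "minimum_ball_map n N F"
    and \<phi>: "\<phi> \<in> Aut N (cball_unit N)" and H: "holo_map n N (cball_unit n) H"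
    and Hm: "\<And>z. z \<in> cball_unit n \<Longrightarrow> H z \<in> cball_unit N"
    and zero: "\<And>z. z \<in> cball_unit n \<Longrightarrow> H z (N - 1) = 0" and N: "1 \<le> N"
    and eq: "\<And>z. z \<in> cball_unit n \<Longrightarrow> F z = \<phi> (H z)"
  shows False
proof -
  have id: "(\<lambda>w. w) \<in> Aut n (cball_unit n)"
    by (rule AutI[where \<rho>="\<lambda>w. w"]) (auto simp: holo_map_id cball_unit_subset_cvec)
  have NS: "N = Suc (N - 1)" using N by simp
  have Hc: "H z \<in> cvec (N - 1)" if "z \<in> cball_unit n" for z
    unfolding cvec_def
  proof (intro CollectI allI impI)
    fix i assume "N - 1 \<le> i"
    then consider "i = N - 1" | "N \<le> i" by linarith
    then show "H z i = 0"
      using zero[OF that] Hm[OF that] by cases (auto simp: cball_unit_def cvec_def)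
  qed
  have "holo_map n (N - 1) (cball_unit n) H"
    using H Hc by (auto simp: holo_map_def)
  moreover have "maps_into H (cball_unit n) (cball_unit (N - 1))"
    unfolding maps_into_def
  proof
    fix z assume z: "z \<in> cball_unit n"
    have "(\<Sum>i<Suc (N - 1). (cmod (H z i))\<^sup>2) < 1" using Hm[OF z] NS by (simp add: cball_unit_def)
    then show "H z \<in> cball_unit (N - 1)" using Hc[OF z] zero[OF z] by (simp add: cball_unit_def)
  qed
  ultimately have "\<exists>\<psi>\<in>Aut n (cball_unit n). \<exists>\<phi>\<in>Aut N (cball_unit N). \<exists>G.
          holo_map n (N - 1) (cball_unit n) G \<and> maps_into G (cball_unit n) (cball_unit (N - 1)) \<and>
          (\<forall>z\<in>cball_unit n. F z = \<phi> (G (\<psi> z)))"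
    using eq by (intro bexI[OF _ id] bexI[OF _ \<phi>] exI[of _ H]) auto
  then show False using min by (simp add: minimum_ball_map_def)
qed

text \<open>The ball automorphism along the \<open>l\<close>-th axis that takes the origin to the
  point with \<open>l\<close>-th coordinate \<open>c\<close>; its inverse belongs to
  \<open>-c\<close>. Real \<open>c\<close> matches the real coefficients of the monomials.\<close>

definition moebius :: "nat \<Rightarrow> real \<Rightarrow> (nat \<Rightarrow> complex) \<Rightarrow> nat \<Rightarrow> complex" where
  "moebius l c w = (\<lambda>p. if p = l then (w l + of_real c) / (1 + of_real c * w l)
      else of_real (sqrt (1 - c\<^sup>2)) * w p / (1 + of_real c * w l))"

lemma cball_unit_coord: "w \<in> cball_unit a \<Longrightarrow> cmod (w i) < 1"
proof (cases "i < a")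
  case True
  assume w: "w \<in> cball_unit a"
  have "(cmod (w i))\<^sup>2 \<le> (\<Sum>i<a. (cmod (w i))\<^sup>2)" using True by (intro member_le_sum) auto
  also have "\<dots> < 1" using w by (simp add: cball_unit_def)
  finally show ?thesis by (simp add: power_less_one_iff)
qed (auto simp: cball_unit_def cvec_def)

lemma moebius_denom:
  assumes "w \<in> cball_unit a" "\<bar>c\<bar> < 1" shows "1 + complex_of_real c * w l \<noteq> 0"
proof
  assume "1 + complex_of_real c * w l = 0"
  then have "complex_of_real c * w l = -1" by (simp add: eq_neg_iff_add_eq_0 add.commute)
  then have "cmod (complex_of_real c * w l) = cmod (-1)" by (rule arg_cong)
  then have "\<bar>c\<bar> * cmod (w l) = 1" by (simp add: norm_mult)
  moreover have "\<bar>c\<bar> * cmod (w l) \<le> \<bar>c\<bar> * 1"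
    using cball_unit_coord[OF assms(1), of l] by (intro mult_left_mono) auto
  ultimately show False using assms(2) by linarith
qed

text \<open>Rests on the one-variable identity \<open>(cmod D)\<^sup>2 - (cmod (w l + c))\<^sup>2 =
  (1 - c\<^sup>2) * (1 - (cmod (w l))\<^sup>2)\<close>; the weight
  \<open>sqrt (1 - c\<^sup>2)\<close> on the other coordinates produces the same factor.\<close>

lemma moebius_in_ball:
  assumes w: "w \<in> cball_unit (Suc l)" and c: "\<bar>c\<bar> < 1"
  shows "moebius l c w \<in> cball_unit (Suc l)"
proof -
  define D where "D = 1 + complex_of_real c * w l"
  have D0: "0 < (cmod D)\<^sup>2" using moebius_denom[OF w c] by (simp add: D_def)
  have c2: "0 < 1 - c\<^sup>2" using c by (simp add: abs_square_less_1)
  have "(\<Sum>p<Suc l. (cmod (moebius l c w p))\<^sup>2)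
      = (\<Sum>p<l. (1 - c\<^sup>2) * (cmod (w p))\<^sup>2 / (cmod D)\<^sup>2) + (cmod (w l + of_real c))\<^sup>2 / (cmod D)\<^sup>2"
    using c2 by (simp add: moebius_def D_def norm_divide norm_mult power_divide power_mult_distrib)
  also have "\<dots> = ((1 - c\<^sup>2) * (\<Sum>p<l. (cmod (w p))\<^sup>2) + (cmod (w l + of_real c))\<^sup>2) / (cmod D)\<^sup>2"
    by (simp add: sum_divide_distrib sum_distrib_left add_divide_distrib)
  also have "\<dots> < 1"
  proof -
    have "(cmod D)\<^sup>2 - (cmod (w l + of_real c))\<^sup>2 = (1 - c\<^sup>2) * (1 - (cmod (w l))\<^sup>2)"
      unfolding cmod_power2 D_def by (simp add: power2_eq_square algebra_simps)
    moreover have "(1 - c\<^sup>2) * (\<Sum>p<l. (cmod (w p))\<^sup>2) < (1 - c\<^sup>2) * (1 - (cmod (w l))\<^sup>2)"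
      using w c2 by (intro mult_strict_left_mono) (auto simp: cball_unit_def)
    ultimately show ?thesis using D0 by (simp add: divide_less_eq)
  qed
  finally show ?thesis using w by (auto simp: cball_unit_def cvec_def moebius_def)
qed

lemma moebius_inverse:
  assumes w: "w \<in> cball_unit (Suc l)" and c: "\<bar>c\<bar> < 1"
  shows "moebius l (-c) (moebius l c w) = w"
proof
  fix p
  define C where "C = complex_of_real c"
  define D where "D = 1 + C * w l"
  have D0: "D \<noteq> 0" using moebius_denom[OF w c] by (simp add: D_def C_def)
  have c2: "0 < 1 - c\<^sup>2" using c by (simp add: abs_square_less_1)
  have C2: "1 - C\<^sup>2 \<noteq> 0"
  proof -
    have "1 - C\<^sup>2 = complex_of_real (1 - c\<^sup>2)" by (simp add: C_def)
    then show ?thesis using c2 by (metis less_irrefl of_real_eq_0_iff)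
  qed
  have ml: "moebius l c w l = (w l + C) / D" by (simp add: moebius_def C_def D_def)
  have den: "1 - C * ((w l + C) / D) = (1 - C\<^sup>2) / D"
    using D0 by (simp add: field_simps power2_eq_square) (simp add: D_def algebra_simps)
  have num: "(w l + C) / D - C = (1 - C\<^sup>2) * w l / D"
    using D0 by (simp add: field_simps power2_eq_square) (simp add: D_def algebra_simps)
  have s2: "complex_of_real (sqrt (1 - c\<^sup>2)) * complex_of_real (sqrt (1 - c\<^sup>2)) = 1 - C\<^sup>2"
    using c2 by (simp add: C_def flip: of_real_mult)
  show "moebius l (-c) (moebius l c w) p = w p"
  proof (cases "p = l")
    case True
    have "moebius l (-c) (moebius l c w) l = ((w l + C) / D - C) / (1 - C * ((w l + C) / D))"
      by (simp add: moebius_def[of l "-c"] ml) (simp add: C_def)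
    also have "\<dots> = w l" unfolding den num using D0 C2 by simp
    finally show ?thesis using True by simp
  next
    case False
    have "moebius l (-c) (moebius l c w) p
       = of_real (sqrt (1 - c\<^sup>2)) * (of_real (sqrt (1 - c\<^sup>2)) * w p / D) / (1 - C * ((w l + C) / D))"
      using False by (simp add: moebius_def[of l "-c"] ml) (simp add: moebius_def C_def D_def)
    also have "\<dots> = (of_real (sqrt (1 - c\<^sup>2)) * of_real (sqrt (1 - c\<^sup>2))) * w p / D / ((1 - C\<^sup>2) / D)"
      unfolding den by (simp add: mult.assoc)
    also have "\<dots> = w p" unfolding s2 using D0 C2 by simp
    finally show ?thesis .
  qed
qed

lemma holo_map_moebius:
  assumes G: "holo_map a (Suc l) D G" and GB: "\<And>z. z \<in> D \<Longrightarrow> G z \<in> cball_unit (Suc l)" and c: "\<bar>c\<bar> < 1"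
  shows "holo_map a (Suc l) D (\<lambda>z. moebius l c (G z))"
  unfolding holo_map_def
proof (intro conjI allI impI ballI)
  show "moebius l c (G z) \<in> cvec (Suc l)" if "z \<in> D" for z
    using moebius_in_ball[OF GB[OF that] c] cball_unit_subset_cvec by blast
  fix j assume j: "j < Suc l"
  have h: "holo_comp a D (\<lambda>z. G z i)" if "i < Suc l" for i using G that by (simp add: holo_map_def)
  have d: "1 + complex_of_real c * G z l \<noteq> 0" if "z \<in> D" for z by (rule moebius_denom[OF GB[OF that] c])
  have "holo_comp a D (\<lambda>z. (G z l + of_real c) / (1 + of_real c * G z l))"
    by (intro holo_comp_intros h d) auto
  moreover have "holo_comp a D (\<lambda>z. of_real (sqrt (1 - c\<^sup>2)) * G z j / (1 + of_real c * G z l))"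
    by (intro holo_comp_intros h d j) auto
  ultimately show "holo_comp a D (\<lambda>z. moebius l c (G z) j)"
    by (cases "j = l") (simp_all add: moebius_def)
qed

definition coord_swap :: "nat \<Rightarrow> nat \<Rightarrow> (nat \<Rightarrow> complex) \<Rightarrow> nat \<Rightarrow> complex" where
  "coord_swap i l w = (\<lambda>p. w (if p = i then l else if p = l then i else p))"

lemma coord_swap_coord_swap: "coord_swap i l (coord_swap i l w) = w"
  by (auto simp: coord_swap_def)

lemma coord_swap_in_ball:
  assumes w: "w \<in> cball_unit a" and "i < a" "l < a"
  shows "coord_swap i l w \<in> cball_unit a"
proof -
  have "(\<Sum>p<a. (cmod (coord_swap i l w p))\<^sup>2) = (\<Sum>p<a. (cmod (w p))\<^sup>2)"
    unfolding coord_swap_def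
    by (rule sum.reindex_bij_witness[where i="\<lambda>p. if p = i then l else if p = l then i else p"
          and j="\<lambda>p. if p = i then l else if p = l then i else p"]) (use assms in auto)
  then show ?thesis using assms by (auto simp: cball_unit_def cvec_def coord_swap_def)
qed

lemma holo_map_coord_swap:
  assumes G: "holo_map a b D G" and "i < b" "l < b"
  shows "holo_map a b D (\<lambda>z. coord_swap i l (G z))"
  using assms by (auto simp: holo_map_def coord_swap_def cvec_def)

text \<open>Swapping the constant coordinate into the last place and applying the Moebius map of
  \<open>-c\<close> turns it into 0.\<close>

lemma minimum_ball_map_no_constant_component:
  assumes min: "minimum_ball_map n N F" and i: "i < N"
    and F: "\<And>z. z \<in> cball_unit n \<Longrightarrow> F z i = complex_of_real c"
  shows False
proof -
  define l where "l = N - 1"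
  have N: "N = Suc l" using i by (simp add: l_def)
  have hF: "holo_map n N (cball_unit n) F" and FB: "\<And>z. z \<in> cball_unit n \<Longrightarrow> F z \<in> cball_unit N"
    using min by (auto simp: minimum_ball_map_def proper_holo_def maps_into_def)
  have "(\<lambda>i. 0) \<in> cball_unit n" by (simp add: cball_unit_def cvec_def)
  then have c: "\<bar>c\<bar> < 1" using cball_unit_coord[OF FB, of "\<lambda>i. 0" i] F[of "\<lambda>i. 0"] by simp
  then have c': "\<bar>-c\<bar> < 1" by simp
  define \<phi> where "\<phi> = (\<lambda>w. coord_swap i l (moebius l c w))"
  define \<rho> where "\<rho> = (\<lambda>w. moebius l (-c) (coord_swap i l w))"
  have sw: "coord_swap i l w \<in> cball_unit (Suc l)" if "w \<in> cball_unit (Suc l)" for w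
    using coord_swap_in_ball[OF that] i N by simp
  have hid: "holo_map (Suc l) (Suc l) (cball_unit (Suc l)) (\<lambda>w. w)" by (rule holo_map_id[OF cball_unit_subset_cvec])
  have \<rho>B: "\<rho> w \<in> cball_unit (Suc l)" if "w \<in> cball_unit (Suc l)" for w
    unfolding \<rho>_def by (intro moebius_in_ball sw that c')
  have \<phi>\<rho>: "\<phi> (\<rho> w) = w" if "w \<in> cball_unit (Suc l)" for w
    using moebius_inverse[OF sw[OF that] c'] by (simp add: \<phi>_def \<rho>_def coord_swap_coord_swap)
  have aut: "\<phi> \<in> Aut N (cball_unit N)"
    unfolding N
  proof (rule AutI[where \<rho>=\<rho>])
    show "holo_map (Suc l) (Suc l) (cball_unit (Suc l)) \<phi>"
      unfolding \<phi>_def using i N by (intro holo_map_coord_swap holo_map_moebius hid c) auto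
    show "holo_map (Suc l) (Suc l) (cball_unit (Suc l)) \<rho>"
      unfolding \<rho>_def using i N by (intro holo_map_moebius holo_map_coord_swap hid sw c') auto
    fix w assume w: "w \<in> cball_unit (Suc l)"
    show "\<phi> w \<in> cball_unit (Suc l)" unfolding \<phi>_def by (intro moebius_in_ball sw w c)
    show "\<rho> w \<in> cball_unit (Suc l)" by (rule \<rho>B[OF w])
    show "\<rho> (\<phi> w) = w" using moebius_inverse[OF w c] by (simp add: \<phi>_def \<rho>_def coord_swap_coord_swap)
    show "\<phi> (\<rho> w) = w" by (rule \<phi>\<rho>[OF w])
  qed
  show False
  proof (rule minimum_ball_map_no_zero_last[OF min aut, of "\<lambda>z. \<rho> (F z)"])
    show "holo_map n N (cball_unit n) (\<lambda>z. \<rho> (F z))"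
      unfolding \<rho>_def N using hF FB i N by (intro holo_map_moebius holo_map_coord_swap sw c') auto
    fix z assume z: "z \<in> cball_unit n"
    show "\<rho> (F z) \<in> cball_unit N" using \<rho>B FB[OF z] N by simp
    show "\<rho> (F z) (N - 1) = 0" using F[OF z] by (simp add: \<rho>_def moebius_def coord_swap_def l_def)
    show "F z = \<phi> (\<rho> (F z))" using \<phi>\<rho> FB[OF z] N by simp
  qed (use i in simp)
qed

text \<open>When \<open>\<beta>\<close> times the squared norm of \<open>u\<close> is 2, this is the
  unitary reflection in the hyperplane orthogonal to the real vector \<open>u\<close>.\<close>

definition householder :: "nat \<Rightarrow> real \<Rightarrow> (nat \<Rightarrow> real) \<Rightarrow> (nat \<Rightarrow> complex) \<Rightarrow> nat \<Rightarrow> complex" where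
  "householder a \<beta> u w =
     (\<lambda>p. if p < a then w p - of_real \<beta> * (\<Sum>q<a. of_real (u q) * w q) * of_real (u p) else 0)"

lemma householder_norm:
  assumes \<beta>: "\<beta> * (\<Sum>q<a. (u q)\<^sup>2) = 2"
  shows "(\<Sum>p<a. (cmod (householder a \<beta> u w p))\<^sup>2) = (\<Sum>p<a. (cmod (w p))\<^sup>2)"
proof -
  define s where "s = (\<Sum>q<a. of_real (u q) * w q)"
  have s: "(\<Sum>q<a. u q * Re (w q)) = Re s" "(\<Sum>q<a. u q * Im (w q)) = Im s"
    by (simp_all add: s_def)
  have "(\<Sum>p<a. (cmod (householder a \<beta> u w p))\<^sup>2)
     = (\<Sum>p<a. (cmod (w p))\<^sup>2 - 2 * \<beta> * (Re s * (u p * Re (w p)) + Im s * (u p * Im (w p)))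
         + \<beta>\<^sup>2 * ((Re s)\<^sup>2 + (Im s)\<^sup>2) * (u p)\<^sup>2)"
  proof (rule sum.cong[OF refl])
    fix p assume "p \<in> {..<a}"
    then have "householder a \<beta> u w p = w p - of_real \<beta> * s * of_real (u p)" by (simp add: householder_def s_def)
    then have "cmod (householder a \<beta> u w p) = cmod (w p - of_real \<beta> * s * of_real (u p))" by (simp only:)
    then show "(cmod (householder a \<beta> u w p))\<^sup>2
       = (cmod (w p))\<^sup>2 - 2 * \<beta> * (Re s * (u p * Re (w p)) + Im s * (u p * Im (w p)))
         + \<beta>\<^sup>2 * ((Re s)\<^sup>2 + (Im s)\<^sup>2) * (u p)\<^sup>2"
      by (simp only: cmod_power2) (simp add: power2_eq_square algebra_simps)
  qed
  also have "\<dots> = (\<Sum>p<a. (cmod (w p))\<^sup>2) - 2 * \<beta> * (Re s * Re s + Im s * Im s)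
      + \<beta>\<^sup>2 * ((Re s)\<^sup>2 + (Im s)\<^sup>2) * (\<Sum>p<a. (u p)\<^sup>2)"
    by (simp only: sum.distrib sum_subtractf sum_distrib_left[symmetric] s)
  also have "\<beta>\<^sup>2 * ((Re s)\<^sup>2 + (Im s)\<^sup>2) * (\<Sum>p<a. (u p)\<^sup>2)
      = \<beta> * ((Re s)\<^sup>2 + (Im s)\<^sup>2) * (\<beta> * (\<Sum>p<a. (u p)\<^sup>2))"
    by (simp add: power2_eq_square)
  finally show ?thesis unfolding \<beta> by (simp add: power2_eq_square)
qed

lemma householder_householder:
  assumes \<beta>: "\<beta> * (\<Sum>q<a. (u q)\<^sup>2) = 2" and w: "w \<in> cvec a"
  shows "householder a \<beta> u (householder a \<beta> u w) = w"
proof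
  fix p
  define s where "s = (\<Sum>q<a. of_real (u q) * w q)"
  have "(\<Sum>q<a. of_real (u q) * householder a \<beta> u w q)
     = (\<Sum>q<a. of_real (u q) * w q - of_real \<beta> * s * of_real ((u q)\<^sup>2))"
    by (intro sum.cong refl) (simp add: householder_def s_def power2_eq_square algebra_simps)
  also have "\<dots> = s - s * of_real (\<beta> * (\<Sum>q<a. (u q)\<^sup>2))"
    by (simp add: sum_subtractf s_def sum_distrib_left mult_ac)
  also have "\<dots> = - s" unfolding \<beta> by simp
  finally have "(\<Sum>q<a. of_real (u q) * householder a \<beta> u w q) = - s" .
  then show "householder a \<beta> u (householder a \<beta> u w) p = w p"
    using w by (simp add: householder_def[of a \<beta> u "householder a \<beta> u w"]) (simp add: householder_def s_def cvec_def)
qed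

lemma holo_map_householder:
  assumes G: "holo_map a b D G" shows "holo_map a b D (\<lambda>z. householder b \<beta> u (G z))"
  unfolding holo_map_def
proof (intro conjI allI impI ballI)
  show "householder b \<beta> u (G z) \<in> cvec b" for z by (simp add: cvec_def householder_def)
  fix j assume j: "j < b"
  have h: "holo_comp a D (\<lambda>z. G z i)" if "i < b" for i using G that by (simp add: holo_map_def)
  have "holo_comp a D (\<lambda>z. G z j - of_real \<beta> * (\<Sum>q<b. of_real (u q) * G z q) * of_real (u j))"
    by (intro holo_comp_intros h j) auto
  then show "holo_comp a D (\<lambda>z. householder b \<beta> u (G z) j)" using j by (simp add: householder_def)
qed

text \<open>The reflection along \<open>u - e\<close>, with \<open>e\<close> the last unit vector,
  exchanges \<open>u\<close> and \<open>e\<close>, so the last coordinate of the reflected map is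
  the given vanishing combination. It exists when \<open>u\<close> differs from \<open>e\<close>,
  which for a unit vector means \<open>u (N - 1) \<noteq> 1\<close>.\<close>

lemma minimum_ball_map_no_real_relation:
  assumes min: "minimum_ball_map n N F" and N: "1 \<le> N"
    and u1: "(\<Sum>q<N. (u q)\<^sup>2) = 1" "u (N - 1) \<noteq> 1"
    and rel: "\<And>z. z \<in> cball_unit n \<Longrightarrow> (\<Sum>q<N. complex_of_real (u q) * F z q) = 0"
  shows False
proof -
  define l where "l = N - 1"
  have l: "l < N" using N by (simp add: l_def)
  define v where "v q = u q - (if q = l then 1 else 0)" for q
  define \<beta> where "\<beta> = 1 / (1 - u l)"
  have "(\<Sum>q<N. (v q)\<^sup>2) = (\<Sum>q<N. (u q)\<^sup>2 - (if q = l then 2 * u l - 1 else 0))"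
    by (intro sum.cong refl) (simp add: v_def power2_eq_square algebra_simps)
  also have "\<dots> = 2 * (1 - u l)" using l by (simp add: sum_subtractf u1)
  finally have \<beta>: "\<beta> * (\<Sum>q<N. (v q)\<^sup>2) = 2" using u1(2) by (simp add: \<beta>_def l_def divide_eq_eq)
  define R where "R = householder N \<beta> v"
  have hF: "holo_map n N (cball_unit n) F" and FB: "\<And>z. z \<in> cball_unit n \<Longrightarrow> F z \<in> cball_unit N"
    using min by (auto simp: minimum_ball_map_def proper_holo_def maps_into_def)
  have RB: "R w \<in> cball_unit N" if "w \<in> cball_unit N" for w
    using that householder_norm[OF \<beta>, of w] by (simp add: cball_unit_def R_def) (simp add: cvec_def householder_def)
  have RR: "R (R w) = w" if "w \<in> cball_unit N" for w
    unfolding R_def using householder_householder[OF \<beta>] that by (simp add: cball_unit_def)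
  have hR: "holo_map N N (cball_unit N) R"
    unfolding R_def using holo_map_householder[OF holo_map_id[OF cball_unit_subset_cvec]] .
  have aut: "R \<in> Aut N (cball_unit N)" by (rule AutI[OF hR hR RB RB RR RR])
  show False
  proof (rule minimum_ball_map_no_zero_last[OF min aut, of "\<lambda>z. R (F z)"])
    show "holo_map n N (cball_unit n) (\<lambda>z. R (F z))" unfolding R_def by (rule holo_map_householder[OF hF])
    fix z assume z: "z \<in> cball_unit n"
    show "R (F z) \<in> cball_unit N" by (rule RB[OF FB[OF z]])
    show "F z = R (R (F z))" using RR[OF FB[OF z]] by simp
    have "(\<Sum>q<N. complex_of_real (v q) * F z q) = (\<Sum>q<N. complex_of_real (u q) * F z q - (if q = l then F z l else 0))"
      by (intro sum.cong refl) (simp add: v_def algebra_simps)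
    also have "\<dots> = - F z l" using l by (simp add: sum_subtractf rel[OF z])
    finally have "R (F z) l = F z l + of_real \<beta> * F z l * of_real (u l - 1)"
      using l by (simp add: R_def householder_def v_def)
    also have "\<dots> = F z l * (1 + of_real (\<beta> * (u l - 1)))" by (simp add: algebra_simps)
    also have "\<beta> * (u l - 1) = -1" using u1(2) by (simp add: \<beta>_def l_def field_simps)
    finally show "R (F z) (N - 1) = 0" by (simp add: l_def)
  qed (rule N)
qed

text \<open>A zero coefficient or a zero exponent vector gives a constant component. Equal exponent
  vectors at \<open>i\<close> and \<open>j\<close> give the real relation with coefficients
  \<open>c j\<close> and \<open>- c i\<close>; as neither vanishes, no entry of the normalised
  vector \<open>u\<close> is 1.\<close>

lemma minimum_monomial_map:
  assumes min: "minimum_ball_map n N (monomial_map n N c \<alpha>)"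
  shows "\<And>i. i < N \<Longrightarrow> c i \<noteq> 0"
    and "\<And>i. i < N \<Longrightarrow> \<exists>p<n. \<alpha> i p \<noteq> 0"
    and "\<And>i j. i < N \<Longrightarrow> j < N \<Longrightarrow> i \<noteq> j \<Longrightarrow> \<exists>p<n. \<alpha> i p \<noteq> \<alpha> j p"
proof -
  show c: "c i \<noteq> 0" if i: "i < N" for i
  proof
    assume "c i = 0"
    then show False
      by (intro minimum_ball_map_no_constant_component[OF min i, of 0]) (simp add: monomial_map_def)
  qed
  show "\<exists>p<n. \<alpha> i p \<noteq> 0" if i: "i < N" for i
  proof (rule ccontr)
    assume "\<not> ?thesis"
    then show False
      using i by (intro minimum_ball_map_no_constant_component[OF min i, of "c i"]) (simp add: monomial_map_def)
  qed
  show "\<exists>p<n. \<alpha> i p \<noteq> \<alpha> j p" if i: "i < N" and j: "j < N" and ij: "i \<noteq> j" for i j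
  proof (rule ccontr)
    assume "\<not> ?thesis"
    then have eq: "(\<Prod>p<n. z p ^ \<alpha> i p) = (\<Prod>p<n. z p ^ \<alpha> j p)" for z :: "nat \<Rightarrow> complex"
      by (intro prod.cong) auto
    define r where "r = sqrt ((c i)\<^sup>2 + (c j)\<^sup>2)"
    have pos: "0 < (c i)\<^sup>2" "0 < (c j)\<^sup>2" using c i j by auto
    have r2: "r\<^sup>2 = (c i)\<^sup>2 + (c j)\<^sup>2" by (simp add: r_def)
    have r: "0 < r" using add_pos_pos[OF pos] unfolding r_def by (rule real_sqrt_gt_zero)
    define u where "u q = (if q = i then c j / r else if q = j then - c i / r else 0)" for q
    have two: "(\<Sum>q<N. g q) = g i + g j" if "\<And>q. q \<noteq> i \<Longrightarrow> q \<noteq> j \<Longrightarrow> g q = 0" for g :: "nat \<Rightarrow> 'a::comm_monoid_add"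
    proof -
      have "(\<Sum>q<N. g q) = (\<Sum>q\<in>{i, j}. g q)"
        by (rule sum.mono_neutral_right) (use i j that in auto)
      then show ?thesis using ij by simp
    qed
    have sum1: "(\<Sum>q<N. (u q)\<^sup>2) = 1"
    proof -
      have "(\<Sum>q<N. (u q)\<^sup>2) = (c j / r)\<^sup>2 + (- c i / r)\<^sup>2"
        using two[of "\<lambda>q. (u q)\<^sup>2"] ij by (simp add: u_def)
      also have "\<dots> = ((c i)\<^sup>2 + (c j)\<^sup>2) / r\<^sup>2" by (simp add: power_divide add_divide_distrib)
      finally show ?thesis using r by (simp flip: r2)
    qed
    have ne: "u (N - 1) \<noteq> 1"
    proof
      assume "u (N - 1) = 1"
      then have "c j = r \<or> - c i = r" using r by (auto simp: u_def divide_eq_eq split: if_splits)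
      then have "(c j)\<^sup>2 = r\<^sup>2 \<or> (c i)\<^sup>2 = r\<^sup>2" by (metis power2_minus)
      then show False using r2 pos by auto
    qed
    show False
    proof (rule minimum_ball_map_no_real_relation[OF min _ sum1 ne])
      fix z
      have "(\<Sum>q<N. complex_of_real (u q) * monomial_map n N c \<alpha> z q)
         = complex_of_real (u i) * monomial_map n N c \<alpha> z i + complex_of_real (u j) * monomial_map n N c \<alpha> z j"
        by (rule two) (simp add: u_def)
      also have "\<dots> = 0" using i j ij by (simp add: u_def monomial_map_def eq field_simps)
      finally show "(\<Sum>q<N. complex_of_real (u q) * monomial_map n N c \<alpha> z q) = 0" .
    qed (use i in simp)
  qed
qed

section \<open>Linear independence\<close>

lemma base_digits_unique:
  fixes x y :: "nat \<Rightarrow> nat"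
  assumes "\<And>p. p < n \<Longrightarrow> x p < B" "\<And>p. p < n \<Longrightarrow> y p < B"
    and "(\<Sum>p<n. x p * B ^ p) = (\<Sum>p<n. y p * B ^ p)" and "p < n"
  shows "x p = y p"
  using assms
proof (induction n arbitrary: x y p)
  case (Suc n)
  have split: "(\<Sum>p<Suc n. z p * B ^ p) = z 0 + B * (\<Sum>p<n. z (Suc p) * B ^ p)" for z :: "nat \<Rightarrow> nat"
    by (subst sum.lessThan_Suc_shift) (simp add: sum_distrib_left algebra_simps)
  have eq: "x 0 + B * (\<Sum>p<n. x (Suc p) * B ^ p) = y 0 + B * (\<Sum>p<n. y (Suc p) * B ^ p)"
    using Suc.prems(3) by (simp only: split)
  have lt: "x 0 < B" "y 0 < B" using Suc.prems(1,2) by auto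
  have "x 0 = (x 0 + B * (\<Sum>p<n. x (Suc p) * B ^ p)) mod B" using lt by simp
  also have "\<dots> = y 0" unfolding eq using lt by simp
  finally have 0: "x 0 = y 0" .
  have S: "(\<Sum>p<n. x (Suc p) * B ^ p) = (\<Sum>p<n. y (Suc p) * B ^ p)" using eq 0 lt by simp
  show ?case
  proof (cases p)
    case (Suc p')
    then show ?thesis
      using Suc.IH[of "\<lambda>p. x (Suc p)" "\<lambda>p. y (Suc p)" p'] Suc.prems S by auto
  qed (simp add: 0)
qed simp

lemma poly_zero_on_interval:
  fixes P :: "'a::{real_normed_field} poly" and \<delta> :: real
  assumes "0 < \<delta>" "\<And>t. 0 < t \<Longrightarrow> t < \<delta> \<Longrightarrow> poly P (of_real t) = 0"
  shows "P = 0"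
proof (rule ccontr)
  assume "P \<noteq> 0"
  then have "finite {x. poly P x = 0}" by (rule poly_roots_finite)
  moreover have "(of_real :: real \<Rightarrow> 'a) ` {0<..<\<delta>} \<subseteq> {x. poly P x = 0}" using assms(2) by auto
  ultimately have "finite ((of_real :: real \<Rightarrow> 'a) ` {0<..<\<delta>})" by (rule rev_finite_subset)
  then have "finite {0<..<\<delta>}" by (rule finite_imageD) (simp add: inj_on_def)
  then show False using assms(1) infinite_Ioo by blast
qed

lemma distinct_powers_independent:
  fixes b :: "nat \<Rightarrow> complex" and \<delta> :: real
  assumes \<delta>: "0 < \<delta>" and e: "inj_on e {..<N}"
    and zero: "\<And>t. 0 < t \<Longrightarrow> t < \<delta> \<Longrightarrow> (\<Sum>i<N. b i * complex_of_real t ^ e i) = 0" and i: "i < N"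
  shows "b i = 0"
proof -
  define P where "P = (\<Sum>i<N. monom (b i) (e i))"
  have "P = 0"
    by (rule poly_zero_on_interval[OF \<delta>]) (simp add: P_def poly_sum poly_monom zero)
  then have "0 = coeff P (e i)" by simp
  also have "\<dots> = (\<Sum>j<N. if j = i then b i else 0)"
    unfolding P_def coeff_sum by (intro sum.cong refl) (use e i in \<open>auto simp: inj_on_def\<close>)
  also have "\<dots> = b i" using i by simp
  finally show ?thesis by simp
qed

text \<open>The polynomial identity would extend to all \<open>t\<close>, but its right-hand side is negative for large \<open>t\<close>.\<close>

lemma sqrt_not_real_polynomial:
  fixes a s :: "nat \<Rightarrow> real" and e :: "nat \<Rightarrow> nat"
  assumes \<delta>: "0 < \<delta>" and N: "0 < N" and s: "\<And>i. i < N \<Longrightarrow> 0 < s i" and e: "\<And>i. i < N \<Longrightarrow> 0 < e i"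
    and eq: "\<And>t. 0 < t \<Longrightarrow> t < \<delta> \<Longrightarrow> (1 - (\<Sum>i<N. a i * t ^ e i))\<^sup>2 = 1 - (\<Sum>i<N. s i * (t ^ e i)\<^sup>2)"
  shows False
proof -
  define P where "P = (1 - (\<Sum>i<N. monom (a i) (e i)))\<^sup>2 - 1 + (\<Sum>i<N. smult (s i) ((monom 1 (e i))\<^sup>2))"
  have pP: "poly P t = (1 - (\<Sum>i<N. a i * t ^ e i))\<^sup>2 - 1 + (\<Sum>i<N. s i * (t ^ e i)\<^sup>2)" for t
    by (simp add: P_def poly_sum poly_monom)
  have "P = 0" by (rule poly_zero_on_interval[OF \<delta>]) (simp add: pP eq)
  then have P0: "poly P t = 0" for t by simp
  have id: "(\<Sum>i<N. s i * (t ^ e i)\<^sup>2) \<le> 1" for t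
    using pP[of t] zero_le_power2[of "1 - (\<Sum>i<N. a i * t ^ e i)"] unfolding P0 by linarith
  \<comment> \<open>\<open>s 0 * t = s 0 + 1\<close> exceeds 1, and \<open>t \<ge> 1\<close> makes
    \<open>(t ^ e 0)\<^sup>2\<close> dominate \<open>t\<close>. This contradicts \<open>id\<close>,
    where the sum is 1 minus a square.\<close>
  define t where "t = 1 + 1 / s 0"
  have t: "1 \<le> t" using s[OF N] by (simp add: t_def)
  have "t ^ 1 \<le> t ^ e 0" using t e[OF N] by (intro power_increasing) auto
  moreover have "t ^ e 0 * 1 \<le> t ^ e 0 * t ^ e 0" using t by (intro mult_left_mono) auto
  ultimately have "t \<le> (t ^ e 0)\<^sup>2" by (simp add: power2_eq_square)
  then have "s 0 * t \<le> s 0 * (t ^ e 0)\<^sup>2" using s[OF N] by (intro mult_left_mono) auto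
  also have "\<dots> \<le> (\<Sum>i<N. s i * (t ^ e i)\<^sup>2)"
    using N s by (intro member_le_sum[where f="\<lambda>i. s i * (t ^ e i)\<^sup>2"]) (auto intro!: mult_nonneg_nonneg simp: less_imp_le)
  also have "\<dots> \<le> 1" by (rule id)
  also have "s 0 * t = s 0 + 1" using s[OF N] by (simp add: t_def field_simps)
  finally show False using s[OF N] by simp
qed

text \<open>Substituting \<open>z\<^sub>p = t\<^bsup>B^p\<^esup>\<close> for a large base \<open>B\<close> turns distinct monomials into distinct powers of \<open>t\<close>.\<close>

lemma Kronecker_substitution:
  fixes \<alpha> :: "nat \<Rightarrow> nat \<Rightarrow> nat"
  assumes pos: "\<And>i. i < N \<Longrightarrow> \<exists>p<n. \<alpha> i p \<noteq> 0"
    and dist: "\<And>i j. i < N \<Longrightarrow> j < N \<Longrightarrow> i \<noteq> j \<Longrightarrow> \<exists>p<n. \<alpha> i p \<noteq> \<alpha> j p"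
  obtains \<delta> :: real and z :: "real \<Rightarrow> nat \<Rightarrow> complex" and e :: "nat \<Rightarrow> nat"
  where "0 < \<delta>" "\<And>t. 0 < t \<Longrightarrow> t < \<delta> \<Longrightarrow> z t \<in> cball_unit n"
    "\<And>t i. i < N \<Longrightarrow> (\<Prod>p<n. z t p ^ \<alpha> i p) = complex_of_real t ^ e i"
    "inj_on e {..<N}" "\<And>i. i < N \<Longrightarrow> 0 < e i"
proof -
  \<comment> \<open>\<open>B\<close> exceeds every exponent, so the \<open>\<alpha> i p\<close> are
    the base-\<open>B\<close> digits of \<open>e i\<close>, and \<open>e\<close> is
    injective.\<close>
  define B where "B = Suc (\<Sum>i<N. \<Sum>p<n. \<alpha> i p)"
  have B: "\<alpha> i p < B" if "i < N" "p < n" for i p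
  proof -
    have "\<alpha> i p \<le> (\<Sum>p<n. \<alpha> i p)" using that by (intro member_le_sum) auto
    also have "\<dots> \<le> (\<Sum>i<N. \<Sum>p<n. \<alpha> i p)"
      using that by (intro member_le_sum[where f="\<lambda>i. \<Sum>p<n. \<alpha> i p"]) auto
    finally show ?thesis by (simp add: B_def)
  qed
  have B1: "0 < B" by (simp add: B_def)
  define e where "e i = (\<Sum>p<n. \<alpha> i p * B ^ p)" for i
  define z where "z t = (\<lambda>p. if p < n then complex_of_real t ^ (B ^ p) else 0)" for t
  \<comment> \<open>Each \<open>(cmod (z t p))\<^sup>2\<close> will be at most \<open>t\<close>, and
    \<open>n * \<delta> < 1\<close>.\<close>
  define \<delta> :: real where "\<delta> = 1 / (real n + 1)"
  show thesis
  proof (rule that[of \<delta> z e])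
    show "0 < \<delta>" by (simp add: \<delta>_def)
    show "z t \<in> cball_unit n" if t: "0 < t" "t < \<delta>" for t
    proof -
      have t1: "t \<le> 1" using t(2) by (simp add: \<delta>_def field_simps) (smt (verit) of_nat_0_le_iff mult_nonneg_nonneg t(1))
      have "(\<Sum>p<n. (cmod (z t p))\<^sup>2) \<le> (\<Sum>p<n. t)"
      proof (rule sum_mono)
        fix p assume p: "p \<in> {..<n}"
        have "0 < B ^ p" using B1 by simp
        then have "1 \<le> B ^ p * 2" by linarith
        then have "t ^ (B ^ p * 2) \<le> t ^ 1" using t t1 by (intro power_decreasing) auto
        then show "(cmod (z t p))\<^sup>2 \<le> t" using p t by (simp add: z_def norm_power power_mult)
      qed
      also have "\<dots> = real n * t" by simp
      also have "\<dots> \<le> real n * \<delta>" using t by (intro mult_left_mono) auto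
      also have "\<dots> < 1" by (simp add: \<delta>_def field_simps)
      finally show ?thesis by (simp add: cball_unit_def cvec_def z_def)
    qed
    show "(\<Prod>p<n. z t p ^ \<alpha> i p) = complex_of_real t ^ e i" for t i
    proof -
      have "(\<Prod>p<n. z t p ^ \<alpha> i p) = (\<Prod>p<n. complex_of_real t ^ (\<alpha> i p * B ^ p))"
        by (intro prod.cong refl) (simp add: z_def mult.commute flip: power_mult)
      then show ?thesis by (simp add: e_def power_sum)
    qed
    show "inj_on e {..<N}"
    proof (rule inj_onI, rule ccontr)
      fix i j assume ij: "i \<in> {..<N}" "j \<in> {..<N}" "e i = e j" "i \<noteq> j"
      then obtain p where p: "p < n" "\<alpha> i p \<noteq> \<alpha> j p" using dist[of i j] by auto
      moreover have "\<alpha> i p = \<alpha> j p"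
        using ij p(1) B by (intro base_digits_unique[of n "\<alpha> i" B "\<alpha> j"]) (auto simp: e_def)
      ultimately show False by simp
    qed
    show "0 < e i" if i: "i < N" for i
    proof -
      obtain p where p: "p < n" "\<alpha> i p \<noteq> 0" using pos[OF i] by auto
      then have "0 < \<alpha> i p * B ^ p" using B1 by simp
      also have "\<dots> \<le> e i" unfolding e_def using p by (intro member_le_sum[where f="\<lambda>p. \<alpha> i p * B ^ p"]) auto
      finally show ?thesis .
    qed
  qed
qed

text \<open>On the curve of the Kronecker substitution the monomials are real and
  \<open>S t < 1\<close>, so the complex root is the real one. If \<open>b'\<close> were nonzero,
  \<open>sqrt (1 - S t)\<close> would be a real polynomial in \<open>t\<close>, which positivity of
  \<open>\<kappa>\<close> excludes. What remains is a relation between distinct powers.\<close>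

lemma monomials_and_sqrt_independent:
  fixes \<kappa> :: "nat \<Rightarrow> real"
  assumes min: "minimum_ball_map n N (monomial_map n N c \<alpha>)" and N: "0 < N"
    and \<kappa>: "\<And>j. j < N \<Longrightarrow> 0 < \<kappa> j" "\<And>j. j < N \<Longrightarrow> \<kappa> j \<le> 1"
    and rel: "\<And>z. z \<in> cball_unit n \<Longrightarrow> (\<Sum>j<N. b j * monomial_map n N c \<alpha> z j)
        + b' * (1 - csqrt (1 - (\<Sum>j<N. of_real (\<kappa> j) * (monomial_map n N c \<alpha> z j)\<^sup>2))) = 0"
  shows "b' = 0" and "\<And>j. j < N \<Longrightarrow> b j = 0"
proof -
  let ?F = "monomial_map n N c \<alpha>"
  obtain \<delta> z e where \<delta>: "0 < \<delta>" and zB: "\<And>t. 0 < t \<Longrightarrow> t < \<delta> \<Longrightarrow> z t \<in> cball_unit n"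
    and mon: "\<And>t i. i < N \<Longrightarrow> (\<Prod>p<n. z t p ^ \<alpha> i p) = complex_of_real t ^ e i"
    and inj: "inj_on e {..<N}" and e: "\<And>i. i < N \<Longrightarrow> 0 < e i"
    by (rule Kronecker_substitution[OF minimum_monomial_map(2,3)[OF min]]) auto
  have c: "c i \<noteq> 0" if "i < N" for i using minimum_monomial_map(1)[OF min that] .
  have FB: "\<And>z. z \<in> cball_unit n \<Longrightarrow> ?F z \<in> cball_unit N"
    using min by (auto simp: minimum_ball_map_def proper_holo_def maps_into_def)
  have F: "?F (z t) i = of_real (c i * t ^ e i)" if "i < N" for t i
    using that by (simp add: monomial_map_def mon)
  define S where "S t = (\<Sum>j<N. \<kappa> j * (c j * t ^ e j)\<^sup>2)" for t
  have S1: "S t < 1" if t: "0 < t" "t < \<delta>" for t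
  proof -
    have "S t \<le> (\<Sum>j<N. 1 * (c j * t ^ e j)\<^sup>2)"
      unfolding S_def using \<kappa> by (intro sum_mono mult_right_mono) auto
    also have "\<dots> = (\<Sum>j<N. (cmod (?F (z t) j))\<^sup>2)" by (simp add: F del: of_real_mult)
    also have "\<dots> < 1" using FB[OF zB[OF t]] by (simp add: cball_unit_def)
    finally show ?thesis .
  qed
  have sq: "csqrt (1 - (\<Sum>j<N. of_real (\<kappa> j) * (?F (z t) j)\<^sup>2)) = of_real (sqrt (1 - S t))" if "0 < t" "t < \<delta>" for t
  proof -
    have "1 - (\<Sum>j<N. of_real (\<kappa> j) * (?F (z t) j)\<^sup>2) = complex_of_real (1 - S t)"
      by (simp add: S_def F)
    then show ?thesis using S1[OF that] by (simp del: of_real_diff)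
  qed
  show b': "b' = 0"
  proof (rule ccontr)
    assume b': "b' \<noteq> 0"
    define \<beta> where "\<beta> j = b j / b'" for j
    \<comment> \<open>The relation may have complex coefficients while the functions in it are real,
      so its real part is a relation with real coefficients \<open>a\<close>.\<close>
    define a where "a j = - Re (\<beta> j) * c j" for j
    show False
    proof (rule sqrt_not_real_polynomial[OF \<delta> N, of "\<lambda>j. \<kappa> j * (c j)\<^sup>2" e a])
      show "0 < \<kappa> i * (c i)\<^sup>2" if "i < N" for i using \<kappa>(1)[OF that] c[OF that] by simp
      show "0 < e i" if "i < N" for i using e[OF that] .
      fix t assume t: "0 < t" "t < \<delta>"
      have "(\<Sum>j<N. b j * of_real (c j * t ^ e j)) + b' * (1 - of_real (sqrt (1 - S t))) = 0"
        using rel[OF zB[OF t]] unfolding sq[OF t] by (simp add: F)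
      then have "b' * (1 - of_real (sqrt (1 - S t))) = - (\<Sum>j<N. b j * of_real (c j * t ^ e j))"
        by (simp add: eq_neg_iff_add_eq_0 add.commute)
      then have "1 - of_real (sqrt (1 - S t)) = - (\<Sum>j<N. b j * of_real (c j * t ^ e j)) / b'"
        using b' by (simp add: field_simps)
      also have "\<dots> = (\<Sum>j<N. - \<beta> j * of_real (c j * t ^ e j))"
        by (simp add: \<beta>_def sum_divide_distrib sum_negf)
      finally have "Re (1 - of_real (sqrt (1 - S t))) = Re (\<Sum>j<N. - \<beta> j * of_real (c j * t ^ e j))"
        by (rule arg_cong)
      also have "\<dots> = (\<Sum>j<N. a j * t ^ e j)"
        unfolding Re_sum by (intro sum.cong refl) (simp add: a_def flip: of_real_mult of_real_power)
      finally have "1 - (\<Sum>j<N. a j * t ^ e j) = sqrt (1 - S t)" by simp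
      then have "(1 - (\<Sum>j<N. a j * t ^ e j))\<^sup>2 = 1 - S t" using S1[OF t] by simp
      then show "(1 - (\<Sum>i<N. a i * t ^ e i))\<^sup>2 = 1 - (\<Sum>i<N. \<kappa> i * (c i)\<^sup>2 * (t ^ e i)\<^sup>2)"
        by (simp add: S_def power_mult_distrib mult.assoc)
    qed
  qed
  show "b j = 0" if j: "j < N" for j
  proof -
    have "b j * of_real (c j) = 0"
    proof (rule distinct_powers_independent[OF \<delta> inj _ j, where b="\<lambda>j. b j * of_real (c j)"])
      fix t assume t: "0 < t" "t < \<delta>"
      have "(\<Sum>j<N. b j * ?F (z t) j) = 0" using rel[OF zB[OF t]] b' by simp
      then show "(\<Sum>i<N. b i * of_real (c i) * of_real t ^ e i) = 0" by (simp add: F mult.assoc)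
    qed
    then show ?thesis using c[OF j] by simp
  qed
qed

section \<open>The maps into the Lie ball\<close>

lemma sum_lessThan_double: "(\<Sum>p<2 * K. g p) = (\<Sum>j<K. g (2 * j) + g (2 * j + 1))"
  for g :: "nat \<Rightarrow> 'a::comm_monoid_add"
  by (induction K) (simp_all add: add.assoc)

lemma sum_Mmap_coordinates:
  fixes g :: "nat \<Rightarrow> 'a::comm_monoid_add"
  assumes "K \<le> N"
  shows "(\<Sum>p<Suc (N + K). g p)
    = (\<Sum>j<N. if j < K then g (2 * j) + g (2 * j + 1) else g (j + K)) + g (N + K)"
proof -
  have "(\<Sum>p<N + K. g p) = (\<Sum>p<2 * K. g p) + (\<Sum>p\<in>{2 * K..<N + K}. g p)"
    using assms by (subst sum.union_disjoint[symmetric]) (auto intro!: sum.cong)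
  also have "(\<Sum>p\<in>{2 * K..<N + K}. g p) = (\<Sum>j\<in>{K..<N}. g (j + K))"
    using sum.shift_bounds_nat_ivl[of g K K N] by (simp add: mult_2)
  also have "(\<Sum>p<2 * K. g p) = (\<Sum>j<K. g (2 * j) + g (2 * j + 1))" by (rule sum_lessThan_double)
  also have "(\<Sum>j<K. g (2 * j) + g (2 * j + 1)) + (\<Sum>j\<in>{K..<N}. g (j + K))
     = (\<Sum>j<N. if j < K then g (2 * j) + g (2 * j + 1) else g (j + K))" (is "?l = ?r")
  proof -
    have "?r = (\<Sum>j<K. if j < K then g (2 * j) + g (2 * j + 1) else g (j + K))
       + (\<Sum>j\<in>{K..<N}. if j < K then g (2 * j) + g (2 * j + 1) else g (j + K))"
      using assms by (subst sum.union_disjoint[symmetric]) (auto intro!: sum.cong)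
    then show ?thesis by simp
  qed
  finally show ?thesis by simp
qed

text \<open>In the product topology this is Tychonoff's theorem: the set is closed in a product of
  discs, with the factor \<open>{0}\<close> from coordinate \<open>a\<close> on. The absolute value
  under the root lets \<open>r\<close> be negative.\<close>

lemma compact_closed_ball_cvec: "compact {w \<in> cvec a. (\<Sum>j<a. (cmod (w j))\<^sup>2) \<le> r}"
proof -
  define B where "B i = (if i < a then cball (0::complex) (sqrt \<bar>r\<bar>) else {0})" for i
  have "compactin (product_topology (\<lambda>i. euclidean) UNIV) (PiE UNIV B)"
    unfolding compactin_PiE by (auto simp: B_def)
  then have "compact (PiE UNIV B)" by (simp add: euclidean_product_topology)
  moreover have "closed {w::nat \<Rightarrow> complex. (\<Sum>j<a. (cmod (w j))\<^sup>2) \<le> r}"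
    by (intro closed_Collect_le continuous_intros continuous_on_product_coordinates)
  ultimately have "compact (PiE UNIV B \<inter> {w. (\<Sum>j<a. (cmod (w j))\<^sup>2) \<le> r})"
    by (rule compact_Int_closed)
  also have "PiE UNIV B \<inter> {w. (\<Sum>j<a. (cmod (w j))\<^sup>2) \<le> r} = {w \<in> cvec a. (\<Sum>j<a. (cmod (w j))\<^sup>2) \<le> r}"
  proof (intro equalityI subsetI)
    fix w assume w: "w \<in> PiE UNIV B \<inter> {w. (\<Sum>j<a. (cmod (w j))\<^sup>2) \<le> r}"
    then have wB: "w i \<in> B i" for i by auto
    have "w i = 0" if "a \<le> i" for i using wB[of i] that by (simp add: B_def)
    then show "w \<in> {w \<in> cvec a. (\<Sum>j<a. (cmod (w j))\<^sup>2) \<le> r}" using w by (simp add: cvec_def)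
  next
    fix w assume w: "w \<in> {w \<in> cvec a. (\<Sum>j<a. (cmod (w j))\<^sup>2) \<le> r}"
    have "w i \<in> B i" for i
    proof (cases "i < a")
      case True
      have "(cmod (w i))\<^sup>2 \<le> (\<Sum>j<a. (cmod (w j))\<^sup>2)" using True by (intro member_le_sum) auto
      also have "\<dots> \<le> r" using w by simp
      also have "\<dots> \<le> \<bar>r\<bar>" by simp
      finally show ?thesis using True by (simp add: B_def real_le_rsqrt)
    qed (use w in \<open>simp add: B_def cvec_def\<close>)
    then show "w \<in> PiE UNIV B \<inter> {w. (\<Sum>j<a. (cmod (w j))\<^sup>2) \<le> r}" using w by auto
  qed
  finally show ?thesis .
qed

text \<open>\<open>K\<close> is \<open>k - 1\<close>, the number of components of \<open>F\<close>
  that are split into a pair. Properness of \<open>M\<close> is derived from that of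
  \<open>F\<close> alone; the monomial form enters with minimality.\<close>

locale Mmap_setup =
  fixes n N K :: nat and F :: "(nat \<Rightarrow> complex) \<Rightarrow> nat \<Rightarrow> complex" and \<theta> :: real
  assumes F: "proper_holo n N (cball_unit n) (cball_unit N) F"
    and \<theta>: "0 < \<theta>" "\<theta> < pi / 4" and K: "K \<le> N"
begin

definition M :: "(nat \<Rightarrow> complex) \<Rightarrow> nat \<Rightarrow> complex" where
  "M = Mmap N F \<theta> (Suc K)"

text \<open>The weight \<open>cos (2 * \<theta>)\<close> equals
  \<open>(cos \<theta>)\<^sup>2 - (sin \<theta>)\<^sup>2\<close>, which is what the squares of a
  split pair add up to. Weighting every component lets all \<open>k\<close> be treated at
  once.\<close>

definition \<kappa> :: "nat \<Rightarrow> real" where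
  "\<kappa> j = (if j < K then cos (2 * \<theta>) else 1)"

definition S :: "(nat \<Rightarrow> complex) \<Rightarrow> complex" where
  "S z = (\<Sum>j<N. of_real (\<kappa> j) * (F z j)\<^sup>2)"

definition h :: "(nat \<Rightarrow> complex) \<Rightarrow> complex" where
  "h z = 1 - csqrt (1 - S z)"

lemma \<kappa>_pos: "0 < \<kappa> j" and \<kappa>_le_1: "\<kappa> j \<le> 1"
  using \<theta> by (auto simp: \<kappa>_def intro!: cos_gt_zero)

lemma M_simps:
  "j < K \<Longrightarrow> M z (2 * j) = of_real (cos \<theta>) * F z j"
  "j < K \<Longrightarrow> M z (2 * j + 1) = \<i> * of_real (sin \<theta>) * F z j"
  "K \<le> j \<Longrightarrow> j < N \<Longrightarrow> M z (j + K) = F z j"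
  "M z (N + K) = h z"
  "N + K < p \<Longrightarrow> M z p = 0"
proof -
  have "S z = of_real (cos (2 * \<theta>)) * (\<Sum>j<K. (F z j)\<^sup>2) + (\<Sum>j\<in>{K..<N}. (F z j)\<^sup>2)"
  proof -
    have "S z = (\<Sum>j<K. of_real (\<kappa> j) * (F z j)\<^sup>2) + (\<Sum>j\<in>{K..<N}. of_real (\<kappa> j) * (F z j)\<^sup>2)"
      unfolding S_def using K by (subst sum.union_disjoint[symmetric]) (auto intro!: sum.cong)
    then show ?thesis by (simp add: \<kappa>_def sum_distrib_left)
  qed
  then show "M z (N + K) = h z" using K by (simp add: M_def Mmap_def h_def algebra_simps)
qed (use K in \<open>auto simp: M_def Mmap_def\<close>)

lemma sum_M:
  fixes g :: "complex \<Rightarrow> nat \<Rightarrow> 'a::comm_monoid_add"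
  shows "(\<Sum>p<Suc (N + K). g (M z p) p)
    = (\<Sum>j<N. if j < K then g (of_real (cos \<theta>) * F z j) (2 * j) + g (\<i> * of_real (sin \<theta>) * F z j) (2 * j + 1)
         else g (F z j) (j + K)) + g (h z) (N + K)"
  by (subst sum_Mmap_coordinates[OF K], intro arg_cong2[where f="(+)"] sum.cong refl)
     (auto simp: M_simps simp del: One_nat_def)

lemma FB: "z \<in> cball_unit n \<Longrightarrow> F z \<in> cball_unit N"
  using F by (auto simp: proper_holo_def maps_into_def)

lemma S_less_1:
  assumes "z \<in> cball_unit n" shows "cmod (S z) < 1"
proof -
  have "cmod (S z) \<le> (\<Sum>j<N. \<kappa> j * (cmod (F z j))\<^sup>2)"
    unfolding S_def using \<kappa>_pos
    by (intro order_trans[OF norm_sum] sum_mono) (simp add: norm_mult norm_power less_imp_le)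
  also have "\<dots> \<le> (\<Sum>j<N. 1 * (cmod (F z j))\<^sup>2)"
    using \<kappa>_le_1 by (intro sum_mono mult_right_mono) auto
  also have "\<dots> < 1" using FB[OF assms] by (simp add: cball_unit_def)
  finally show ?thesis .
qed

lemma h_quadratic: "(h z)\<^sup>2 + S z = 2 * h z"
proof -
  have "(1 - h z)\<^sup>2 = 1 - S z" by (simp add: h_def)
  then show ?thesis by (simp add: power2_eq_square algebra_simps)
qed

text \<open>\<open>h\<close> and \<open>2 - h\<close> have the product \<open>S\<close>. The
  principal branch gives \<open>2 - h = 1 + csqrt (1 - S)\<close> a real part of at least 1, so
  \<open>cmod h \<le> cmod S\<close>.\<close>

lemma h_less_1:
  assumes "z \<in> cball_unit n" shows "cmod (h z) < 1"
proof -
  have "h z * (2 - h z) = S z" using h_quadratic[of z] by (simp add: power2_eq_square algebra_simps)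
  then have "cmod (h z) * cmod (2 - h z) = cmod (S z)" by (metis norm_mult)
  moreover have "1 \<le> cmod (2 - h z)"
  proof -
    have "0 \<le> Re (csqrt (1 - S z))" using csqrt_principal[of "1 - S z"] by auto
    then have "1 \<le> Re (2 - h z)" by (simp add: h_def)
    then show ?thesis using complex_Re_le_cmod[of "2 - h z"] by linarith
  qed
  then have "cmod (h z) * 1 \<le> cmod (h z) * cmod (2 - h z)" by (intro mult_left_mono) auto
  ultimately show ?thesis using S_less_1[OF assms] by simp
qed

lemma M_norm: "(\<Sum>p<Suc (N + K). (cmod (M z p))\<^sup>2) = (\<Sum>j<N. (cmod (F z j))\<^sup>2) + (cmod (h z))\<^sup>2"
proof -
  have trig: "(cmod (of_real (cos \<theta>) * x))\<^sup>2 + (cmod (\<i> * of_real (sin \<theta>) * x))\<^sup>2 = (cmod x)\<^sup>2" for x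
  proof -
    have "(cmod (of_real (cos \<theta>) * x))\<^sup>2 + (cmod (\<i> * of_real (sin \<theta>) * x))\<^sup>2 = ((cos \<theta>)\<^sup>2 + (sin \<theta>)\<^sup>2) * (cmod x)\<^sup>2"
      by (simp only: norm_mult power_mult_distrib norm_of_real power2_abs norm_ii distrib_right) simp
    then show ?thesis by simp
  qed
  show ?thesis by (subst sum_M[of "\<lambda>x p. (cmod x)\<^sup>2"]) (simp only: trig if_cancel)
qed

lemma M_square: "(\<Sum>p<Suc (N + K). (M z p)\<^sup>2) = 2 * h z"
proof -
  have trig: "(of_real (cos \<theta>) * x)\<^sup>2 + (\<i> * of_real (sin \<theta>) * x)\<^sup>2 = of_real (cos (2 * \<theta>)) * x\<^sup>2" for x
    unfolding cos_double power_mult_distrib by (simp add: algebra_simps)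
  have "(\<Sum>p<Suc (N + K). (M z p)\<^sup>2) = S z + (h z)\<^sup>2"
    unfolding sum_M[of "\<lambda>x p. x\<^sup>2"] trig S_def
    by (intro arg_cong2[where f="(+)"] sum.cong refl) (simp add: \<kappa>_def)
  then show ?thesis using h_quadratic[of z] by (simp add: add.commute)
qed

lemma M_boundary_function:
  "1 - (\<Sum>p<Suc (N + K). (cmod (M z p))\<^sup>2) + (cmod (\<Sum>p<Suc (N + K). (M z p)\<^sup>2))\<^sup>2 / 4
     = 1 - (\<Sum>j<N. (cmod (F z j))\<^sup>2)"
  unfolding M_norm M_square by (simp add: norm_mult power_mult_distrib)

lemma M_cvec: "M z \<in> cvec (Suc (N + K))"
  by (auto simp: cvec_def M_simps)

lemma M_in_DIV:
  assumes "z \<in> cball_unit n" shows "M z \<in> DIV (Suc (N + K))"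
proof -
  have F1: "(\<Sum>j<N. (cmod (F z j))\<^sup>2) < 1" using FB[OF assms] by (simp add: cball_unit_def)
  have "(cmod (h z))\<^sup>2 < 1" using h_less_1[OF assms] by (simp add: power_less_one_iff)
  then have "(\<Sum>p<Suc (N + K). (cmod (M z p))\<^sup>2) < 2" using F1 unfolding M_norm by linarith
  moreover have "0 < 1 - (\<Sum>p<Suc (N + K). (cmod (M z p))\<^sup>2) + (cmod (\<Sum>p<Suc (N + K). (M z p)\<^sup>2))\<^sup>2 / 4"
    using F1 unfolding M_boundary_function by linarith
  ultimately show ?thesis using M_cvec unfolding DIV_def by blast
qed

lemma S_slit: "z \<in> cball_unit n \<Longrightarrow> 1 - S z \<notin> \<real>\<^sub>\<le>\<^sub>0"
  using S_less_1[of z] complex_Re_le_cmod[of "S z"] by (auto simp: complex_nonpos_Reals_iff)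

lemma M_components:
  assumes p: "p < Suc (N + K)"
  obtains (scaled) a j where "j < N" "\<And>z. M z p = a * F z j" | (last) "\<And>z. M z p = h z"
proof -
  consider (a) "p < 2 * K" | (b) "2 * K \<le> p" "p < N + K" | (c) "p = N + K" using p by linarith
  then show thesis
  proof cases
    case a
    define j where "j = p div 2"
    have j: "j < K" "p = 2 * j \<or> p = 2 * j + 1" using a by (auto simp: j_def)
    from j(2) show thesis
    proof
      assume "p = 2 * j"
      then show thesis using j(1) K M_simps(1)[of j] by (intro scaled[of j "of_real (cos \<theta>)"]) auto
    next
      assume "p = 2 * j + 1"
      then show thesis using j(1) K M_simps(2)[of j] by (intro scaled[of j "\<i> * of_real (sin \<theta>)"]) auto
    qed
  next
    case b
    then show thesis using M_simps(3)[of "p - K"] by (intro scaled[of "p - K" 1]) auto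
  next
    case c
    then show thesis using M_simps(4) by (intro last) simp
  qed
qed

lemma holo_map_M: "holo_map n (Suc (N + K)) (cball_unit n) M"
  unfolding holo_map_def
proof (intro conjI ballI allI impI)
  fix p assume p: "p < Suc (N + K)"
  have hF: "holo_comp n (cball_unit n) (\<lambda>z. F z j)" if "j < N" for j
    using F that by (simp add: proper_holo_def holo_map_def)
  show "holo_comp n (cball_unit n) (\<lambda>z. M z p)"
    using p
  proof (cases rule: M_components)
    case (scaled a j)
    then show ?thesis by (simp only: scaled(2)) (intro holo_comp_intros hF)
  next
    case last
    have "holo_comp n (cball_unit n) (\<lambda>z. 1 - S z)"
      unfolding S_def by (intro holo_comp_intros hF) auto
    then have "holo_comp n (cball_unit n) (\<lambda>z. csqrt (1 - S z))"
      by (rule holo_comp_compose) (intro field_differentiable_at_csqrt S_slit)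
    then have "holo_comp n (cball_unit n) h"
      unfolding h_def[abs_def] by (intro holo_comp_diff holo_comp_const)
    then show ?thesis by (simp only: last)
  qed
qed (rule M_cvec)

lemma continuous_on_M: "continuous_on (cball_unit n) M"
proof (rule continuous_on_coordinatewise_then_product)
  fix p
  show "continuous_on (cball_unit n) (\<lambda>z. M z p)"
  proof (cases "p < Suc (N + K)")
    case True
    then show ?thesis
      using holo_map_M by (intro holo_comp_continuous_on[OF _ cball_unit_subset_cvec]) (simp add: holo_map_def)
  next
    case False
    then show ?thesis by (simp add: M_simps)
  qed
qed

text \<open>On a nonempty compact \<open>T\<close> the defining function \<open>\<rho>\<close> has a
  positive minimum. By \<open>M_boundary_function\<close> this confines \<open>F\<close> to a
  smaller closed ball, whose preimage under \<open>F\<close> is compact; the preimage of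
  \<open>T\<close> under \<open>M\<close> is relatively closed in it.\<close>

lemma proper_holo_M: "proper_holo n (Suc (N + K)) (cball_unit n) (DIV (Suc (N + K))) M"
  unfolding proper_holo_def proper_on_def
proof (intro conjI allI impI)
  show "holo_map n (Suc (N + K)) (cball_unit n) M" by (rule holo_map_M)
  show "maps_into M (cball_unit n) (DIV (Suc (N + K)))" using M_in_DIV by (simp add: maps_into_def)
  fix T assume T: "T \<subseteq> DIV (Suc (N + K)) \<and> compact T"
  show "compact {z \<in> cball_unit n. M z \<in> T}"
  proof (cases "T = {}")
    case True
    then show ?thesis by simp
  next
    case False
    define \<rho> where "\<rho> w = 1 - (\<Sum>p<Suc (N + K). (cmod (w p))\<^sup>2) + (cmod (\<Sum>p<Suc (N + K). (w p)\<^sup>2))\<^sup>2 / 4" for w :: "nat \<Rightarrow> complex"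
    have coord: "continuous_on T (\<lambda>w. w p)" for p
      by (rule continuous_on_subset[OF continuous_on_product_coordinates subset_UNIV])
    have "continuous_on T \<rho>" unfolding \<rho>_def by (intro continuous_intros coord) auto
    then obtain w0 where w0: "w0 \<in> T" "\<And>w. w \<in> T \<Longrightarrow> \<rho> w0 \<le> \<rho> w"
      using continuous_attains_inf[of T \<rho>] T False by auto
    have pos: "0 < \<rho> w0" using w0(1) T by (auto simp: DIV_def \<rho>_def)
    define C where "C = {w \<in> cvec N. (\<Sum>j<N. (cmod (w j))\<^sup>2) \<le> 1 - \<rho> w0}"
    have "C \<subseteq> cball_unit N" using pos by (auto simp: C_def cball_unit_def)
    moreover have "compact C" unfolding C_def by (rule compact_closed_ball_cvec)
    ultimately have cF: "compact {z \<in> cball_unit n. F z \<in> C}"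
      using F by (simp add: proper_holo_def proper_on_def)
    have "{z \<in> cball_unit n. M z \<in> T} = {z \<in> cball_unit n. F z \<in> C} \<inter> M -` T"
    proof (intro equalityI subsetI)
      fix z assume "z \<in> {z \<in> cball_unit n. M z \<in> T}"
      then have z: "z \<in> cball_unit n" "M z \<in> T" by auto
      have "\<rho> w0 \<le> 1 - (\<Sum>j<N. (cmod (F z j))\<^sup>2)"
        using w0(2)[OF z(2)] M_boundary_function[of z] by (simp only: \<rho>_def)
      then show "z \<in> {z \<in> cball_unit n. F z \<in> C} \<inter> M -` T"
        using z FB[OF z(1)] cball_unit_subset_cvec[of N] by (auto simp: C_def)
    qed auto
    moreover have "closedin (top_of_set {z \<in> cball_unit n. F z \<in> C}) ({z \<in> cball_unit n. F z \<in> C} \<inter> M -` T)"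
    proof (rule continuous_closedin_preimage)
      show "continuous_on {z \<in> cball_unit n. F z \<in> C} M"
        by (rule continuous_on_subset[OF continuous_on_M]) auto
      show "closed T" using T by (simp add: compact_imp_closed)
    qed
    ultimately show ?thesis using closedin_compact[OF cF] by simp
  qed
qed

end

section \<open>Minimality\<close>

lemma DIV_mono: "DIV m \<subseteq> DIV (Suc m)"
  by (auto simp: DIV_def cvec_def)

definition reflect :: "nat \<Rightarrow> (nat \<Rightarrow> complex) \<Rightarrow> nat \<Rightarrow> complex" where
  "reflect l w = (\<lambda>i. if i = l then - w i else w i)"

lemma reflect_in_DIV: "w \<in> DIV m \<Longrightarrow> reflect l w \<in> DIV m"
proof -
  assume w: "w \<in> DIV m"
  have "cmod (reflect l w i) = cmod (w i)" "(reflect l w i)\<^sup>2 = (w i)\<^sup>2" for i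
    by (auto simp: reflect_def)
  then show ?thesis using w by (auto simp: DIV_def cvec_def reflect_def)
qed

lemma holo_map_reflect: "D \<subseteq> cvec a \<Longrightarrow> holo_map a a D (reflect l)"
  unfolding holo_map_def
proof (intro conjI ballI allI impI)
  assume D: "D \<subseteq> cvec a"
  show "reflect l z \<in> cvec a" if "z \<in> D" for z using that D by (auto simp: cvec_def reflect_def)
  fix j assume j: "j < a"
  have "holo_comp a D (\<lambda>z. (if j = l then -1 else 1) * z j)" by (intro holo_comp_intros j)
  moreover have "(\<lambda>z. (if j = l then -1 else 1) * z j) = (\<lambda>z. reflect l z j)" by (auto simp: reflect_def)
  ultimately show "holo_comp a D (\<lambda>z. reflect l z j)" by simp
qed

text \<open>If the image of \<open>X\<close> lies in \<open>\<phi>\<close> of the hyperplane section, the conjugate by \<open>\<phi>\<close> of the reflection in that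
  section fixes the image of \<open>X\<close> pointwise; as \<open>X\<close> passes through the origin this conjugate is linear.\<close>

lemma DIV_section_involution:
  assumes \<phi>: "\<phi> \<in> Aut (Suc l) (DIV (Suc l))"
    and Y: "\<And>z. z \<in> A \<Longrightarrow> Y z \<in> DIV l" and X: "\<And>z. z \<in> A \<Longrightarrow> X z = \<phi> (Y z)"
    and origin: "x \<in> A" "X x = (\<lambda>i. 0)"
  obtains d where "\<And>w. w \<in> DIV (Suc l) \<Longrightarrow> matvec (Suc l) d w \<in> DIV (Suc l)"
    "\<And>v. v \<in> cvec (Suc l) \<Longrightarrow> matvec (Suc l) d v \<in> cvec (Suc l)"
    "\<And>v. v \<in> cvec (Suc l) \<Longrightarrow> matvec (Suc l) d (matvec (Suc l) d v) = v"
    "\<And>z. z \<in> A \<Longrightarrow> matvec (Suc l) d (X z) = X z"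
    "\<exists>w\<in>DIV (Suc l). matvec (Suc l) d w \<noteq> w"
proof -
  define D where "D = DIV (Suc l)"
  define \<xi> where "\<xi> = inv_into D \<phi>"
  have Dc: "D \<subseteq> cvec (Suc l)" by (simp add: D_def DIV_subset_cvec)
  have bij: "bij_betw \<phi> D D" and h\<phi>: "holo_map (Suc l) (Suc l) D \<phi>" and h\<xi>: "holo_map (Suc l) (Suc l) D \<xi>"
    using \<phi> by (simp_all add: Aut_def D_def \<xi>_def)
  have \<phi>D: "\<phi> w \<in> D" if "w \<in> D" for w using bij that by (auto simp: bij_betw_def)
  have \<xi>D: "\<xi> w \<in> D" if "w \<in> D" for w
    using bij that inv_into_into[of w \<phi> D] by (simp add: \<xi>_def bij_betw_def)
  have \<phi>\<xi>: "\<phi> (\<xi> w) = w" if "w \<in> D" for w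
    using bij that f_inv_into_f[of w \<phi> D] by (simp add: \<xi>_def bij_betw_def)
  have \<xi>\<phi>: "\<xi> (\<phi> w) = w" if "w \<in> D" for w
    using bij that inv_into_f_f[of \<phi> D w] by (simp add: \<xi>_def bij_betw_def)
  have \<sigma>D: "reflect l w \<in> D" if "w \<in> D" for w using reflect_in_DIV that by (simp add: D_def)
  define \<tau> where "\<tau> = (\<lambda>w. \<phi> (reflect l (\<xi> w)))"
  have \<tau>D: "\<tau> w \<in> D" if "w \<in> D" for w using that by (simp add: \<tau>_def \<phi>D \<sigma>D \<xi>D)
  have c1: "curve_holo (Suc l) D (\<lambda>w. reflect l (\<xi> w))"
    using curve_holo_comp[OF holo_map_imp_curve_holo[OF h\<xi> Dc] holo_map_imp_curve_holo[OF holo_map_reflect[OF Dc] Dc]] \<xi>D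
    by auto
  have "curve_holo (Suc l) D (\<lambda>w. \<phi> (reflect l (\<xi> w)))"
    using curve_holo_comp[OF c1 holo_map_imp_curve_holo[OF h\<phi> Dc]] \<sigma>D \<xi>D by auto
  then have c\<tau>: "curve_holo (Suc l) D \<tau>" by (simp only: \<tau>_def)
  have inv: "\<tau> (\<tau> w) = w" if "w \<in> D" for w
  proof -
    have "reflect l (reflect l (\<xi> w)) = \<xi> w" by (auto simp: reflect_def)
    then show ?thesis using that by (simp add: \<tau>_def \<xi>\<phi> \<sigma>D \<xi>D \<phi>\<xi>)
  qed
  have YD: "Y z \<in> D" if "z \<in> A" for z using Y[OF that] DIV_mono by (auto simp: D_def)
  have fixX: "\<tau> (X z) = X z" if z: "z \<in> A" for z
  proof -
    have "reflect l (Y z) = Y z" using Y[OF z] by (auto simp: reflect_def DIV_def cvec_def)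
    then show ?thesis using z by (simp add: \<tau>_def X \<xi>\<phi> YD)
  qed
  have XD: "X z \<in> D" if "z \<in> A" for z using X[OF that] \<phi>D[OF YD[OF that]] by simp
  obtain d where d: "\<And>w. w \<in> D \<Longrightarrow> \<tau> w = matvec (Suc l) d w"
    "\<And>v. v \<in> cvec (Suc l) \<Longrightarrow> matvec (Suc l) d v \<in> cvec (Suc l)"
    "\<And>v. v \<in> cvec (Suc l) \<Longrightarrow> matvec (Suc l) d (matvec (Suc l) d v) = v"
  proof (rule Cartan_linear_involution[of D "Suc l" 2 \<tau>])
    show "\<And>w. w \<in> cvec (Suc l) \<Longrightarrow> l1norm (Suc l) w < 1 \<Longrightarrow> w \<in> D" unfolding D_def by (rule small_in_DIV)
    show "\<And>w i. w \<in> D \<Longrightarrow> cmod (w i) \<le> 2" unfolding D_def by (rule DIV_bounded)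
    show "\<And>w c. w \<in> D \<Longrightarrow> cmod c \<le> 1 \<Longrightarrow> (\<lambda>i. c * w i) \<in> D" unfolding D_def by (rule DIV_balanced)
    show "\<And>w. w \<in> D \<Longrightarrow> open {t. (\<lambda>i. t * w i) \<in> D}" unfolding D_def by (rule DIV_open_slice)
    show "\<tau> ` D \<subseteq> D" using \<tau>D by auto
    show "\<tau> (\<lambda>i. 0) = (\<lambda>i. 0)" using fixX[OF origin(1)] origin(2) by simp
  qed (use Dc c\<tau> inv in auto)
  show thesis
  proof (rule that[of d])
    show "matvec (Suc l) d w \<in> DIV (Suc l)" if "w \<in> DIV (Suc l)" for w
      using \<tau>D[of w] d(1)[of w] that by (simp add: D_def)
    show "matvec (Suc l) d v \<in> cvec (Suc l)" if "v \<in> cvec (Suc l)" for v by (rule d(2)[OF that])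
    show "matvec (Suc l) d (matvec (Suc l) d v) = v" if "v \<in> cvec (Suc l)" for v by (rule d(3)[OF that])
    show "matvec (Suc l) d (X z) = X z" if "z \<in> A" for z using fixX[OF that] d(1)[OF XD[OF that]] by simp
    \<comment> \<open>A point off the mirror of the reflection, as its last coordinate is nonzero;
      the factor 1/2 keeps it inside the domain. Injectivity of \<open>\<phi>\<close> shows that
      \<open>\<phi> v\<close> is moved.\<close>
    define v where "v = (\<lambda>i. (1/2) * unit_vec l i)"
    have "v \<in> D"
      unfolding D_def
    proof (rule small_in_DIV)
      show "v \<in> cvec (Suc l)" by (simp add: v_def cvec_def unit_vec_def)
      have "l1norm (Suc l) (unit_vec l) = 1" by (simp add: l1norm_def unit_vec_def)
      then show "l1norm (Suc l) v < 1" unfolding v_def l1norm_smult by simp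
    qed
    then have v: "v \<in> D" "\<phi> v \<in> D" using \<phi>D by auto
    have "\<tau> (\<phi> v) \<noteq> \<phi> v"
    proof
      assume "\<tau> (\<phi> v) = \<phi> v"
      then have "\<phi> (reflect l v) = \<phi> v" using v by (simp add: \<tau>_def \<xi>\<phi>)
      then have "reflect l v = v" using \<xi>\<phi>[OF v(1)] \<xi>\<phi>[OF \<sigma>D[OF v(1)]] by simp
      then have "reflect l v l = v l" by simp
      then show False by (simp add: reflect_def v_def unit_vec_def)
    qed
    then show "\<exists>w\<in>DIV (Suc l). matvec (Suc l) d w \<noteq> w"
      using v(2) d(1)[OF v(2)] by (intro bexI[of _ "\<phi> v"]) (simp_all add: D_def)
  qed
qed

lemma minimum_DIV_map_Mmap:
  assumes min: "minimum_ball_map n N (monomial_map n N c \<alpha>)" and N: "0 < N"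
    and \<theta>: "0 < \<theta>" "\<theta> < pi / 4" and K: "K \<le> N"
  shows "minimum_DIV_map n (Suc (N + K)) (Mmap N (monomial_map n N c \<alpha>) \<theta> (Suc K))"
proof -
  let ?F = "monomial_map n N c \<alpha>"
  interpret Mmap_setup n N K ?F \<theta>
    using min \<theta> K by unfold_locales (simp_all add: minimum_ball_map_def)
  let ?l = "N + K"
  let ?m = "Suc (N + K)"
  have "\<not> (\<exists>\<psi>\<in>Aut n (cball_unit n). \<exists>\<phi>\<in>Aut ?m (DIV ?m). \<exists>G.
          holo_map n (?m - 1) (cball_unit n) G \<and> maps_into G (cball_unit n) (DIV (?m - 1)) \<and>
          (\<forall>z\<in>cball_unit n. M z = \<phi> (G (\<psi> z))))"
  proof (intro notI, elim bexE exE conjE)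
    fix \<psi> \<phi> G
    assume \<psi>: "\<psi> \<in> Aut n (cball_unit n)" and \<phi>: "\<phi> \<in> Aut ?m (DIV ?m)"
      and G: "maps_into G (cball_unit n) (DIV (?m - 1))" and eq: "\<forall>z\<in>cball_unit n. M z = \<phi> (G (\<psi> z))"
    have \<psi>B: "\<psi> z \<in> cball_unit n" if "z \<in> cball_unit n" for z
      using \<psi> that by (auto simp: Aut_def bij_betw_def)
    have origin: "(\<lambda>i. 0) \<in> cball_unit n" by (simp add: cball_unit_def cvec_def)
    have F0: "?F (\<lambda>i. 0) j = 0" for j
    proof (cases "j < N")
      case True
      then obtain p where p: "p < n" "\<alpha> j p \<noteq> 0" using minimum_monomial_map(2)[OF min] by blast
      then have "(\<Prod>p<n. (0::complex) ^ \<alpha> j p) = 0" by (intro prod_zero) auto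
      then show ?thesis by (simp add: monomial_map_def)
    qed (simp add: monomial_map_def)
    have M0: "M (\<lambda>i. 0) = (\<lambda>i. 0)"
    proof
      fix p
      have h0: "h (\<lambda>i. 0) = 0" by (simp add: h_def S_def F0)
      show "M (\<lambda>i. 0) p = 0"
      proof (cases "p < ?m")
        case True
        then show ?thesis by (cases rule: M_components) (simp_all add: F0 h0)
      next
        case False
        then show ?thesis using M_simps(5)[of p] by simp
      qed
    qed
    obtain d where LD: "\<And>w. w \<in> DIV ?m \<Longrightarrow> matvec ?m d w \<in> DIV ?m"
      and Lc: "\<And>v. v \<in> cvec ?m \<Longrightarrow> matvec ?m d v \<in> cvec ?m"
      and LL: "\<And>v. v \<in> cvec ?m \<Longrightarrow> matvec ?m d (matvec ?m d v) = v"
      and fixM: "\<And>z. z \<in> cball_unit n \<Longrightarrow> matvec ?m d (M z) = M z"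
      and ne: "\<exists>w\<in>DIV ?m. matvec ?m d w \<noteq> w"
      by (rule DIV_section_involution[OF \<phi>, where A="cball_unit n" and Y="\<lambda>z. G (\<psi> z)" and X=M, OF _ _ origin M0])
         (use G eq \<psi>B in \<open>auto simp: maps_into_def\<close>)
    \<comment> \<open>The matrix minus the identity. It annihilates the image of \<open>M\<close>,
      so each of its rows is a linear relation between the coordinates of \<open>M\<close>.\<close>
    define A where "A q p = d q p - (if q = p then 1 else 0)" for q p
    have rel: "(\<Sum>p<?m. A q p * M z p) = 0" if "q < ?m" "z \<in> cball_unit n" for q z
    proof -
      have "(\<Sum>p<?m. A q p * M z p) = (\<Sum>p<?m. d q p * M z p - (if q = p then M z p else 0))"
        by (intro sum.cong refl) (simp add: A_def algebra_simps)
      also have "\<dots> = matvec ?m d (M z) q - M z q"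
        using that by (simp only: sum_subtractf matvec_def) (simp del: sum.lessThan_Suc)
      finally show ?thesis using fixM[OF that(2)] by simp
    qed
    \<comment> \<open>Row \<open>q\<close> applied to the coefficient vector of the
      \<open>j\<close>-th component: a split component occupies the coordinates \<open>2 * j\<close>
      and \<open>2 * j + 1\<close>, an unsplit one the coordinate \<open>j + K\<close>.\<close>
    define b where "b q j = (if j < K then A q (2 * j) * of_real (cos \<theta>) + A q (2 * j + 1) * (\<i> * of_real (sin \<theta>))
        else A q (j + K))" for q j
    have rel': "(\<Sum>j<N. b q j * ?F z j) + A q ?l * (1 - csqrt (1 - (\<Sum>j<N. of_real (\<kappa> j) * (?F z j)\<^sup>2))) = 0"
      if q: "q < ?m" and z: "z \<in> cball_unit n" for q z
    proof -
      have "0 = (\<Sum>j<N. if j < K then A q (2 * j) * (of_real (cos \<theta>) * ?F z j)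
            + A q (2 * j + 1) * (\<i> * of_real (sin \<theta>) * ?F z j) else A q (j + K) * ?F z j) + A q ?l * h z"
        using rel[OF q z] by (simp only: sum_M[of "\<lambda>x p. A q p * x"])
      also have "\<dots> = (\<Sum>j<N. b q j * ?F z j) + A q ?l * h z"
        by (intro arg_cong2[where f="(+)"] sum.cong refl) (simp add: b_def algebra_simps)
      finally show ?thesis by (simp add: h_def S_def)
    qed
    have A_last: "A q ?l = 0" and b0: "\<And>j. j < N \<Longrightarrow> b q j = 0" if "q < ?m" for q
      using monomials_and_sqrt_independent[OF min N \<kappa>_pos \<kappa>_le_1 rel'[OF that]] by auto
    have ec: "unit_vec ?l \<in> cvec ?m" by (auto simp: cvec_def unit_vec_def)
    have fix_last: "matvec ?m d (unit_vec ?l) = unit_vec ?l"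
    proof
      fix q
      show "matvec ?m d (unit_vec ?l) q = unit_vec ?l q"
      proof (cases "q < ?m")
        case True
        have "matvec ?m d (unit_vec ?l) q = d q ?l"
          by (simp add: matvec_def unit_vec_def)
        also have "\<dots> = (if q = ?l then 1 else 0)" using A_last[OF True] by (simp add: A_def)
        finally show ?thesis by (simp add: unit_vec_def)
      next
        case False
        then show ?thesis using Lc[OF ec] ec by (simp add: cvec_def)
      qed
    qed
    \<comment> \<open>For a split component \<open>b q j = 0\<close> is one complex equation for two
      entries of \<open>A\<close>. Reality of the entries, available once the last unit vector is
      known to be fixed, makes it two real ones.\<close>
    have real: "Im (A q p) = 0" if "q < ?m" "p < ?m" for q p
      using DIV_linear_involution_real[OF LD Lc LL fix_last that] by (simp add: A_def)
    have cs: "cos \<theta> \<noteq> 0" "sin \<theta> \<noteq> 0"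
      using cos_gt_zero[of \<theta>] sin_gt_zero[of \<theta>] \<theta> pi_gt_zero by auto
    have A0: "A q p = 0" if q: "q < ?m" and p: "p < ?m" for q p
    proof -
      consider (a) "p < 2 * K" | (b) "2 * K \<le> p" "p < ?l" | (c) "p = ?l" using p by linarith
      then show ?thesis
      proof cases
        case p2: a
        define j where "j = p div 2"
        have a: "j < K" "p = 2 * j \<or> p = 2 * j + 1" using p2 by (auto simp: j_def)
        have j: "j < N" "2 * j < ?m" "2 * j + 1 < ?m" using a(1) K by auto
        have "A q (2 * j) * of_real (cos \<theta>) + A q (2 * j + 1) * (\<i> * of_real (sin \<theta>)) = 0"
          using b0[OF q j(1)] a(1) by (simp add: b_def)
        then have "Re (A q (2 * j) * of_real (cos \<theta>) + A q (2 * j + 1) * (\<i> * of_real (sin \<theta>))) = 0"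
          "Im (A q (2 * j) * of_real (cos \<theta>) + A q (2 * j + 1) * (\<i> * of_real (sin \<theta>))) = 0" by simp_all
        \<comment> \<open>With real entries the cosine term is the real part of the equation and the
          sine term its imaginary part; neither factor vanishes.\<close>
        then have "Re (A q (2 * j)) = 0" "Re (A q (2 * j + 1)) = 0"
          using cs real[OF q j(2)] real[OF q j(3)] by simp_all
        then show ?thesis using a(2) real[OF q j(2)] real[OF q j(3)] by (auto simp: complex_eq_iff)
      next
        case b
        then have "p - K < N" "\<not> p - K < K" "p - K + K = p" by auto
        then show ?thesis using b0[OF q, of "p - K"] by (simp only: b_def if_False)
      next
        case c
        then show ?thesis using A_last[OF q] by simp
      qed
    qed
    have "matvec ?m d w = w" if w: "w \<in> cvec ?m" for w
    proof
      fix q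
      show "matvec ?m d w q = w q"
      proof (cases "q < ?m")
        case True
        have "matvec ?m d w q = (\<Sum>p<?m. if q = p then w p else 0)"
          unfolding matvec_def using A0[OF True] by (intro sum.cong refl) (auto simp: A_def)
        then show ?thesis using True by simp
      next
        case False
        then show ?thesis using Lc[OF w] w by (simp add: cvec_def)
      qed
    qed
    then show False using ne DIV_subset_cvec[of ?m] by auto
  qed
  moreover have "maps_into M (cball_unit n) (DIV ?m)" using M_in_DIV by (simp add: maps_into_def)
  ultimately have "minimum_DIV_map n ?m M"
    using holo_map_M unfolding minimum_DIV_map_def by simp
  then show ?thesis by (simp only: M_def)
qed

theorem mainTheorem4:
  fixes n N k :: nat and c :: "nat \<Rightarrow> real" and \<alpha> :: "nat \<Rightarrow> nat \<Rightarrow> nat" and \<theta> :: real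
  assumes "1 \<le> n" and "n \<le> N"
    and "minimum_ball_map n N (monomial_map n N c \<alpha>)"
    and "0 < \<theta>" and "\<theta> < pi / 4"
    and "1 \<le> k" and "k \<le> N + 1"
  shows "proper_holo n (N + k) (cball_unit n) (DIV (N + k)) (Mmap N (monomial_map n N c \<alpha>) \<theta> k)
       \<and> minimum_DIV_map n (N + k) (Mmap N (monomial_map n N c \<alpha>) \<theta> k)"
proof -
  obtain K where k: "k = Suc K" using assms(6) by (cases k) auto
  have K: "K \<le> N" and N: "0 < N" using assms(1,2,7) k by auto
  interpret Mmap_setup n N K "monomial_map n N c \<alpha>" \<theta>
    using assms K by unfold_locales (simp_all add: minimum_ball_map_def)
  show ?thesis
    using proper_holo_M minimum_DIV_map_Mmap[OF assms(3) N assms(4,5) K] by (simp add: M_def k)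
qed

end
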